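(* Let $W\subset X$ be domains in $\mathbb{C}^n$, let $\varphi:W\to\mathbb{R}\cup\{-\infty\}$ be an upper semicontinuous function, and let $\beta$ be a $W$-disc structure on $X$, with associated family of discs $\mathcal{B}$, such that $E_{\mathcal{B}}H_\varphi\le\varphi$ on $W$. Then $$ \sup\mathcal{F}_\varphi=E_WH_\varphi\quad\text{on } X, $$ that is, for every $x\in X$, $$ \sup\{u(x) : u\in\mathcal{PSH}(X),\ u|_W\le\varphi\}=\inf\left\{\int_{\mathbb{T}}\varphi\circ f\,d\sigma : f\in\mathcal{A}_X^W,\ f(0)=x\right\}. $$
   Context: A domain is a nonempty connected open set. $\mathbb{D}$ is the open unit disc in $\mathbb{C}$, $\mathbb{T}$ the unit circle, $\sigma$ arclength measure on $\mathbb{T}$ normalized to total mass one. $\mathcal{A}_X$ is the set of closed analytic discs in $X$: continuous maps $f:\overline{\mathbb{D}}\to X$ holomorphic on $\mathbb{D}$ (with the topology of uniform convergence); $\mathcal{A}_X^W$ is the set of $f\in\mathcal{A}_X$ with $f(\mathbb{T})\subset W$. $\mathcal{PSH}(X)$ is the set of plurisubharmonic functions on $X$ (the function identically $-\infty$ is allowed; equivalently the supremum of an empty family is $-\infty$). $\mathcal{F}_\varphi=\{u\in\mathcal{PSH}(X) : u|_W\le\varphi\}$ and $\sup\mathcal{F}_\varphi(x)=\sup\{u(x):u\in\mathcal{F}_\varphi\}$. For $f\in\mathcal{A}_X^W$, $H_\varphi(f)=\int_{\mathbb{T}}\varphi\circ f\,d\sigma$. For a family $\mathcal{C}\subset\mathcal{A}_X^W$,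 $E_{\mathcal{C}}H_\varphi(x)=\inf\{H_\varphi(f): f\in\mathcal{C},\ f(0)=x\}$, and $E_W=E_{\mathcal{A}_X^W}$. Two discs $f_0,f_1\in\mathcal{A}_X^W$ with $f_0(0)=f_1(0)$ are centre-homotopic if there is a continuous map $f:\overline{\mathbb{D}}\times[0,1]\to X$ such that $f(\cdot,t)\in\mathcal{A}_X^W$ for all $t\in[0,1]$, $f(\cdot,0)=f_0$, $f(\cdot,1)=f_1$, and $f(0,t)=f_0(0)=f_1(0)$ for all $t\in[0,1]$. A $W$-disc structure on $X$ is a family $\beta=(\beta_\nu)_\nu$ of continuous maps $\beta_\nu:U_\nu\to\mathcal{A}_X^W$, where $(U_\nu)_\nu$ is an open covering of $X$, such that $\beta_\nu(x)(0)=x$ for all $x\in U_\nu$, and $\beta_\nu(x)$ and $\beta_\mu(x)$ are centre-homotopic whenever $x\in U_\nu\cap U_\mu$. Its associated family of discs is $\mathcal{B}=\bigcup_\nu\beta_\nu(U_\nu)\subset\mathcal{A}_X^W$. *)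

theory Defs
  imports "HOL-Analysis.Analysis"
begin

definition circle_measure :: "complex measure" where
  "circle_measure =
     distr (uniform_measure lborel {0..2 * pi}) (restrict_space borel (sphere 0 1)) cis"

text \<open>Positive part minus negative part. All integrands below are upper semicontinuous and
  \<open>< \<infinity>\<close> on a compact set, so the first term is finite and the difference is
  the usual integral, with values in \<open>[-\<infinity>, \<infinity>)\<close>.\<close>

definition ereal_integral :: "'a measure \<Rightarrow> ('a \<Rightarrow> ereal) \<Rightarrow> ereal" where
  "ereal_integral M g =
     enn2ereal (\<integral>\<^sup>+ x. e2ennreal (g x) \<partial>M) - enn2ereal (\<integral>\<^sup>+ x. e2ennreal (- g x) \<partial>M)"

definition usc_on :: "'a::topological_space set \<Rightarrow> ('a \<Rightarrow> ereal) \<Rightarrow> bool" where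
  "usc_on S u \<longleftrightarrow> (\<forall>x\<in>S. u x \<noteq> \<infinity>) \<and> (\<forall>c. openin (top_of_set S) {x \<in> S. u x < c})"

text \<open>The function identically \<open>-\<infinity>\<close> counts as subharmonic and plurisubharmonic.\<close>

definition subharmonic_on :: "complex set \<Rightarrow> (complex \<Rightarrow> ereal) \<Rightarrow> bool" where
  "subharmonic_on S v \<longleftrightarrow> usc_on S v \<and>
     (\<forall>c r. r > 0 \<and> cball c r \<subseteq> S \<longrightarrow>
        v c \<le> ereal_integral circle_measure (\<lambda>z. v (c + of_real r * z)))"

definition PSH :: "(complex ^ 'n) set \<Rightarrow> (complex ^ 'n \<Rightarrow> ereal) set" where
  "PSH X = {u. usc_on X u \<and>
     (\<forall>a b. subharmonic_on {z. a + z *s b \<in> X} (\<lambda>z. u (a + z *s b)))}"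

text \<open>A closed analytic disc is represented by a function on all of \<open>\<complex>\<close>; only its
  values on the closed unit disc are relevant.\<close>

definition analytic_discs :: "(complex ^ 'n) set \<Rightarrow> (complex \<Rightarrow> complex ^ 'n) set" where
  "analytic_discs X = {f. continuous_on (cball 0 1) f \<and>
     (\<forall>i. (\<lambda>z. f z $ i) holomorphic_on ball 0 1) \<and> f ` cball 0 1 \<subseteq> X}"

definition analytic_discs_bdry ::
  "(complex ^ 'n) set \<Rightarrow> (complex ^ 'n) set \<Rightarrow> (complex \<Rightarrow> complex ^ 'n) set" where
  "analytic_discs_bdry X W = {f \<in> analytic_discs X. f ` sphere 0 1 \<subseteq> W}"

definition poisson_functional ::
  "(complex ^ 'n \<Rightarrow> ereal) \<Rightarrow> (complex \<Rightarrow> complex ^ 'n) \<Rightarrow> ereal" where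
  "poisson_functional \<phi> f = ereal_integral circle_measure (\<lambda>z. \<phi> (f z))"

definition disc_envelope ::
  "(complex \<Rightarrow> complex ^ 'n) set \<Rightarrow> ((complex \<Rightarrow> complex ^ 'n) \<Rightarrow> ereal) \<Rightarrow> complex ^ 'n \<Rightarrow> ereal" where
  "disc_envelope C H x = (INF f\<in>{f \<in> C. f 0 = x}. H f)"

definition centre_homotopic ::
  "(complex ^ 'n) set \<Rightarrow> (complex ^ 'n) set \<Rightarrow>
     (complex \<Rightarrow> complex ^ 'n) \<Rightarrow> (complex \<Rightarrow> complex ^ 'n) \<Rightarrow> bool" where
  "centre_homotopic X W f0 f1 \<longleftrightarrow>
     f0 \<in> analytic_discs_bdry X W \<and> f1 \<in> analytic_discs_bdry X W \<and> f0 0 = f1 0 \<and>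
     (\<exists>F :: complex \<times> real \<Rightarrow> complex ^ 'n.
        continuous_on (cball 0 1 \<times> {0..1}) F \<and>
        (\<forall>t\<in>{0..1}. (\<lambda>z. F (z, t)) \<in> analytic_discs_bdry X W) \<and>
        (\<forall>z\<in>cball 0 1. F (z, 0) = f0 z \<and> F (z, 1) = f1 z) \<and>
        (\<forall>t\<in>{0..1}. F (0, t) = f0 0))"

text \<open>The \<^const>\<open>uniform_limit\<close> condition is continuity of \<open>\<beta> \<nu>\<close> on
  \<open>U \<nu>\<close> for the topology of uniform convergence on the closed unit disc.\<close>

definition disc_structure ::
  "(complex ^ 'n) set \<Rightarrow> (complex ^ 'n) set \<Rightarrow> 'i set \<Rightarrow> ('i \<Rightarrow> (complex ^ 'n) set) \<Rightarrow>
     ('i \<Rightarrow> complex ^ 'n \<Rightarrow> complex \<Rightarrow> complex ^ 'n) \<Rightarrow> bool" where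
  "disc_structure X W I U \<beta> \<longleftrightarrow>
     (\<forall>\<nu>\<in>I. openin (top_of_set X) (U \<nu>)) \<and> (\<Union>\<nu>\<in>I. U \<nu>) = X \<and>
     (\<forall>\<nu>\<in>I. \<forall>x\<in>U \<nu>. \<beta> \<nu> x \<in> analytic_discs_bdry X W \<and> \<beta> \<nu> x 0 = x \<and>
        uniform_limit (cball 0 1) (\<beta> \<nu>) (\<beta> \<nu> x) (at x within U \<nu>)) \<and>
     (\<forall>\<nu>\<in>I. \<forall>\<mu>\<in>I. \<forall>x\<in>U \<nu> \<inter> U \<mu>. centre_homotopic X W (\<beta> \<nu> x) (\<beta> \<mu> x))"

definition disc_family ::
  "'i set \<Rightarrow> ('i \<Rightarrow> (complex ^ 'n) set) \<Rightarrow>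
     ('i \<Rightarrow> complex ^ 'n \<Rightarrow> complex \<Rightarrow> complex ^ 'n) \<Rightarrow> (complex \<Rightarrow> complex ^ 'n) set" where
  "disc_family I U \<beta> = (\<Union>\<nu>\<in>I. \<beta> \<nu> ` U \<nu>)"

end

theory Submission
  imports Defs "HOL-Complex_Analysis.Complex_Analysis" "HOL-Probability.Probability_Measure"
begin

text \<open>
  For \<open>u\<close> in the family on the left and a disc \<open>f\<close>, the submean inequality along \<open>f\<close> gives
  \<open>u (f 0) \<le> H \<phi> f\<close>, hence one inequality. As \<^const>\<open>PSH\<close> only tests affine discs, the submean
  inequality along holomorphic discs is obtained by a maximum principle argument.

  For the other inequality let \<open>D\<close> be the class of all discs that are centre-homotopic to a disc of the
  structure, \<open>v0\<close> the envelope over \<open>D\<close>, and \<open>v\<close> the Poletsky envelope of \<open>v0\<close> over all discs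
  in \<open>X\<close>, which is plurisubharmonic and satisfies \<open>v \<le> v0 \<le> \<phi>\<close> on \<open>W\<close>. That
  \<open>v\<close> is plurisubharmonic, and that it dominates the envelope over all discs with boundary in \<open>W\<close>, both
  follow from one patching construction: given a disc \<open>g\<close>, near-optimal discs centred at finitely many points of
  \<open>g\<close> on the circle are translated along arcs, joined by homotopies over very short arcs, and the resulting
  family \<open>F (z, w)\<close> is approximated by Laurent polynomials in \<open>z\<close>; then \<open>z \<mapsto> F (z, z ^ k)\<close> is
  the required disc for large \<open>k\<close>. Integrals are handled by adjoining to a disc a holomorphic function
  \<open>q\<close> with \<open>\<phi> \<circ> f < Re q\<close> on the circle, so that \<open>Re (q 0)\<close> bounds the integral and
  the construction takes place in \<open>X \<times> \<complex>\<close>.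
\<close>

section \<open>Integration over the unit circle\<close>

text \<open>The conclusion is a cycle of inequalities on X: \<open>v\<close> <= supremum <= envelope
  over all discs with boundary in W <= \<open>v\<close>. Two envelopes are taken because
  \<open>v0\<close> has no evident submean property: a patched disc has its boundary in W, but
  nothing is known about its homotopy class, so it bounds the envelope over all such discs and not
  \<open>v0\<close>. The class is enlarged from the discs of the structure to \<open>D\<close>
  because translates of a disc must stay in it; a disc centred at \<open>g z0\<close> is then moved
  along \<open>g\<close> by adding a vector. The obstacle in patching is continuity: near-optimal
  discs chosen at neighbouring points need not match where two arcs meet. Centre-homotopy of any two
  discs of \<open>D\<close> with a common centre bridges the gap, but along the homotopy \<phi> is
  controlled by a finite bound only. That bound is paid for by adding to the majorant a sum of
  Poisson kernels, nonnegative on the circle, huge at the finitely many junctions and of arbitrarily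
  small mean. For W = X any two discs with the same centre are homotopic by contraction, which is
  why the same construction yields the plurisubharmonicity of \<open>v\<close>.\<close>

lemma circle_density:
  "uniform_measure lborel {0..2 * pi} = density lborel (\<lambda>x. ennreal (indicator {0..2 * pi} x / (2 * pi)))"
  unfolding uniform_measure_def
proof (rule arg_cong[where f = "density lborel"], rule ext)
  fix x :: real
  have "(1::ennreal) / ennreal (2 * pi) = ennreal (1 / (2 * pi))"
    using divide_ennreal[of 1 "2 * pi"] pi_gt_zero by simp
  then show "indicator {0..2 * pi} x / emeasure lborel {0..2 * pi} =
      ennreal (indicator {0..2 * pi} x / (2 * pi))"
    by (simp add: indicator_def)
qed

lemma space_circle [simp]: "space circle_measure = sphere 0 1"
  by (simp add: circle_measure_def space_restrict_space)

lemma sets_circle: "sets circle_measure = sets (restrict_space borel (sphere 0 1))"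
  by (simp add: circle_measure_def)

lemma cis_measurable_circle:
  "cis \<in> measurable (uniform_measure lborel {0..2 * pi}) (restrict_space borel (sphere 0 1))"
proof (rule measurable_restrict_space2)
  have "cis \<in> borel_measurable borel"
    by (intro borel_measurable_continuous_onI continuous_intros)
  then show "cis \<in> measurable (uniform_measure lborel {0..2 * pi}) borel"
    by (simp cong: measurable_cong_sets)
qed (auto simp: dist_norm)

lemma prob_space_circle: "prob_space circle_measure"
  unfolding circle_measure_def
proof (rule prob_space.prob_space_distr)
  show "prob_space (uniform_measure lborel {0..2 * pi})"
    by (rule prob_space_uniform_measure) auto
qed (rule cis_measurable_circle)

lemma continuous_circle_measurable:
  "continuous_on (sphere 0 1) f \<Longrightarrow> f \<in> borel_measurable circle_measure"
  by (subst measurable_cong_sets[OF sets_circle refl]) (rule borel_measurable_continuous_on_restrict)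

lemma continuous_circle_integrable:
  fixes f :: "complex \<Rightarrow> real"
  assumes "continuous_on (sphere 0 1) f"
  shows "integrable circle_measure f"
proof -
  interpret prob_space circle_measure by (rule prob_space_circle)
  have "compact (f ` sphere 0 1)"
    using assms by (intro compact_continuous_image) auto
  then obtain B where B: "\<And>x. x \<in> sphere 0 1 \<Longrightarrow> norm (f x) \<le> B"
    by (meson bounded_iff compact_imp_bounded imageI)
  show ?thesis
  proof (rule integrable_const_bound)
    show "AE x in circle_measure. norm (f x) \<le> B"
      by (rule AE_I2) (use B in auto)
  qed (rule continuous_circle_measurable[OF assms])
qed

definition disc_algebra :: "(complex \<Rightarrow> complex) set" where
  "disc_algebra = {h. continuous_on (cball 0 1) h \<and> h holomorphic_on ball 0 1}"

text \<open>Cauchy's formula at 0, in the form that asks only for continuity up to the circle; the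
  factor 1/u of the kernel cancels against the derivative of the parametrization.\<close>

lemma circle_mean_value:
  assumes h: "h \<in> disc_algebra"
  shows "(LINT z|circle_measure. Re (h z)) = Re (h 0)"
proof -
  have c: "continuous_on (cball 0 1) h" and ho: "h holomorphic_on ball 0 1"
    using h by (auto simp: disc_algebra_def)
  have cs: "continuous_on (sphere 0 1) (\<lambda>z. Re (h z))"
    by (intro continuous_intros continuous_on_subset[OF c]) auto
  have cc: "continuous_on {0..2 * pi} (\<lambda>x. Re (h (cis x)))"
    by (intro continuous_on_compose2[OF cs] continuous_intros) (auto simp: dist_norm)
  have "((\<lambda>u. h u / (u - 0)) has_contour_integral (2 * of_real pi * \<i> * h 0)) (circlepath 0 1)"
    by (rule Cauchy_integral_circlepath[OF c ho]) auto
  then have "((\<lambda>t. h (0 + 1 * cis t) / (0 + 1 * cis t - 0) * 1 * \<i> * cis t) has_integral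
      2 * of_real pi * \<i> * h 0) {0..2 * pi}"
    unfolding circlepath_def by (subst (asm) has_contour_integral_part_circlepath_iff) auto
  then have "((\<lambda>t. \<i> * h (cis t)) has_integral 2 * of_real pi * \<i> * h 0) {0..2 * pi}"
    by (rule has_integral_eq[rotated]) (auto simp: field_simps)
  from has_integral_mult_right[OF this, of "-\<i>"]
  have "((\<lambda>t. h (cis t)) has_integral 2 * of_real pi * h 0) {0..2 * pi}"
    by (simp add: algebra_simps)
  from has_integral_Re[OF this]
  have I: "((\<lambda>t. Re (h (cis t))) has_integral 2 * pi * Re (h 0)) {0..2 * pi}"
    by simp
  have si: "set_integrable lborel {0..2 * pi} (\<lambda>x. Re (h (cis x)))"
    by (rule borel_integrable_compact[OF compact_Icc cc, folded set_integrable_def])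
  have "(LINT z|circle_measure. Re (h z)) = (LINT x|uniform_measure lborel {0..2 * pi}. Re (h (cis x)))"
    unfolding circle_measure_def
    by (rule integral_distr[OF cis_measurable_circle borel_measurable_continuous_on_restrict[OF cs]])
  also have "\<dots> = (LINT x|density lborel (\<lambda>x. ennreal (indicator {0..2 * pi} x / (2 * pi))). Re (h (cis x)))"
    by (simp add: circle_density)
  also have "\<dots> = (LINT x|lborel. (indicator {0..2 * pi} x / (2 * pi)) *\<^sub>R Re (h (cis x)))"
  proof (rule integral_density)
    have "(\<lambda>x. Re (h (cis x))) \<in> borel_measurable borel"
    proof -
      have "(\<lambda>z. Re (h z)) \<circ> cis \<in> borel_measurable borel"
        by (rule measurable_comp[of _ _ "restrict_space borel (sphere 0 1)"])
          (use borel_measurable_continuous_on_restrict[OF cs] in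
            \<open>auto intro!: measurable_restrict_space2 borel_measurable_continuous_onI continuous_intros\<close>)
      then show ?thesis by (simp add: o_def)
    qed
    then show "(\<lambda>x. Re (h (cis x))) \<in> borel_measurable lborel" by simp
  qed auto
  also have "\<dots> = (1 / (2 * pi)) * (LINT x:{0..2 * pi}|lborel. Re (h (cis x)))"
    unfolding set_lebesgue_integral_def
    by (subst integral_mult_right_zero[symmetric], rule Bochner_Integration.integral_cong) auto
  also have "(LINT x:{0..2 * pi}|lborel. Re (h (cis x))) = 2 * pi * Re (h 0)"
    using set_borel_integral_eq_integral(2)[OF si] integral_unique[OF I] by simp
  finally show ?thesis by simp
qed

text \<open>Nonnegative integrals are monotone for arbitrary functions, so measurability does not
  enter and majorants can be compared with functions of which nothing is known.\<close>

lemma ereal_integral_mono: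
  assumes "\<And>x. x \<in> space M \<Longrightarrow> f x \<le> g x"
  shows "ereal_integral M f \<le> ereal_integral M g"
  unfolding ereal_integral_def
  by (intro ereal_minus_mono; subst less_eq_ennreal.rep_eq[symmetric]; intro nn_integral_mono e2ennreal_mono)
    (auto simp: assms)

lemma ereal_integral_real:
  fixes f :: "'a \<Rightarrow> real"
  assumes "integrable M f"
  shows "ereal_integral M (\<lambda>x. ereal (f x)) = ereal (integral\<^sup>L M f)"
proof -
  have *: "e2ennreal (ereal r) = ennreal r" for r
    by (simp add: ennreal.abs_eq e2ennreal_def)
  have f1: "(\<integral>\<^sup>+ x. ennreal (f x) \<partial>M) < \<infinity>" and f2: "(\<integral>\<^sup>+ x. ennreal (- f x) \<partial>M) < \<infinity>"
    using assms real_integrable_def by (auto simp: top.not_eq_extremum)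
  show ?thesis
    unfolding ereal_integral_def real_lebesgue_integral_def[OF assms] * uminus_ereal.simps
    using f1 f2 by (cases "\<integral>\<^sup>+ x. ennreal (f x) \<partial>M"; cases "\<integral>\<^sup>+ x. ennreal (- f x) \<partial>M") auto
qed

text \<open>One half of the principle that the integral of an upper semicontinuous function over the
  circle is the infimum of \<open>Re (h 0)\<close> over its disc algebra majorants; the other half
  is \<open>usc_circle_disc_algebra_majorant\<close>.\<close>

lemma ereal_integral_le_disc_algebra:
  assumes "h \<in> disc_algebra" "\<And>z. z \<in> sphere 0 1 \<Longrightarrow> q z \<le> ereal (Re (h z))"
  shows "ereal_integral circle_measure q \<le> ereal (Re (h 0))"
proof -
  have "continuous_on (sphere 0 1) (\<lambda>z. Re (h z))"
    using assms(1) by (auto simp: disc_algebra_def intro!: continuous_intros continuous_on_subset[where s="cball 0 1"])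
  then have "ereal_integral circle_measure (\<lambda>z. ereal (Re (h z))) = ereal (Re (h 0))"
    using ereal_integral_real[OF continuous_circle_integrable] circle_mean_value[OF assms(1)] by simp
  moreover have "ereal_integral circle_measure q \<le> ereal_integral circle_measure (\<lambda>z. ereal (Re (h z)))"
    by (intro ereal_integral_mono) (use assms in auto)
  ultimately show ?thesis by simp
qed

section \<open>Majorants of upper semicontinuous functions on the circle\<close>

lemma usc_onD: "usc_on S u \<Longrightarrow> x \<in> S \<Longrightarrow> u x \<noteq> \<infinity>"
  by (simp add: usc_on_def)

lemma usc_on_less_ball:
  fixes u :: "'a::metric_space \<Rightarrow> ereal"
  assumes "usc_on S u" "x \<in> S" "u x < c"
  obtains d where "d > 0" "\<And>y. y \<in> S \<Longrightarrow> dist y x < d \<Longrightarrow> u y < c"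
proof -
  have "openin (top_of_set S) {y \<in> S. u y < c}"
    using assms by (simp add: usc_on_def)
  then show ?thesis
    using assms that unfolding openin_euclidean_subtopology_iff by blast
qed

lemma usc_on_compact_bounded:
  fixes u :: "'a::metric_space \<Rightarrow> ereal"
  assumes "usc_on S u" "compact S"
  obtains M :: real where "\<And>x. x \<in> S \<Longrightarrow> u x < ereal M"
proof -
  have op: "\<And>n::nat. \<exists>T. open T \<and> {x \<in> S. u x < ereal (real n)} = S \<inter> T"
    using assms(1) by (simp add: usc_on_def openin_open)
  then obtain T where T: "\<And>n::nat. open (T n)" "\<And>n. {x \<in> S. u x < ereal (real n)} = S \<inter> T n"
    by metis
  have "S \<subseteq> (\<Union>n\<in>UNIV. T n)"
  proof
    fix x assume x: "x \<in> S"
    have "u x \<noteq> \<infinity>" using assms(1) x by (rule usc_onD)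
    then obtain r where "u x \<le> ereal r" by (cases "u x") auto
    moreover obtain n :: nat where "r < real n" using reals_Archimedean2 by blast
    ultimately have "u x < ereal (real n)" by (meson ereal_less(2) less_ereal.simps(1) order_le_less_trans)
    then show "x \<in> (\<Union>n\<in>UNIV. T n)" using x T(2) by blast
  qed
  then obtain C where C: "finite C" "S \<subseteq> (\<Union>n\<in>C. T n)"
    using compactE_image[OF assms(2), of UNIV T] T(1) by auto
  show ?thesis
  proof (rule that[of "real (Max (insert 0 C))"])
    fix x assume "x \<in> S"
    then obtain n where n: "n \<in> C" "u x < ereal (real n)" using C(2) T(2) by blast
    then have "n \<le> Max (insert 0 C)" using C(1) by auto
    then show "u x < ereal (real (Max (insert 0 C)))"
      using n(2) by (meson ereal_less_eq(3) of_nat_le_iff order_less_le_trans)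
  qed
qed

lemma usc_circle_measurable:
  assumes "usc_on (sphere 0 1) q"
  shows "q \<in> borel_measurable circle_measure"
proof (rule borel_measurableI_less)
  fix y
  have "openin (top_of_set (sphere 0 1)) {x \<in> sphere 0 1. q x < y}"
    using assms by (simp add: usc_on_def)
  then obtain T where "open T" "{x \<in> sphere 0 1. q x < y} = sphere 0 1 \<inter> T"
    unfolding openin_open by blast
  then show "{x \<in> space circle_measure. q x < y} \<in> sets circle_measure"
    by (auto simp: sets_circle sets_restrict_space)
qed

text \<open>The functions \<open>\<psi> k\<close> are the \<open>k\<close>-Lipschitz upper envelopes of \<open>q\<close>.\<close>

lemma usc_decreasing_continuous:
  fixes q :: "'a::metric_space \<Rightarrow> ereal"
  assumes q: "usc_on S q" and bd: "\<And>x. x \<in> S \<Longrightarrow> q x \<le> ereal M" and M: "M \<ge> 0"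
  obtains \<psi> :: "nat \<Rightarrow> 'a \<Rightarrow> real" where
    "\<And>k. continuous_on S (\<psi> k)"
    "\<And>k x. x \<in> S \<Longrightarrow> \<psi> (Suc k) x \<le> \<psi> k x"
    "\<And>k x. x \<in> S \<Longrightarrow> q x \<le> ereal (\<psi> k x)"
    "\<And>k x. x \<in> S \<Longrightarrow> \<psi> k x \<le> M"
    "\<And>x c. x \<in> S \<Longrightarrow> q x < ereal c \<Longrightarrow> \<exists>k. \<psi> k x \<le> c"
proof -
  \<comment> \<open>Truncation at \<open>- real k\<close> makes the values real, so that the
    supremum below is taken in the reals; the bound by \<open>M\<close> survives because
    \<open>M \<ge> 0\<close>.\<close>
  define r where "r k y = real_of_ereal (max (q y) (ereal (- real k)))" for k :: nat and y
  have r: "ereal (r k y) = max (q y) (ereal (- real k))" if "y \<in> S" for k y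
    using usc_onD[OF q that] by (cases "q y") (auto simp: r_def max_def)
  have rM: "r k y \<le> M" if "y \<in> S" for k y
  proof -
    have "ereal (r k y) \<le> ereal M" unfolding r[OF that] using bd[OF that] M by auto
    then show ?thesis by simp
  qed
  have r_mono: "r (Suc k) y \<le> r k y" if "y \<in> S" for k y
  proof -
    have "ereal (r (Suc k) y) \<le> ereal (r k y)"
      unfolding r[OF that] by (intro max.mono) auto
    then show ?thesis by simp
  qed
  define \<psi> where "\<psi> k x = (SUP y\<in>S. r k y - real k * dist x y)" for k :: nat and x
  have bdd: "bdd_above ((\<lambda>y. r k y - real k * dist x y) ` S)" for k x
  proof (rule bdd_aboveI2)
    fix y assume "y \<in> S"
    moreover have "0 \<le> real k * dist x y" by simp
    ultimately show "r k y - real k * dist x y \<le> M" using rM[of y k] by linarith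
  qed
  have up: "r k y - real k * dist x y \<le> \<psi> k x" if "y \<in> S" for k x y
    unfolding \<psi>_def using that bdd by (rule cSUP_upper)
  have least: "\<psi> k x \<le> B" if "S \<noteq> {}" "\<And>y. y \<in> S \<Longrightarrow> r k y - real k * dist x y \<le> B" for k x B
    unfolding \<psi>_def using that by (rule cSUP_least)
  have lip: "\<psi> k x \<le> \<psi> k x' + real k * dist x x'" if "S \<noteq> {}" for k x x'
  proof (rule least[OF that])
    fix y assume y: "y \<in> S"
    have "real k * dist x' y \<le> real k * (dist x x' + dist x y)"
      by (intro mult_left_mono dist_triangle3) auto
    then show "r k y - real k * dist x y \<le> \<psi> k x' + real k * dist x x'"
      using up[OF y, of k x'] by (simp add: algebra_simps)
  qed
  show ?thesis
  proof (rule that[of \<psi>])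
    show "continuous_on S (\<psi> k)" for k
    proof (cases "S = {}")
      case False
      show ?thesis
      proof (rule continuous_onI)
        fix x and e :: real assume "x \<in> S" "e > 0"
        show "\<exists>d>0. \<forall>x'\<in>S. dist x' x < d \<longrightarrow> dist (\<psi> k x') (\<psi> k x) \<le> e"
        proof (intro exI[of _ "e / (real k + 1)"] conjI ballI impI)
          fix x' assume "x' \<in> S" and d: "dist x' x < e / (real k + 1)"
          have "real k * dist x' x \<le> (real k + 1) * dist x' x" by (simp add: algebra_simps)
          also have "\<dots> \<le> e" using d by (simp add: field_simps)
          finally show "dist (\<psi> k x') (\<psi> k x) \<le> e"
            using lip[OF False, of k x x'] lip[OF False, of k x' x] 
            by (simp add: dist_real_def abs_le_iff dist_commute)
        qed (use \<open>e > 0\<close> in auto)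
      qed
    qed auto
    show "\<psi> (Suc k) x \<le> \<psi> k x" if "x \<in> S" for k x
    proof (rule least)
      fix y assume y: "y \<in> S"
      have "real k * dist x y \<le> real (Suc k) * dist x y" by (intro mult_right_mono) auto
      then show "r (Suc k) y - real (Suc k) * dist x y \<le> \<psi> k x"
        using up[OF y, of k x] r_mono[OF y, of k] by linarith
    qed (use that in auto)
    show "q x \<le> ereal (\<psi> k x)" if "x \<in> S" for k x
    proof -
      have "q x \<le> ereal (r k x)" by (simp add: r[OF that])
      also have "\<dots> \<le> ereal (\<psi> k x)" using up[OF that, of k x] by simp
      finally show ?thesis .
    qed
    show "\<psi> k x \<le> M" if "x \<in> S" for k x
    proof (rule least)
      fix y assume "y \<in> S"
      moreover have "0 \<le> real k * dist x y" by simp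
      ultimately show "r k y - real k * dist x y \<le> M" using rM[of y k] by linarith
    qed (use that in auto)
    show "\<exists>k. \<psi> k x \<le> c" if x: "x \<in> S" and c: "q x < ereal c" for x c
    proof -
      obtain d where d: "d > 0" "\<And>y. y \<in> S \<Longrightarrow> dist y x < d \<Longrightarrow> q y < ereal c"
        using usc_on_less_ball[OF q x c] by blast
      \<comment> \<open>\<open>k1\<close> pushes the truncation level below \<open>c\<close>;
        \<open>k2\<close> makes the Lipschitz penalty at distance at least \<open>d\<close> absorb
        the excess of \<open>M\<close> over \<open>c\<close>. Near and far points are then both
        bounded by \<open>c\<close>.\<close>
      obtain k1 :: nat where k1: "- c \<le> real k1" using real_arch_simple by blast
      obtain k2 :: nat where k2: "(M - c) / d \<le> real k2" using real_arch_simple by blast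
      define k where "k = max k1 k2"
      have ka: "- real k \<le> c" "(M - c) \<le> real k * d"
        using k1 k2 d(1) by (auto simp: k_def field_simps max_def intro: order_trans)
      have "\<psi> k x \<le> c"
      proof (rule least)
        fix y assume y: "y \<in> S"
        show "r k y - real k * dist x y \<le> c"
        proof (cases "dist y x < d")
          case True
          have "ereal (r k y) \<le> ereal c"
            unfolding r[OF y] using d(2)[OF y True] ka(1) by (auto intro: less_imp_le)
          moreover have "0 \<le> real k * dist x y" by simp
          ultimately show ?thesis unfolding ereal_less_eq by linarith
        next
          case False
          then have "real k * d \<le> real k * dist x y"
            by (intro mult_left_mono) (auto simp: dist_commute)
          then show ?thesis using rM[OF y, of k] ka(2) by linarith
        qed
      qed (use x in auto)
      then show ?thesis by blast
    qed
  qed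
qed

text \<open>Monotone convergence applies to the nonnegative function M - q. The signed integral is
  recovered from the pointwise identity q^- + M = q^+ + (M - q), which subtracts no
  integrals.\<close>

lemma ereal_integral_shift:
  assumes "prob_space \<mu>" "q \<in> borel_measurable \<mu>" and bd: "\<And>x. x \<in> space \<mu> \<Longrightarrow> q x \<le> ereal M" and "M \<ge> 0"
    and le: "(\<integral>\<^sup>+ x. e2ennreal (ereal M - q x) \<partial>\<mu>) \<le> ennreal (M - a)" and "a \<le> M"
  shows "ereal a \<le> ereal_integral \<mu> q"
proof -
  interpret prob_space \<mu> by fact
  note [measurable] = assms(2)
  have pw: "e2ennreal (- q x) + ennreal M = e2ennreal (q x) + e2ennreal (ereal M - q x)"
    if "x \<in> space \<mu>" for x
  proof (cases "q x")
    case (real r)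
    then have "r \<le> M" using bd[OF that] by simp
    then show ?thesis
      using real \<open>M \<ge> 0\<close>
      by (cases "r \<ge> 0") (auto simp: ennreal_neg ennreal_plus[symmetric] simp del: ennreal_plus)
  qed (use bd[OF that] in \<open>auto simp: e2ennreal_neg\<close>)
  have "(\<integral>\<^sup>+ x. e2ennreal (- q x) \<partial>\<mu>) + ennreal M = (\<integral>\<^sup>+ x. e2ennreal (- q x) + ennreal M \<partial>\<mu>)"
    by (subst nn_integral_add) (auto simp: emeasure_space_1)
  also have "\<dots> = (\<integral>\<^sup>+ x. e2ennreal (q x) + e2ennreal (ereal M - q x) \<partial>\<mu>)"
    by (intro nn_integral_cong pw)
  also have "\<dots> = (\<integral>\<^sup>+ x. e2ennreal (q x) \<partial>\<mu>) + (\<integral>\<^sup>+ x. e2ennreal (ereal M - q x) \<partial>\<mu>)"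
    by (subst nn_integral_add) auto
  also have "\<dots> \<le> (\<integral>\<^sup>+ x. e2ennreal (q x) \<partial>\<mu>) + ennreal (M - a)"
    using le by (intro add_left_mono)
  finally have key: "(\<integral>\<^sup>+ x. e2ennreal (- q x) \<partial>\<mu>) + ennreal M \<le> (\<integral>\<^sup>+ x. e2ennreal (q x) \<partial>\<mu>) + ennreal (M - a)" .
  have "(\<integral>\<^sup>+ x. e2ennreal (q x) \<partial>\<mu>) \<le> (\<integral>\<^sup>+ x. ennreal M \<partial>\<mu>)"
    by (intro nn_integral_mono) (use bd e2ennreal_mono[of "q _" "ereal M"] in auto)
  then have "(\<integral>\<^sup>+ x. e2ennreal (q x) \<partial>\<mu>) \<le> ennreal M" by (simp add: emeasure_space_1)
  then obtain A where A: "A \<ge> 0" "(\<integral>\<^sup>+ x. e2ennreal (q x) \<partial>\<mu>) = ennreal A"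
    by (cases "\<integral>\<^sup>+ x. e2ennreal (q x) \<partial>\<mu>") (auto simp: top_unique)
  obtain B where B: "B \<ge> 0" "(\<integral>\<^sup>+ x. e2ennreal (- q x) \<partial>\<mu>) = ennreal B"
    using key A by (cases "\<integral>\<^sup>+ x. e2ennreal (- q x) \<partial>\<mu>") (auto simp: top_unique)
  have "B + M \<le> A + (M - a)"
    using key A B \<open>M \<ge> 0\<close> \<open>a \<le> M\<close> by (simp add: ennreal_plus[symmetric] del: ennreal_plus)
  then show ?thesis unfolding ereal_integral_def A(2) B(2) using A(1) B(1) by simp
qed

text \<open>The Lipschitz envelopes decrease to \<open>q\<close>, so M minus them increases to M -
  q, and monotone convergence brings the integral of one of them below \<open>a\<close>. This covers
  the case that \<open>q\<close> has integral minus infinity.\<close>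

lemma usc_circle_continuous_majorant:
  assumes q: "usc_on (sphere 0 1) q" and a: "ereal_integral circle_measure q < ereal a"
  obtains \<psi> :: "complex \<Rightarrow> real" where "continuous_on (sphere 0 1) \<psi>"
    "\<And>z. z \<in> sphere 0 1 \<Longrightarrow> q z \<le> ereal (\<psi> z)" "(LINT z|circle_measure. \<psi> z) < a"
proof -
  interpret prob_space circle_measure by (rule prob_space_circle)
  obtain M0 where M0: "\<And>x. x \<in> sphere 0 1 \<Longrightarrow> q x < ereal M0"
    using usc_on_compact_bounded[OF q] by auto
  \<comment> \<open>The bound is enlarged to dominate 0 and \<open>a\<close>, as
    \<open>ereal_integral_shift\<close> requires.\<close>
  define M where "M = max M0 (max a 0)"
  have M: "q x \<le> ereal M" if "x \<in> sphere 0 1" for x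
  proof -
    have "q x \<le> ereal M0" using M0[OF that] by simp
    also have "\<dots> \<le> ereal M" by (simp add: M_def)
    finally show ?thesis .
  qed
  have M_ge: "M \<ge> 0" "a \<le> M" by (auto simp: M_def)
  obtain \<psi> :: "nat \<Rightarrow> complex \<Rightarrow> real" where
    c: "\<And>k. continuous_on (sphere 0 1) (\<psi> k)"
    and d: "\<And>k x. x \<in> sphere 0 1 \<Longrightarrow> \<psi> (Suc k) x \<le> \<psi> k x"
    and ge: "\<And>k x. x \<in> sphere 0 1 \<Longrightarrow> q x \<le> ereal (\<psi> k x)"
    and le: "\<And>k x. x \<in> sphere 0 1 \<Longrightarrow> \<psi> k x \<le> M"
    and lim: "\<And>x c. x \<in> sphere 0 1 \<Longrightarrow> q x < ereal c \<Longrightarrow> \<exists>k. \<psi> k x \<le> c"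
    using usc_decreasing_continuous[OF q M M_ge(1)] by metis
  have "\<exists>k. (LINT z|circle_measure. \<psi> k z) < a"
  proof (rule ccontr)
    assume "\<not> ?thesis"
    then have n: "a \<le> (LINT z|circle_measure. \<psi> k z)" for k by (simp add: not_less)
    have sup: "e2ennreal (ereal M - q z) \<le> (SUP k. ennreal (M - \<psi> k z))" if z: "z \<in> sphere 0 1" for z
    proof (rule ennreal_le_epsilon)
      fix e' :: real assume "e' > 0" and fin: "(SUP k. ennreal (M - \<psi> k z)) < top"
      then obtain s where s: "s \<ge> 0" "(SUP k. ennreal (M - \<psi> k z)) = ennreal s"
        by (cases "SUP k. ennreal (M - \<psi> k z)") auto
      have "ereal (M - s - e') \<le> q z"
      proof (rule ccontr)
        assume "\<not> ?thesis"
        then obtain k where k: "\<psi> k z \<le> M - s - e'" using lim[OF z] by (auto simp: not_le)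
        have "ennreal (M - \<psi> k z) \<le> ennreal s" unfolding s(2)[symmetric] by (rule SUP_upper) auto
        then show False using k \<open>e' > 0\<close> s(1) by (simp add: ennreal_le_iff)
      qed
      then have "ereal M - q z \<le> ereal (s + e')"
        using usc_onD[OF q z] by (cases "q z") auto
      then have "e2ennreal (ereal M - q z) \<le> ennreal (s + e')"
        by (metis e2ennreal_ereal e2ennreal_mono)
      then show "e2ennreal (ereal M - q z) \<le> (SUP k. ennreal (M - \<psi> k z)) + ennreal e'"
        using s \<open>e' > 0\<close> by (simp add: ennreal_plus)
    qed
    have "(\<integral>\<^sup>+ z. e2ennreal (ereal M - q z) \<partial>circle_measure) \<le> (\<integral>\<^sup>+ z. (SUP k. ennreal (M - \<psi> k z)) \<partial>circle_measure)"
      by (intro nn_integral_mono) (use sup in auto)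
    \<comment> \<open>The value 0 off the circle makes the sequence monotone at every point of the
      type, as \<open>incseq\<close> demands.\<close>
    also have "\<dots> = (\<integral>\<^sup>+ z. (SUP k. ennreal (M - (if z \<in> sphere 0 1 then \<psi> k z else 0))) \<partial>circle_measure)"
      by (intro nn_integral_cong) auto
    also have "\<dots> = (SUP k. \<integral>\<^sup>+ z. ennreal (M - (if z \<in> sphere 0 1 then \<psi> k z else 0)) \<partial>circle_measure)"
    proof (rule nn_integral_monotone_convergence_SUP)
      show "incseq (\<lambda>k z. ennreal (M - (if z \<in> sphere 0 1 then \<psi> k z else 0)))"
        by (rule incseq_SucI) (auto simp: le_fun_def intro!: ennreal_leI d)
      fix k
      have "(\<lambda>z. (if z \<in> sphere 0 1 then \<psi> k z else 0)) \<in> borel_measurable circle_measure"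
        by (subst measurable_cong[of _ _ "\<psi> k"]) (auto intro: continuous_circle_measurable c)
      then show "(\<lambda>z. ennreal (M - (if z \<in> sphere 0 1 then \<psi> k z else 0))) \<in> borel_measurable circle_measure"
        by simp
    qed
    also have "\<dots> = (SUP k. \<integral>\<^sup>+ z. ennreal (M - \<psi> k z) \<partial>circle_measure)"
      by (intro SUP_cong refl nn_integral_cong) auto
    also have "\<dots> \<le> ennreal (M - a)"
    proof (rule SUP_least)
      fix k
      have i: "integrable circle_measure (\<psi> k)" by (rule continuous_circle_integrable[OF c])
      have "(\<integral>\<^sup>+ z. ennreal (M - \<psi> k z) \<partial>circle_measure) = ennreal (LINT z|circle_measure. (M - \<psi> k z))"
        by (rule nn_integral_eq_integral) (use i le in \<open>auto intro!: AE_I2\<close>)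
      also have "(LINT z|circle_measure. (M - \<psi> k z)) = M - (LINT z|circle_measure. \<psi> k z)"
        using i by (simp add: prob_space[unfolded space_circle])
      finally show "(\<integral>\<^sup>+ z. ennreal (M - \<psi> k z) \<partial>circle_measure) \<le> ennreal (M - a)"
        using n[of k] by (auto intro!: ennreal_leI)
    qed
    finally have "ereal a \<le> ereal_integral circle_measure q"
      using ereal_integral_shift[OF prob_space_circle usc_circle_measurable[OF q], of M a] M M_ge by auto
    then show False using a by simp
  qed
  then show ?thesis using that c ge by blast
qed


section \<open>Laurent polynomials on the circle\<close>

definition laurent :: "nat \<Rightarrow> complex poly \<Rightarrow> complex \<Rightarrow> complex" where
  "laurent m p z = poly p z / z ^ m"

lemma laurent_const: "\<exists>m p. \<forall>z\<in>sphere 0 1. c = laurent m p z"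
  by (intro exI[of _ 0] exI[of _ "[:c:]"]) (simp add: laurent_def)

lemma laurent_add:
  assumes "\<forall>z\<in>sphere 0 1. f z = laurent m p z" "\<forall>z\<in>sphere 0 1. g z = laurent n q z"
  shows "\<exists>m p. \<forall>z\<in>sphere 0 1. f z + g z = laurent m p z"
proof (intro exI ballI)
  fix z :: complex assume z: "z \<in> sphere 0 1"
  then have "z \<noteq> 0" by auto
  then show "f z + g z = laurent (m + n) (p * monom 1 n + q * monom 1 m) z"
    using assms z by (simp add: laurent_def poly_monom field_simps power_add)
qed

lemma laurent_mult:
  assumes "\<forall>z\<in>sphere 0 1. f z = laurent m p z" "\<forall>z\<in>sphere 0 1. g z = laurent n q z"
  shows "\<exists>m p. \<forall>z\<in>sphere 0 1. f z * g z = laurent m p z"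
  by (intro exI[of _ "m + n"] exI[of _ "p * q"]) (use assms in \<open>auto simp: laurent_def power_add\<close>)

text \<open>On the circle \<open>cnj z = 1 / z\<close>, so real and imaginary part, and with them
  every real linear functional, are Laurent polynomials there.\<close>

lemma real_polynomial_laurent:
  assumes "real_polynomial_function f"
  shows "\<exists>m p. \<forall>z\<in>sphere 0 1. complex_of_real (f z) = laurent m p z"
  using assms
proof induction
  case (linear f)
  interpret bounded_linear f by fact
  show ?case
  proof (intro exI ballI)
    fix z :: complex assume z: "z \<in> sphere 0 1"
    then have "z * cnj z = 1" by (simp add: complex_norm_square[symmetric])
    moreover from this have "z \<noteq> 0" by auto
    ultimately have cz: "cnj z = 1 / z" "z \<noteq> 0" by (auto simp: eq_divide_eq mult.commute)
    have "Re z *\<^sub>R 1 + Im z *\<^sub>R \<i> = z" by (simp add: complex_eq_iff)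
    then have "f z = f (Re z *\<^sub>R 1 + Im z *\<^sub>R \<i>)" by simp
    also have "\<dots> = Re z * f 1 + Im z * f \<i>" by (simp add: add scaleR)
    finally have "complex_of_real (f z) = of_real (Re z) * of_real (f 1) + of_real (Im z) * of_real (f \<i>)" by simp
    moreover have "complex_of_real (Re z) = (z + 1 / z) / 2"
      unfolding cz(1)[symmetric] by (simp add: complex_add_cnj)
    moreover have "complex_of_real (Im z) = (z - 1 / z) * (- \<i> / 2)"
      unfolding cz(1)[symmetric] by (simp add: complex_diff_cnj)
    moreover have "(z + 1 / z) / 2 * A + (z - 1 / z) * (- \<i> / 2) * B = laurent 1 [:A / 2 + \<i> / 2 * B, 0, A / 2 - \<i> / 2 * B:] z" for A B
    proof -
      have "laurent 1 [:A / 2 + \<i> / 2 * B, 0, A / 2 - \<i> / 2 * B:] z = (A / 2 + \<i> / 2 * B) / z + z * (A / 2 - \<i> / 2 * B)"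
        using cz(2) by (simp add: laurent_def add_divide_distrib)
      also have "\<dots> = (z + 1 / z) / 2 * A + (z - 1 / z) * (- \<i> / 2) * B"
        by (simp add: algebra_simps add_divide_distrib diff_divide_distrib)
      finally show ?thesis by simp
    qed
    ultimately show "complex_of_real (f z) = laurent 1 [:complex_of_real (f 1) / 2 + \<i> / 2 * complex_of_real (f \<i>), 0,
        complex_of_real (f 1) / 2 - \<i> / 2 * complex_of_real (f \<i>):] z" by simp
  qed
next
  case (const c)
  show ?case by (rule laurent_const)
next
  case (add f g)
  then show ?case using laurent_add[of "\<lambda>z. of_real (f z)" _ _ "\<lambda>z. of_real (g z)"] by auto
next
  case (mult f g)
  then show ?case using laurent_mult[of "\<lambda>z. of_real (f z)" _ _ "\<lambda>z. of_real (g z)"] by auto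
qed

lemma continuous_circle_laurent:
  fixes f :: "complex \<Rightarrow> real"
  assumes "continuous_on (sphere 0 1) f" "e > 0"
  obtains m p where "\<And>z. z \<in> sphere 0 1 \<Longrightarrow> norm (of_real (f z) - laurent m p z) < e"
proof -
  obtain g where g: "real_polynomial_function g" "\<And>z. z \<in> sphere 0 1 \<Longrightarrow> \<bar>f z - g z\<bar> < e"
    using Stone_Weierstrass_real_polynomial_function[OF _ assms] by auto
  obtain m p where mp: "\<forall>z\<in>sphere 0 1. complex_of_real (g z) = laurent m p z"
    using real_polynomial_laurent[OF g(1)] by blast
  show ?thesis
  proof (rule that)
    fix z :: complex assume "z \<in> sphere 0 1"
    then have "norm (of_real (f z) - laurent m p z) = norm (complex_of_real (f z - g z))"
      using mp by simp
    then show "norm (of_real (f z) - laurent m p z) < e"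
      using g(2)[OF \<open>z \<in> sphere 0 1\<close>] unfolding norm_of_real by simp
  qed
qed

text \<open>On the circle \<open>c / z^j\<close> and \<open>cnj c * z^j\<close> have the same real part.\<close>

lemma laurent_Re_disc_algebra:
  obtains h where "h \<in> disc_algebra" "\<And>z. z \<in> sphere 0 1 \<Longrightarrow> Re (h z) = Re (laurent m p z)"
proof -
  define h where "h z = (\<Sum>i\<le>degree p. if m \<le> i then coeff p i * z ^ (i - m) else cnj (coeff p i) * z ^ (m - i))" for z
  show ?thesis
  proof (rule that[of h])
    have "h holomorphic_on UNIV"
      unfolding h_def
    proof (rule holomorphic_on_sum)
      show "(\<lambda>z. if m \<le> i then coeff p i * z ^ (i - m) else cnj (coeff p i) * z ^ (m - i)) holomorphic_on UNIV" for i
        by (cases "m \<le> i") (auto intro!: holomorphic_intros)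
    qed
    then show "h \<in> disc_algebra"
      by (auto simp: disc_algebra_def intro: holomorphic_on_subset continuous_on_subset holomorphic_on_imp_continuous_on)
    fix z :: complex assume z: "z \<in> sphere 0 1"
    then have "z * cnj z = 1" by (simp add: complex_norm_square[symmetric])
    moreover from this have "z \<noteq> 0" by auto
    ultimately have cz: "1 / z = cnj z" "z \<noteq> 0" by (auto simp: divide_eq_eq mult.commute)
    have "Re (if m \<le> i then coeff p i * z ^ (i - m) else cnj (coeff p i) * z ^ (m - i)) = Re (coeff p i * z ^ i / z ^ m)" for i
    proof (cases "m \<le> i")
      case True
      then show ?thesis using cz(2) by (simp add: power_diff)
    next
      case False
      then have "coeff p i * z ^ i / z ^ m = coeff p i * (1 / z) ^ (m - i)"
        using cz(2) by (simp add: power_diff field_simps power_one_over)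
      also have "\<dots> = cnj (cnj (coeff p i) * z ^ (m - i))" by (simp add: cz(1))
      finally have "Re (coeff p i * z ^ i / z ^ m) = Re (cnj (coeff p i) * z ^ (m - i))"
        by (simp only: cnj.simps)
      then show ?thesis using False by simp
    qed
    then show "Re (h z) = Re (laurent m p z)"
      by (simp add: h_def laurent_def poly_altdef sum_divide_distrib)
  qed
qed

lemma disc_algebra_continuous_circle:
  "h \<in> disc_algebra \<Longrightarrow> continuous_on (sphere 0 1) (\<lambda>z. Re (h z))"
  unfolding disc_algebra_def
  by (rule continuous_on_Re) (auto intro: continuous_on_subset[of "cball 0 1"])

lemma disc_algebra_const [simp]: "(\<lambda>z. c) \<in> disc_algebra"
  by (auto simp: disc_algebra_def)

lemma disc_algebra_add: "f \<in> disc_algebra \<Longrightarrow> g \<in> disc_algebra \<Longrightarrow> (\<lambda>z. f z + g z) \<in> disc_algebra"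
  by (simp add: disc_algebra_def continuous_on_add holomorphic_on_add)

lemma disc_algebra_diff: "f \<in> disc_algebra \<Longrightarrow> g \<in> disc_algebra \<Longrightarrow> (\<lambda>z. f z - g z) \<in> disc_algebra"
  by (simp add: disc_algebra_def continuous_on_diff holomorphic_on_diff)

lemma disc_algebra_mult: "f \<in> disc_algebra \<Longrightarrow> g \<in> disc_algebra \<Longrightarrow> (\<lambda>z. f z * g z) \<in> disc_algebra"
  by (simp add: disc_algebra_def continuous_on_mult holomorphic_on_mult)

lemma disc_algebra_sum: "(\<And>i. i \<in> I \<Longrightarrow> f i \<in> disc_algebra) \<Longrightarrow> (\<lambda>z. \<Sum>i\<in>I. f i z) \<in> disc_algebra"
  by (simp add: disc_algebra_def continuous_on_sum holomorphic_on_sum)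

text \<open>A continuous majorant with almost the same integral is approximated uniformly by a
  Laurent polynomial, whose real part on the circle is that of a disc algebra function. From here on
  an integral of \<phi> is represented by such an \<open>h\<close> and its value at 0.\<close>

lemma usc_circle_disc_algebra_majorant:
  assumes q: "usc_on (sphere 0 1) q" and a: "ereal_integral circle_measure q < a"
  obtains h where "h \<in> disc_algebra"
    "\<And>z. z \<in> sphere 0 1 \<Longrightarrow> q z < ereal (Re (h z))" "ereal (Re (h 0)) < a"
proof -
  interpret prob_space circle_measure by (rule prob_space_circle)
  obtain b where b: "ereal_integral circle_measure q < ereal b" "ereal b < a"
    using ereal_dense2[OF a] by blast
  obtain \<psi> where c: "continuous_on (sphere 0 1) \<psi>"
    and ge: "\<And>z. z \<in> sphere 0 1 \<Longrightarrow> q z \<le> ereal (\<psi> z)" and lt: "(LINT z|circle_measure. \<psi> z) < b"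
    using usc_circle_continuous_majorant[OF q b(1)] by blast
  \<comment> \<open>Approximating \<open>\<psi> + e\<close> within \<open>e\<close> lands strictly
    between \<open>\<psi>\<close> and \<open>\<psi> + 2 * e\<close>, and the latter has mean exactly
    \<open>b\<close>.\<close>
  define e where "e = (b - (LINT z|circle_measure. \<psi> z)) / 2"
  have e: "e > 0" using lt by (simp add: e_def)
  have "continuous_on (sphere 0 1) (\<lambda>z. \<psi> z + e)" by (intro continuous_intros c)
  then obtain m p where mp: "\<And>z. z \<in> sphere 0 1 \<Longrightarrow> norm (of_real (\<psi> z + e) - laurent m p z) < e"
    using continuous_circle_laurent e by blast
  obtain h where h: "h \<in> disc_algebra" "\<And>z. z \<in> sphere 0 1 \<Longrightarrow> Re (h z) = Re (laurent m p z)"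
    using laurent_Re_disc_algebra by blast
  have hb: "\<psi> z < Re (h z)" "Re (h z) < \<psi> z + 2 * e" if "z \<in> sphere 0 1" for z
    using abs_Re_le_cmod[of "of_real (\<psi> z + e) - laurent m p z"] mp[OF that] h(2)[OF that] by auto
  show ?thesis
  proof (rule that[OF h(1)])
    show "q z < ereal (Re (h z))" if "z \<in> sphere 0 1" for z
      using ge[OF that] hb(1)[OF that] by (meson ereal_less_eq(3) less_ereal.simps(1) order_le_less_trans)
    have i: "integrable circle_measure \<psi>" by (rule continuous_circle_integrable[OF c])
    have "Re (h 0) = (LINT z|circle_measure. Re (h z))" by (simp add: circle_mean_value[OF h(1)])
    also have "\<dots> \<le> (LINT z|circle_measure. \<psi> z + 2 * e)"
      by (intro integral_mono continuous_circle_integrable disc_algebra_continuous_circle h(1) Bochner_Integration.integrable_add i)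
        (use hb(2) in \<open>auto intro: less_imp_le\<close>)
    also have "\<dots> = b" using i by (simp add: prob_space[unfolded space_circle] e_def field_simps)
    finally show "ereal (Re (h 0)) < a" using b(2) by (meson ereal_less_eq(3) order_le_less_trans)
  qed
qed

section \<open>Plurisubharmonic functions on analytic discs\<close>

lemma usc_on_compose:
  assumes u: "usc_on X u" and g: "continuous_on S g" "g ` S \<subseteq> X"
  shows "usc_on S (\<lambda>x. u (g x))"
  unfolding usc_on_def
proof (intro conjI ballI allI)
  show "u (g x) \<noteq> \<infinity>" if "x \<in> S" for x
    using usc_onD[OF u] g(2) that by blast
  fix c
  have "openin (top_of_set X) {x \<in> X. u x < c}"
    using u by (simp add: usc_on_def)
  then have "openin (top_of_set S) (S \<inter> g -` {x \<in> X. u x < c})"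
    using g by (intro continuous_openin_preimage) auto
  also have "S \<inter> g -` {x \<in> X. u x < c} = {x \<in> S. u (g x) < c}"
    using g(2) by auto
  finally show "openin (top_of_set S) {x \<in> S. u (g x) < c}" .
qed

lemma usc_on_add_continuous:
  fixes c :: "'a::topological_space \<Rightarrow> real"
  assumes u: "usc_on S u" and c: "continuous_on S c"
  shows "usc_on S (\<lambda>x. u x + ereal (c x))"
  unfolding usc_on_def
proof (intro conjI ballI allI)
  show "u x + ereal (c x) \<noteq> \<infinity>" if "x \<in> S" for x
    using usc_onD[OF u that] by auto
  fix b
  have op: "openin (top_of_set S) ({x \<in> S. u x < ereal r} \<inter> (S \<inter> (\<lambda>x. r + c x) -` {t. ereal t < b}))" for r
  proof (rule openin_Int)
    show "openin (top_of_set S) {x \<in> S. u x < ereal r}"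
      using u by (simp add: usc_on_def)
    have "open {t. ereal t < b}" by (cases b) (auto simp: open_lessThan[unfolded lessThan_def])
    then show "openin (top_of_set S) (S \<inter> (\<lambda>x. r + c x) -` {t. ereal t < b})"
      by (intro continuous_openin_preimage_gen continuous_intros c)
  qed
  have "{x \<in> S. u x + ereal (c x) < b} =
    (\<Union>r. {x \<in> S. u x < ereal r} \<inter> (S \<inter> (\<lambda>x. r + c x) -` {t. ereal t < b}))" (is "?L = ?R")
  proof
    show "?L \<subseteq> ?R"
    proof
      fix x assume x: "x \<in> ?L"
      then have "u x < b - ereal (c x)" by (auto simp: ereal_less_minus)
      then obtain r where "u x < ereal r" "ereal r < b - ereal (c x)" using ereal_dense2 by blast
      then show "x \<in> ?R" using x by (auto simp: ereal_less_minus)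
    qed
    show "?R \<subseteq> ?L"
    proof
      fix x assume "x \<in> ?R"
      then obtain r where r: "x \<in> S" "u x < ereal r" "ereal (r + c x) < b" by auto
      have "u x + ereal (c x) \<le> ereal r + ereal (c x)" using r by (intro add_right_mono) auto
      then show "x \<in> ?L" using r by auto
    qed
  qed
  then show "openin (top_of_set S) {x \<in> S. u x + ereal (c x) < b}"
    using op by auto
qed

lemma usc_on_attains_max:
  assumes u: "usc_on S u" and S: "compact S" "S \<noteq> {}"
  obtains x where "x \<in> S" "\<And>y. y \<in> S \<Longrightarrow> u y \<le> u x"
proof -
  have "\<exists>x\<in>S. \<forall>y\<in>S. u y \<le> u x"
  proof (rule ccontr)
    assume "\<not> ?thesis"
    then have n: "\<And>x. x \<in> S \<Longrightarrow> \<exists>y\<in>S. u x < u y" by (auto simp: not_le)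
    have "\<forall>y. \<exists>T. open T \<and> {x \<in> S. u x < u y} = S \<inter> T"
      using u by (simp add: usc_on_def openin_open)
    then obtain T where T: "\<And>y. open (T y)" "\<And>y. {x \<in> S. u x < u y} = S \<inter> T y" by metis
    have "S \<subseteq> (\<Union>y\<in>S. T y)" using n T(2) by blast
    then obtain C where C: "C \<subseteq> S" "finite C" "S \<subseteq> (\<Union>y\<in>C. T y)"
      using compactE_image[OF S(1), of S T] T(1) by auto
    then have "C \<noteq> {}" using S(2) by auto
    then have "Max (u ` C) \<in> u ` C" using C(2) by (intro Max_in) auto
    then obtain y where y: "y \<in> C" "u y = Max (u ` C)" by auto
    then have y_max: "\<And>x. x \<in> C \<Longrightarrow> u x \<le> u y" using C(2) by simp
    then obtain y' where "y' \<in> C" "y \<in> T y'" using y(1) C(1,3) by blast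
    then have "u y < u y'" using T(2)[of y'] C(1) y(1) by blast
    then show False using y_max[OF \<open>y' \<in> C\<close>] by auto
  qed
  then show ?thesis using that by blast
qed

text \<open>A pair (f, q) maps the circle into this set exactly if \<open>f\<close> maps it into
  \<open>W\<close> and Re q strictly majorises \<phi> along \<open>f\<close>. As the set is open, a
  compact family of such pairs admits small perturbations, although \<phi> itself is not
  continuous.\<close>

lemma open_strict_hypergraph:
  fixes W :: "'a::topological_space set"
  assumes "open W" "usc_on W \<phi>"
  shows "open {(x, s::complex). x \<in> W \<and> \<phi> x < ereal (Re s)}"
proof -
  have "{(x, s::complex). x \<in> W \<and> \<phi> x < ereal (Re s)} = (\<Union>r. {x \<in> W. \<phi> x < ereal r} \<times> {s. r < Re s})" (is "?L = ?R")
  proof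
    show "?L \<subseteq> ?R"
    proof
      fix p assume "p \<in> ?L"
      then obtain x s where p: "p = (x, s)" "x \<in> W" "\<phi> x < ereal (Re s)" by auto
      then obtain r where "\<phi> x < ereal r" "ereal r < ereal (Re s)" using ereal_dense2 by blast
      then show "p \<in> ?R" using p by auto
    qed
    show "?R \<subseteq> ?L" by (auto intro: less_trans[of _ "ereal _"])
  qed
  moreover have "open {x \<in> W. \<phi> x < ereal r}" for r
  proof -
    have "openin (top_of_set W) {x \<in> W. \<phi> x < ereal r}" using assms(2) by (simp add: usc_on_def)
    then show ?thesis using assms(1) openin_open_trans by blast
  qed
  moreover have "open {s. r < Re s}" for r by (rule open_halfspace_Re_gt)
  ultimately show ?thesis by (auto intro!: open_UN open_Times)
qed

lemma compact_in_open_translate: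
  fixes K :: "'a::{real_normed_vector, heine_borel} set"
  assumes "compact K" "open X" "K \<subseteq> X"
  obtains r where "r > 0" "\<And>x y. x \<in> K \<Longrightarrow> norm y \<le> r \<Longrightarrow> x + y \<in> X"
proof -
  obtain e where e: "e > 0" "(\<Union>x\<in>K. ball x e) \<subseteq> X"
    using compact_subset_open_imp_ball_epsilon_subset[OF assms] by metis
  show ?thesis
  proof (rule that[of "e / 2"])
    fix x y :: 'a assume "x \<in> K" "norm y \<le> e / 2"
    then have "x + y \<in> ball x e" using e(1) by (auto simp: dist_norm)
    then show "x + y \<in> X" using e(2) \<open>x \<in> K\<close> by blast
  qed (use e in auto)
qed

lemma analytic_discs_iff:
  "f \<in> analytic_discs X \<longleftrightarrow> (\<forall>i. (\<lambda>z. f z $ i) \<in> disc_algebra) \<and> f ` cball 0 1 \<subseteq> X"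
proof -
  have "continuous_on (cball 0 1) f \<longleftrightarrow> (\<forall>i. continuous_on (cball 0 1) (\<lambda>z. f z $ i))"
  proof
    assume "\<forall>i. continuous_on (cball 0 1) (\<lambda>z. f z $ i)"
    then have "continuous_on (cball 0 1) (\<lambda>z. \<chi> i. f z $ i)" by (intro continuous_on_vec_lambda) auto
    then show "continuous_on (cball 0 1) f" by simp
  qed (auto intro: continuous_on_component)
  then show ?thesis by (auto simp: analytic_discs_def disc_algebra_def)
qed

lemma disc_algebra_id: "(\<lambda>z. z) \<in> disc_algebra"
  by (simp add: disc_algebra_def)

lemma disc_algebra_affine:
  assumes h: "h \<in> disc_algebra" and r: "0 < r" "norm c + r \<le> 1"
  shows "(\<lambda>w. h (c + of_real r * w)) \<in> disc_algebra"
proof -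
  have n: "norm (c + of_real r * w) \<le> norm c + r * norm w" for w
    using norm_triangle_ineq[of c "of_real r * w"] r(1) by (simp add: norm_mult)
  have a: "c + of_real r * w \<in> cball 0 1" if "w \<in> cball 0 1" for w
  proof -
    have "r * norm w \<le> r" using that r(1) by (simp add: mult_left_le)
    then show ?thesis using n[of w] r(2) by simp
  qed
  have b: "c + of_real r * w \<in> ball 0 1" if "w \<in> ball 0 1" for w
  proof -
    have "r * norm w < r" using that r(1) by simp
    then show ?thesis using n[of w] r(2) by simp
  qed
  have "continuous_on (cball 0 1) (\<lambda>w. h (c + of_real r * w))"
    by (rule continuous_on_compose2[where g = h and t = "cball 0 1"])
      (use h a in \<open>auto simp: disc_algebra_def intro!: continuous_intros\<close>)
  moreover have "(h \<circ> (\<lambda>w. c + of_real r * w)) holomorphic_on ball 0 1"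
    by (rule holomorphic_on_compose_gen[where t = "ball 0 1"])
      (use h b in \<open>auto simp: disc_algebra_def intro!: holomorphic_intros\<close>)
  ultimately show ?thesis by (simp add: disc_algebra_def o_def)
qed

lemma norm_vec_le_sum: "norm (x :: complex ^ 'n) \<le> (\<Sum>i\<in>UNIV. norm (x $ i))"
  by (simp add: norm_vec_def L2_set_le_sum)

text \<open>Beyond its size, the error matters because it is holomorphic in \<open>w\<close> and vanishes at \<open>0\<close>,
  hence has mean value zero on small circles.\<close>

lemma analytic_disc_tangent:
  fixes f :: "complex \<Rightarrow> complex ^ 'n"
  assumes f: "\<And>i. (\<lambda>z. f z $ i) \<in> disc_algebra" and z: "z \<in> ball 0 1" and e: "e > 0"
  obtains b and d :: real where "d > 0" "\<And>w :: complex. norm w \<le> d \<Longrightarrow> norm (f z + w *s b - f (z + w)) \<le> e * norm w"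
proof -
  define N where "N = real CARD('n)"
  have N: "N > 0" by (simp add: N_def)
  define b where "b = (\<chi> i. deriv (\<lambda>z. f z $ i) z)"
  have "\<exists>d>0. \<forall>w. norm w \<le> d \<longrightarrow> norm (f z $ i + w * b $ i - f (z + w) $ i) \<le> e / N * norm w" for i
  proof -
    have "((\<lambda>z. f z $ i) has_field_derivative b $ i) (at z)"
      using f[of i] z by (auto simp: b_def disc_algebra_def intro: holomorphic_derivI)
    then have "((\<lambda>z. f z $ i) has_derivative (\<lambda>w. b $ i * w)) (at z)"
      by (simp add: has_field_derivative_def)
    then obtain d where d: "d > 0"
      "\<And>y. norm (y - z) < d \<Longrightarrow> norm (f y $ i - f z $ i - b $ i * (y - z)) \<le> e / N * norm (y - z)"
      using e N unfolding has_derivative_at_alt by (meson divide_pos_pos)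
    show ?thesis
    proof (intro exI[of _ "d / 2"] conjI allI impI)
      fix w :: complex assume "norm w \<le> d / 2"
      then have "norm (f (z + w) $ i - f z $ i - b $ i * w) \<le> e / N * norm w"
        using d(2)[of "z + w"] d(1) by auto
      moreover have "f z $ i + w * b $ i - f (z + w) $ i = - (f (z + w) $ i - f z $ i - b $ i * w)"
        by (simp add: algebra_simps)
      ultimately show "norm (f z $ i + w * b $ i - f (z + w) $ i) \<le> e / N * norm w"
        by (simp only: norm_minus_cancel)
    qed (use d in auto)
  qed
  then obtain d where d: "\<And>i. d i > 0"
    "\<And>i w. norm w \<le> d i \<Longrightarrow> norm (f z $ i + w * b $ i - f (z + w) $ i) \<le> e / N * norm w" by metis
  show ?thesis
  proof (rule that[of "Min (range d)" b])
    show "Min (range d) > 0" using d(1) by (subst Min_gr_iff) auto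
    fix w :: complex assume w: "norm w \<le> Min (range d)"
    have "norm (f z + w *s b - f (z + w)) \<le> (\<Sum>i\<in>UNIV. norm ((f z + w *s b - f (z + w)) $ i))"
      by (rule norm_vec_le_sum)
    also have "\<dots> \<le> (\<Sum>i\<in>(UNIV :: 'n set). e / N * norm w)"
    proof (rule sum_mono)
      fix i
      have "norm w \<le> d i" by (rule order_trans[OF w]) simp
      then show "norm ((f z + w *s b - f (z + w)) $ i) \<le> e / N * norm w" using d(2) by simp
    qed
    also have "\<dots> = e * norm w" using N by (simp add: N_def)
    finally show "norm (f z + w *s b - f (z + w)) \<le> e * norm w" .
  qed
qed

lemma vec_inner_complex: "(x :: complex ^ 'n) \<bullet> y = Re (\<Sum>i\<in>UNIV. cnj (x $ i) * y $ i)"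
  by (simp add: inner_vec_def inner_complex_def)

text \<open>At an interior maximum \<open>(z, y)\<close> of \<open>u (f z + y) - Re (h z) + \<eta> |z|\<^sup>2 - C |y|\<^sup>2\<close> one moves \<open>z\<close> on a
  small circle and lets \<open>y\<close> absorb the deviation of \<open>f\<close> from its tangent line, so that
  \<open>u\<close> is only evaluated on an affine disc. By the mean value property the \<open>C\<close>-term changes
  by \<open>o(r\<^sup>2)\<close> on average, whereas the \<open>\<eta>\<close>-term gains \<open>\<eta> r\<^sup>2\<close>.\<close>

lemma PSH_no_interior_max:
  fixes f :: "complex \<Rightarrow> complex ^ 'n"
  assumes X: "open X" and u: "u \<in> PSH X" and f: "\<And>i. (\<lambda>z. f z $ i) \<in> disc_algebra"
    and h: "h \<in> disc_algebra" and \<eta>: "\<eta> > 0" and C: "C > 0"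
    and zs: "norm zs < 1" and ys: "norm ys < \<rho>"
    and in_X: "\<And>z y. norm z \<le> 1 \<Longrightarrow> norm y \<le> \<rho> \<Longrightarrow> f z + y \<in> X"
    and m: "u (f zs + ys) = ereal (m + Re (h zs) - \<eta> * norm zs ^ 2 + C * norm ys ^ 2)"
    and max: "\<And>z y. norm z \<le> 1 \<Longrightarrow> norm y \<le> \<rho> \<Longrightarrow>
      u (f z + y) \<le> ereal (m + Re (h z) - \<eta> * norm z ^ 2 + C * norm y ^ 2)"
  shows False
proof -
  \<comment> \<open>With this choice the squared deviation from the tangent line costs at most
    \<open>C * \<epsilon>\<^sup>2 * r\<^sup>2\<close>, half of the gain
    \<open>\<eta> * r\<^sup>2\<close>.\<close>
  define \<epsilon> where "\<epsilon> = sqrt (\<eta> / (2 * C))"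
  have \<epsilon>: "\<epsilon> > 0" "C * \<epsilon>\<^sup>2 = \<eta> / 2" using \<eta> C by (auto simp: \<epsilon>_def)
  obtain b d where d: "d > 0" "\<And>w. norm w \<le> d \<Longrightarrow> norm (f zs + w *s b - f (zs + w)) \<le> \<epsilon> * norm w"
  proof -
    have "zs \<in> ball 0 1" using zs by simp
    then show ?thesis using analytic_disc_tangent[of f zs \<epsilon>, OF f _ \<epsilon>(1)] that by metis
  qed
  define e where "e w = f zs + w *s b - f (zs + w)" for w
  \<comment> \<open>The bounds serve, in turn, the tangent estimate, the first variable staying in
    the closed unit disc, and \<open>ys\<close> plus the deviation staying in the ball of radius
    \<open>\<rho>\<close>.\<close>
  define r where "r = min d (min (1 - norm zs) ((\<rho> - norm ys) / \<epsilon>))"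
  have r: "r > 0" "r \<le> d" "norm zs + r \<le> 1"
    using d zs ys \<epsilon> by (auto simp: r_def)
  have "r \<le> (\<rho> - norm ys) / \<epsilon>" by (simp add: r_def)
  then have r4: "norm ys + \<epsilon> * r \<le> \<rho>" using \<epsilon>(1) by (simp add: field_simps)
  have e_le: "norm (e (of_real r * w)) \<le> \<epsilon> * r" if "norm w \<le> 1" for w
  proof -
    have a: "norm (of_real r * w) \<le> r" using that r(1) by (simp add: norm_mult mult_left_le)
    then have "norm (e (of_real r * w)) \<le> \<epsilon> * norm (of_real r * w)" unfolding e_def using r(2) by (intro d) auto
    also have "\<dots> \<le> \<epsilon> * r" using a \<epsilon>(1) by (intro mult_left_mono) auto
    finally show ?thesis .
  qed
  have z_le: "norm (zs + of_real r * w) \<le> 1" if "norm w \<le> 1" for w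
  proof -
    have "norm (of_real r * w) \<le> r" using that r(1) by (simp add: norm_mult mult_left_le)
    then show ?thesis using norm_triangle_ineq[of zs "of_real r * w"] r(3) by linarith
  qed
  have y_le: "norm (ys + e (of_real r * w)) \<le> \<rho>" if "norm w \<le> 1" for w
    using norm_triangle_ineq[of ys "e (of_real r * w)"] e_le[OF that] r4 by linarith
  define xs where "xs = f zs + ys"
  have line: "xs + (of_real r * w) *s b = f (zs + of_real r * w) + (ys + e (of_real r * w))" for w
    by (simp add: xs_def e_def algebra_simps)
  have "subharmonic_on {z. xs + z *s b \<in> X} (\<lambda>z. u (xs + z *s b))" using u by (simp add: PSH_def)
  moreover have "cball 0 r \<subseteq> {z. xs + z *s b \<in> X}"
  proof safe
    fix z :: complex assume "z \<in> cball 0 r"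
    then have n: "norm (z / of_real r) \<le> 1" using r(1) by (simp add: norm_divide)
    have "xs + (of_real r * (z / of_real r)) *s b \<in> X"
      unfolding line by (intro in_X z_le y_le n)
    then show "xs + z *s b \<in> X" using r(1) by simp
  qed
  ultimately have sub: "u xs \<le> ereal_integral circle_measure (\<lambda>w. u (xs + (of_real r * w) *s b))"
    using r(1) unfolding subharmonic_on_def by (auto dest!: spec[of _ 0] spec[of _ r])
  \<comment> \<open>Expanding both squares in the maximality bound leaves constants, collected in
    \<open>k\<close>, and cross terms that are real parts of functions holomorphic in
    \<open>w\<close> and zero at \<open>w = 0\<close>. So \<open>Re (H w)\<close> dominates the
    bound on the circle, while \<open>H 0\<close> is \<open>h zs\<close> plus
    \<open>k\<close>.\<close>
  define k where "k = m - \<eta> * (norm zs ^ 2 + r ^ 2) + C * (norm ys ^ 2 + \<epsilon> ^ 2 * r ^ 2)"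
  define H where "H w = h (zs + of_real r * w) + (of_real (2 * C) * (\<Sum>i\<in>UNIV. cnj (ys $ i) * e (of_real r * w) $ i)
     + (of_real (- 2 * \<eta>) * cnj zs * of_real r * w + of_real k))" for w
  have "(\<lambda>w. e (of_real r * w) $ i) \<in> disc_algebra" for i
  proof -
    have "(\<lambda>w. f zs $ i + (of_real r * b $ i) * w - f (zs + of_real r * w) $ i) \<in> disc_algebra"
      by (intro disc_algebra_diff disc_algebra_add disc_algebra_mult disc_algebra_const disc_algebra_id
          disc_algebra_affine[OF f] r)
    then show ?thesis by (simp add: e_def mult_ac)
  qed
  then have Hd: "H \<in> disc_algebra"
    unfolding H_def
    by (intro disc_algebra_add disc_algebra_mult disc_algebra_sum disc_algebra_const disc_algebra_id
        disc_algebra_affine[OF h] r)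
  have "u (xs + (of_real r * w) *s b) \<le> ereal (Re (H w))" if w: "w \<in> sphere 0 1" for w
  proof -
    have w1: "norm w \<le> 1" "norm w = 1" using w by auto
    define z where "z = zs + of_real r * w"
    define E where "E = e (of_real r * w)"
    have "u (xs + (of_real r * w) *s b) \<le> ereal (m + Re (h z) - \<eta> * norm z ^ 2 + C * norm (ys + E) ^ 2)"
      unfolding line z_def E_def by (intro max z_le y_le w1)
    also have "m + Re (h z) - \<eta> * norm z ^ 2 + C * norm (ys + E) ^ 2 \<le> Re (H w)"
    proof -
      have 1: "norm z ^ 2 = norm zs ^ 2 + r ^ 2 + 2 * Re (cnj zs * of_real r * w)"
      proof -
        have "norm z ^ 2 = norm zs ^ 2 + 2 * (zs \<bullet> (of_real r * w)) + norm (of_real r * w) ^ 2"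
          unfolding z_def power2_norm_eq_inner by (simp add: algebra_simps inner_commute)
        moreover have "norm (of_real r * w) ^ 2 = r ^ 2" using w1(2) by (simp add: norm_mult)
        moreover have "zs \<bullet> (of_real r * w) = Re (cnj zs * of_real r * w)"
          by (simp add: inner_complex_def algebra_simps)
        ultimately show ?thesis by simp
      qed
      have 2: "norm (ys + E) ^ 2 \<le> norm ys ^ 2 + 2 * (ys \<bullet> E) + \<epsilon> ^ 2 * r ^ 2"
      proof -
        have "norm (ys + E) ^ 2 = norm ys ^ 2 + 2 * (ys \<bullet> E) + norm E ^ 2"
          unfolding power2_norm_eq_inner by (simp add: algebra_simps inner_commute)
        moreover have "norm E ^ 2 \<le> (\<epsilon> * r) ^ 2"
          unfolding E_def by (intro power_mono e_le w1) auto
        ultimately show ?thesis by (simp add: power_mult_distrib)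
      qed
      have 3: "Re (H w) = Re (h z) + 2 * C * (ys \<bullet> E) - 2 * \<eta> * Re (cnj zs * of_real r * w) + k"
        unfolding H_def z_def[symmetric] E_def[symmetric] vec_inner_complex
        by (simp add: algebra_simps)
      have "C * norm (ys + E) ^ 2 \<le> C * (norm ys ^ 2 + 2 * (ys \<bullet> E) + \<epsilon> ^ 2 * r ^ 2)"
        using 2 C by (intro mult_left_mono) auto
      then show ?thesis unfolding 3 1 k_def by (simp add: algebra_simps)
    qed
    finally show ?thesis by simp
  qed
  from ereal_integral_le_disc_algebra[OF Hd this]
  have "u xs \<le> ereal (Re (H 0))" using sub by (rule order_trans[rotated])
  moreover have "Re (H 0) = Re (h zs) + k" by (simp add: H_def e_def)
  \<comment> \<open>The right-hand side is \<open>\<eta> * r\<^sup>2 / 2\<close> by the choice of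
    \<open>\<epsilon>\<close>.\<close>
  ultimately have "\<eta> * r\<^sup>2 \<le> C * \<epsilon>\<^sup>2 * r\<^sup>2" 
    using m unfolding xs_def[symmetric] by (simp add: k_def algebra_simps)
  then show False using \<epsilon>(2) r(1) \<eta> by simp
qed

text \<open>If the bound fails at the centre by \<open>d\<close>, then u (f z + y) - Re (h z) +
  \<eta> |z|^2 - C |y|^2 has a maximum of at least \<open>d\<close> on a closed disc times a closed
  ball. A choice of \<eta> below \<open>d\<close> excludes |z| = 1, a large C excludes |y| = \<rho>,
  and \<open>PSH_no_interior_max\<close> excludes the interior.\<close>

lemma PSH_disc_majorant:
  fixes f :: "complex \<Rightarrow> complex ^ 'n"
  assumes X: "open X" and u: "u \<in> PSH X" and f: "f \<in> analytic_discs X"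
    and h: "h \<in> disc_algebra" and lt: "\<And>z. z \<in> sphere 0 1 \<Longrightarrow> u (f z) < ereal (Re (h z))"
  shows "u (f 0) \<le> ereal (Re (h 0))"
proof (rule ccontr)
  assume "\<not> ?thesis"
  then have gt: "ereal (Re (h 0)) < u (f 0)" by simp
  have usc: "usc_on X u" using u by (simp add: PSH_def)
  have fc: "continuous_on (cball 0 1) f" and fX: "f ` cball 0 1 \<subseteq> X" using f by (auto simp: analytic_discs_def)
  have fd: "\<And>i. (\<lambda>z. f z $ i) \<in> disc_algebra" using f by (simp add: analytic_discs_iff)
  have hc: "continuous_on (cball 0 1) h" using h by (simp add: disc_algebra_def)
  have "f 0 \<in> X" using fX by force
  then have "u (f 0) \<noteq> \<infinity>" by (rule usc_onD[OF usc])
  then obtain u0 where u0: "u (f 0) = ereal u0" using gt by (cases "u (f 0)") auto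
  define d where "d = u0 - Re (h 0)"
  have d: "d > 0" using gt u0 by (simp add: d_def)
  define \<eta> where "\<eta> = d / 2"
  have \<eta>: "\<eta> > 0" "\<eta> < d" using d by (auto simp: \<eta>_def)
  have "compact (f ` cball 0 1)" by (intro compact_continuous_image fc) auto
  then obtain \<rho>1 where \<rho>1: "\<rho>1 > 0" "\<And>x y. x \<in> f ` cball 0 1 \<Longrightarrow> norm y \<le> \<rho>1 \<Longrightarrow> x + y \<in> X"
    using compact_in_open_translate[OF _ X fX] by blast
  \<comment> \<open>The boundary curve is compact in the open hypergraph of \<open>u\<close>, so the
    strict inequality on the circle persists, with the same \<open>h\<close>, for all shifts
    \<open>y\<close> of norm at most \<open>\<rho>2\<close>.\<close>
  have "compact ((\<lambda>z. (f z, h z)) ` sphere 0 1)"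
    by (intro compact_continuous_image continuous_intros continuous_on_subset[OF fc] continuous_on_subset[OF hc]) auto
  moreover have "(\<lambda>z. (f z, h z)) ` sphere 0 1 \<subseteq> {(x, s). x \<in> X \<and> u x < ereal (Re s)}"
    using lt fX by auto
  ultimately obtain \<rho>2 where \<rho>2: "\<rho>2 > 0"
    "\<And>p q. p \<in> (\<lambda>z. (f z, h z)) ` sphere 0 1 \<Longrightarrow> norm q \<le> \<rho>2 \<Longrightarrow> p + q \<in> {(x, s). x \<in> X \<and> u x < ereal (Re s)}"
    using compact_in_open_translate[OF _ open_strict_hypergraph[OF X usc]] by blast
  define \<rho> where "\<rho> = min \<rho>1 \<rho>2"
  have \<rho>: "\<rho> > 0" using \<rho>1 \<rho>2 by (simp add: \<rho>_def)
  have in_X: "f z + y \<in> X" if "norm z \<le> 1" "norm y \<le> \<rho>" for z y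
    using \<rho>1(2)[of "f z" y] that by (auto simp: \<rho>_def)
  have bd: "u (f z + y) < ereal (Re (h z))" if "norm z = 1" "norm y \<le> \<rho>" for z y
    using \<rho>2(2)[of "(f z, h z)" "(y, 0)"] that by (auto simp: \<rho>_def norm_Pair)
  define P where "P = cball (0::complex) 1 \<times> cball (0::complex ^ 'n) \<rho>"
  have P: "compact P" "(0, 0) \<in> P" using \<rho> by (auto simp: P_def intro: compact_Times)
  have fP: "continuous_on P (\<lambda>p. f (fst p) + snd p)"
    by (intro continuous_intros continuous_on_compose2[OF fc]) (auto simp: P_def)
  have uP: "usc_on P (\<lambda>p. u (f (fst p) + snd p))"
    by (rule usc_on_compose[OF usc fP]) (auto simp: P_def intro!: in_X)
  obtain M where M: "\<And>p. p \<in> P \<Longrightarrow> u (f (fst p) + snd p) < ereal M"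
    using usc_on_compact_bounded[OF uP P(1)] by blast
  obtain B where B: "\<And>z. norm z \<le> 1 \<Longrightarrow> norm (h z) \<le> B"
  proof -
    have "bounded (h ` cball 0 1)" by (intro compact_imp_bounded compact_continuous_image hc) auto
    then obtain B where "\<forall>x\<in>h ` cball 0 1. norm x \<le> B" unfolding bounded_iff by blast
    then show ?thesis using that[of B] by simp
  qed
  \<comment> \<open>For |y| = \<rho> the auxiliary function is below M + B + \<eta> - C \<rho>^2,
    which becomes negative.\<close>
  define C where "C = (\<bar>M\<bar> + \<bar>B\<bar> + \<eta> + 1) / \<rho>\<^sup>2"
  have C: "C > 0" "C * \<rho>\<^sup>2 = \<bar>M\<bar> + \<bar>B\<bar> + \<eta> + 1" using \<rho> \<eta> by (auto simp: C_def intro!: divide_pos_pos add_pos_pos add_nonneg_pos)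
  define c where "c p = - Re (h (fst p)) + \<eta> * norm (fst p) ^ 2 - C * norm (snd p) ^ 2" for p :: "complex \<times> (complex ^ 'n)"
  have cP: "continuous_on P c"
    unfolding c_def by (intro continuous_intros continuous_on_compose2[OF hc]) (auto simp: P_def)
  obtain p where p: "p \<in> P" "\<And>q. q \<in> P \<Longrightarrow> u (f (fst q) + snd q) + ereal (c q) \<le> u (f (fst p) + snd p) + ereal (c p)"
    using usc_on_attains_max[OF usc_on_add_continuous[OF uP cP] P(1)] P(2) by blast
  obtain zs ys where zy: "p = (zs, ys)" by (cases p)
  have le1: "norm zs \<le> 1" "norm ys \<le> \<rho>" using p(1) by (auto simp: zy P_def)
  have "ereal d \<le> u (f zs + ys) + ereal (c p)"
    using p(2)[OF P(2)] by (simp add: u0 c_def d_def zy)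
  moreover have "u (f zs + ys) \<noteq> \<infinity>" using usc_onD[OF usc in_X[OF le1]] .
  ultimately obtain v where v: "u (f zs + ys) = ereal v" "d \<le> v + c p"
    by (cases "u (f zs + ys)") auto
  have "norm zs \<noteq> 1"
  proof
    assume n: "norm zs = 1"
    have "v < Re (h zs)" using bd[OF n le1(2)] v(1) by simp
    then have "v + c p < \<eta> - C * norm ys ^ 2" by (simp add: c_def zy n)
    moreover have "0 \<le> C * norm ys ^ 2" using C(1) by simp
    ultimately show False using v(2) \<eta>(2) by linarith
  qed
  moreover have "norm ys \<noteq> \<rho>"
  proof
    assume n: "norm ys = \<rho>"
    have "v < M" using M[OF p(1)] v(1) by (simp add: zy)
    moreover have "- Re (h zs) \<le> B" using B[OF le1(1)] abs_Re_le_cmod[of "h zs"] by linarith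
    moreover have "\<eta> * norm zs ^ 2 \<le> \<eta>" using le1(1) \<eta>(1) by (simp add: mult_left_le power_le_one)
    ultimately have "v + c p < 0" by (simp add: c_def zy n C(2))
    then show False using v(2) d by linarith
  qed
  ultimately have lt1: "norm zs < 1" "norm ys < \<rho>" using le1 by auto
  show False
  proof (rule PSH_no_interior_max[OF X u fd h \<eta>(1) C(1) lt1, of "v + c p"])
    show "f z + y \<in> X" if "norm z \<le> 1" "norm y \<le> \<rho>" for z y using in_X that by blast
    show "u (f zs + ys) = ereal (v + c p + Re (h zs) - \<eta> * (norm zs)\<^sup>2 + C * (norm ys)\<^sup>2)"
      by (simp add: v(1) c_def zy)
    show "u (f z + y) \<le> ereal (v + c p + Re (h z) - \<eta> * (norm z)\<^sup>2 + C * (norm y)\<^sup>2)"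
      if "norm z \<le> 1" "norm y \<le> \<rho>" for z y
    proof -
      have "u (f z + y) + ereal (c (z, y)) \<le> ereal (v + c p)"
        using p(2)[of "(z, y)"] that v(1) by (auto simp: P_def zy)
      then show ?thesis by (cases "u (f z + y)") (auto simp: c_def)
    qed
  qed
qed

lemma usc_on_boundary_values:
  assumes f: "f \<in> analytic_discs_bdry X W" and \<phi>: "usc_on W \<phi>"
  shows "usc_on (sphere 0 1) (\<lambda>z. \<phi> (f z))"
proof (rule usc_on_compose[OF \<phi>])
  show "continuous_on (sphere 0 1) f"
    using f by (auto simp: analytic_discs_bdry_def analytic_discs_def intro: continuous_on_subset)
  show "f ` sphere 0 1 \<subseteq> W" using f by (simp add: analytic_discs_bdry_def)
qed

lemma poisson_functional_majorant:
  assumes f: "f \<in> analytic_discs_bdry X W" and \<phi>: "usc_on W \<phi>" and a: "poisson_functional \<phi> f < a"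
  obtains h where "h \<in> disc_algebra"
    "\<And>z. z \<in> sphere 0 1 \<Longrightarrow> \<phi> (f z) < ereal (Re (h z))" "ereal (Re (h 0)) < a"
proof -
  show ?thesis
    using usc_circle_disc_algebra_majorant[OF usc_on_boundary_values[OF f \<phi>] a[unfolded poisson_functional_def]] that
    by blast
qed

text \<open>No integral of \<open>u\<close> is formed: a disc algebra majorant of \<phi> along
  \<open>f\<close> whose value at 0 is too small would also majorise \<open>u\<close> along
  \<open>f\<close>, against \<open>PSH_disc_majorant\<close>.\<close>

lemma PSH_le_poisson_functional:
  assumes X: "open X" and u: "u \<in> PSH X" and f: "f \<in> analytic_discs_bdry X W"
    and \<phi>: "usc_on W \<phi>" and le: "\<And>y. y \<in> W \<Longrightarrow> u y \<le> \<phi> y"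
  shows "u (f 0) \<le> poisson_functional \<phi> f"
proof (rule ccontr)
  assume "\<not> ?thesis"
  then have lt: "poisson_functional \<phi> f < u (f 0)" by simp
  have fa: "f \<in> analytic_discs X" and fW: "f ` sphere 0 1 \<subseteq> W" using f by (auto simp: analytic_discs_bdry_def)
  obtain h where h: "h \<in> disc_algebra" "\<And>z. z \<in> sphere 0 1 \<Longrightarrow> \<phi> (f z) < ereal (Re (h z))" "ereal (Re (h 0)) < u (f 0)"
    using poisson_functional_majorant[OF f \<phi> lt] by blast
  have "u (f 0) \<le> ereal (Re (h 0))"
  proof (rule PSH_disc_majorant[OF X u fa h(1)])
    fix z :: complex assume z: "z \<in> sphere 0 1"
    then have "u (f z) \<le> \<phi> (f z)" using fW by (intro le) blast
    then show "u (f z) < ereal (Re (h z))" using h(2)[OF z] by (rule order_le_less_trans)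
  qed
  then show False using h(3) by simp
qed

section \<open>Patching a circle of analytic discs\<close>

text \<open>The singularity at 0 is removable and division by \<open>w\<close> is harmless near the
  circle. The use of this is that \<open>R\<close> is bounded on the closed disc, so that putting
  \<open>w = z ^ k\<close> yields a genuine factor \<open>z ^ k\<close>.\<close>

lemma disc_algebra_factor:
  assumes h: "h \<in> disc_algebra" and "h 0 = 0"
  obtains R where "R \<in> disc_algebra" "\<And>w. h w = w * R w"
proof -
  define R where "R w = (if w = 0 then deriv h 0 else (h w - h 0) / (w - 0))" for w
  have ho: "h holomorphic_on ball 0 1" and co: "continuous_on (cball 0 1) h"
    using h by (auto simp: disc_algebra_def)
  have R1: "R holomorphic_on ball 0 1"
    unfolding R_def by (rule pole_lemma[OF ho]) simp
  have R2: "continuous_on (cball 0 1 - {0}) R"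
    by (rule continuous_on_eq[of _ "\<lambda>w. h w / w"])
      (auto simp: R_def \<open>h 0 = 0\<close> intro!: continuous_intros continuous_on_subset[OF co])
  have un: "ball 0 1 \<union> (cball 0 1 - {0}) = cball (0::complex) 1" by auto
  have "continuous_on (ball 0 1 \<union> (cball 0 1 - {0})) R"
  proof (rule continuous_on_Un_local_open)
    show "openin (top_of_set (ball 0 1 \<union> (cball 0 1 - {0}))) (ball (0::complex) 1)"
      by (rule open_subset) auto
    have "cball 0 1 - {0} = cball 0 1 \<inter> (- {0::complex})" by auto
    then show "openin (top_of_set (ball 0 1 \<union> (cball 0 1 - {0}))) (cball 0 1 - {0::complex})"
      unfolding un openin_open by (intro exI[of _ "- {0}"]) auto
  qed (use R1 R2 holomorphic_on_imp_continuous_on in auto)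
  then show ?thesis
    using that[of R] R1 un by (auto simp: disc_algebra_def R_def \<open>h 0 = 0\<close>)
qed

lemma disc_algebra_power_compose:
  assumes h: "h \<in> disc_algebra" and k: "k > 0"
  shows "(\<lambda>z. h (z ^ k)) \<in> disc_algebra"
proof -
  have 1: "z ^ k \<in> cball 0 1" if "z \<in> cball 0 1" for z :: complex
    using that by (simp add: norm_power power_le_one)
  have 2: "z ^ k \<in> ball 0 1" if "z \<in> ball 0 1" for z :: complex
    using that k by (simp add: norm_power power_less_one_iff)
  have "continuous_on (cball 0 1) (\<lambda>z. h (z ^ k))"
    by (rule continuous_on_compose2[where g = h and t = "cball 0 1"])
      (use h 1 in \<open>auto simp: disc_algebra_def intro!: continuous_intros\<close>)
  moreover have "(h \<circ> (\<lambda>z. z ^ k)) holomorphic_on ball 0 1"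
    by (rule holomorphic_on_compose_gen[where t = "ball 0 1"])
      (use h 2 in \<open>auto simp: disc_algebra_def intro!: holomorphic_intros\<close>)
  ultimately show ?thesis by (simp add: disc_algebra_def o_def)
qed

lemma disc_algebra_poly: "poly p \<in> disc_algebra"
  by (auto simp: disc_algebra_def intro!: continuous_intros holomorphic_intros)

lemma disc_algebra_power: "(\<lambda>z. z ^ k) \<in> disc_algebra"
  by (auto simp: disc_algebra_def intro!: continuous_intros holomorphic_intros)

lemma disc_algebra_bounded:
  assumes "h \<in> disc_algebra"
  obtains B where "B \<ge> 0" "\<And>z. norm z \<le> 1 \<Longrightarrow> norm (h z) \<le> B"
proof -
  have "bounded (h ` cball 0 1)"
    using assms by (intro compact_imp_bounded compact_continuous_image) (auto simp: disc_algebra_def)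
  then obtain B where B: "\<forall>x\<in>h ` cball 0 1. norm x \<le> B" unfolding bounded_iff by blast
  then have "norm (h 0) \<le> B" by auto
  then have "B \<ge> 0" using norm_ge_zero order_trans by blast
  then show ?thesis using that[of B] B by simp
qed

lemma norm_vec_scale: "norm (c *s (x :: complex ^ 'n)) = norm c * norm x"
proof -
  have "L2_set (\<lambda>i. norm c * norm (x $ i)) UNIV = norm c * L2_set (\<lambda>i. norm (x $ i)) UNIV"
    by (rule L2_set_right_distrib[symmetric]) simp
  then show ?thesis by (simp add: norm_vec_def norm_mult)
qed

lemma continuous_on_vec_scale [continuous_intros]:
  fixes g :: "'a::topological_space \<Rightarrow> complex ^ 'n"
  assumes "continuous_on S f" "continuous_on S g"
  shows "continuous_on S (\<lambda>x. f x *s g x)"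
  unfolding vector_scalar_mult_def
  by (intro continuous_on_vec_lambda continuous_intros assms)

lemma partition_of_unity_balls:
  fixes S :: "'a::metric_space set"
  assumes S: "compact S" and d: "d > 0"
  obtains Z :: "'a set" and \<tau> :: "'a \<Rightarrow> 'a \<Rightarrow> real" where "finite Z" "Z \<subseteq> S"
    "\<And>y. y \<in> Z \<Longrightarrow> continuous_on S (\<tau> y)" "\<And>y x. y \<in> Z \<Longrightarrow> x \<in> S \<Longrightarrow> 0 \<le> \<tau> y x"
    "\<And>y x. d \<le> dist x y \<Longrightarrow> \<tau> y x = 0"
    "\<And>x. x \<in> S \<Longrightarrow> (\<Sum>y\<in>Z. \<tau> y x) = 1"
proof -
  have "S \<subseteq> (\<Union>y\<in>S. ball y d)" using d by force
  then obtain Z where Z: "Z \<subseteq> S" "finite Z" "S \<subseteq> (\<Union>y\<in>Z. ball y d)"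
    using compactE_image[OF S, of S "\<lambda>y. ball y d"] by (metis open_ball)
  define t where "t y x = max 0 (d - dist x y)" for y x :: 'a
  define s where "s x = (\<Sum>y\<in>Z. t y x)" for x
  have t: "t y x \<ge> 0" for y x by (simp add: t_def)
  have s: "s x > 0" if x: "x \<in> S" for x
  proof -
    obtain y where "y \<in> Z" "x \<in> ball y d" using Z(3) x by blast
    then have "t y x > 0" by (simp add: t_def dist_commute)
    then show ?thesis unfolding s_def using Z(2) \<open>y \<in> Z\<close> t by (intro sum_pos2) auto
  qed
  have tc: "continuous_on S (t y)" for y
    unfolding t_def by (intro continuous_intros)
  show ?thesis
  proof (rule that[of Z "\<lambda>y x. t y x / s x"])
    show "continuous_on S (\<lambda>x. t y x / s x)" for y
    proof (intro continuous_on_divide tc ballI)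
      show "continuous_on S s" unfolding s_def by (intro continuous_on_sum tc)
      show "s x \<noteq> 0" if "x \<in> S" for x using s[OF that] by simp
    qed
    show "(\<Sum>y\<in>Z. t y x / s x) = 1" if "x \<in> S" for x
      using s[OF that] by (simp add: sum_divide_distrib[symmetric] s_def[symmetric])
  qed (use Z t s in \<open>auto simp: t_def intro!: divide_nonneg_pos\<close>)
qed

text \<open>A partition of unity on short arcs replaces \<open>K\<close> by a finite combination of
  its slices \<open>K (y, _)\<close> with coefficients depending on \<open>z\<close> only, and these
  are approximated by Laurent polynomials. In \<open>w\<close> only slices of \<open>K\<close>
  occur, so holomorphy in \<open>w\<close> and zeros at \<open>w = 0\<close> are inherited.\<close>

lemma laurent_approximation:
  fixes K :: "complex \<times> complex \<Rightarrow> complex ^ 'm"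
  assumes K: "continuous_on (sphere 0 1 \<times> cball 0 1) K" and e: "e > 0"
  obtains Z m p where "finite Z" "Z \<subseteq> sphere 0 1"
    "\<And>z w. z \<in> sphere 0 1 \<Longrightarrow> w \<in> cball 0 1 \<Longrightarrow>
       norm ((\<Sum>y\<in>Z. laurent (m y) (p y) z *s K (y, w)) - K (z, w)) \<le> e"
proof -
  let ?S = "sphere (0::complex) 1" and ?D = "cball (0::complex) 1"
  have cpt: "compact (?S \<times> ?D)" by (intro compact_Times) auto
  have "uniformly_continuous_on (?S \<times> ?D) K"
    using compact_uniformly_continuous[OF K cpt] .
  then obtain d where d: "d > 0"
    "\<And>q q'. q \<in> ?S \<times> ?D \<Longrightarrow> q' \<in> ?S \<times> ?D \<Longrightarrow> dist q' q < d \<Longrightarrow> dist (K q') (K q) < e / 2"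
    using e unfolding uniformly_continuous_on_def by (metis half_gt_zero)
  have "bounded (K ` (?S \<times> ?D))"
    by (intro compact_imp_bounded compact_continuous_image K cpt)
  then obtain B0 where B0: "\<forall>x\<in>K ` (?S \<times> ?D). norm x \<le> B0" unfolding bounded_iff by blast
  define B where "B = max B0 0 + 1"
  have B: "B > 0" "\<And>z w. z \<in> ?S \<Longrightarrow> w \<in> ?D \<Longrightarrow> norm (K (z, w)) \<le> B"
    using B0 unfolding B_def by (auto intro: order_trans[of _ B0])
  obtain Z and \<tau> :: "complex \<Rightarrow> complex \<Rightarrow> real" where Z: "finite Z" "Z \<subseteq> ?S"
    and \<tau>c: "\<And>y. y \<in> Z \<Longrightarrow> continuous_on ?S (\<tau> y)"
    and \<tau>p: "\<And>y x. y \<in> Z \<Longrightarrow> x \<in> ?S \<Longrightarrow> 0 \<le> \<tau> y x"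
    and \<tau>0: "\<And>y x. d \<le> dist x y \<Longrightarrow> \<tau> y x = 0"
    and \<tau>1: "\<And>x. x \<in> ?S \<Longrightarrow> (\<Sum>y\<in>Z. \<tau> y x) = 1"
    using partition_of_unity_balls[of ?S, OF _ d(1)] by auto
  \<comment> \<open>Each of the \<open>card Z\<close> coefficients may be off by \<open>e'\<close>,
    together costing at most \<open>e / 2\<close>; the \<open>+ 1\<close> keeps the denominator
    positive whatever \<open>Z\<close> is.\<close>
  define e' where "e' = e / (2 * B * (real (card Z) + 1))"
  have e': "e' > 0" using e B(1) by (simp add: e'_def)
  have "\<exists>m p. \<forall>z\<in>?S. norm (of_real (\<tau> y z) - laurent m p z) < e'" if "y \<in> Z" for y
    using continuous_circle_laurent[OF \<tau>c[OF that] e'] by metis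
  then obtain m p where mp: "\<And>y z. y \<in> Z \<Longrightarrow> z \<in> ?S \<Longrightarrow> norm (of_real (\<tau> y z) - laurent (m y) (p y) z) < e'"
    by metis
  show ?thesis
  proof (rule that[OF Z])
    fix z w :: complex assume z: "z \<in> ?S" and w: "w \<in> ?D"
    define L where "L y = laurent (m y) (p y) z" for y
    \<comment> \<open>The first sum is the error of the coefficients, the second the oscillation of
      \<open>K\<close> over short arcs, small by uniform continuity.\<close>
    have "(\<Sum>y\<in>Z. L y *s K (y, w)) - K (z, w) =
      (\<Sum>y\<in>Z. (L y - of_real (\<tau> y z)) *s K (y, w)) + (\<Sum>y\<in>Z. of_real (\<tau> y z) *s (K (y, w) - K (z, w)))"
    proof -
      have "(\<Sum>y\<in>Z. complex_of_real (\<tau> y z) *s K (z, w)) = (\<Sum>y\<in>Z. complex_of_real (\<tau> y z)) *s K (z, w)"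
        by (simp add: vec_eq_iff sum_distrib_right)
      also have "(\<Sum>y\<in>Z. complex_of_real (\<tau> y z)) = 1" using \<tau>1[OF z] by (metis of_real_1 of_real_sum)
      finally have "(\<Sum>y\<in>Z. complex_of_real (\<tau> y z) *s K (z, w)) = K (z, w)" by simp
      then show ?thesis
        by (simp add: sum.distrib sum_subtractf vector_sub_rdistrib vector_ssub_ldistrib)
    qed
    moreover have "norm (\<Sum>y\<in>Z. (L y - of_real (\<tau> y z)) *s K (y, w)) \<le> e / 2"
    proof -
      have "norm (\<Sum>y\<in>Z. (L y - of_real (\<tau> y z)) *s K (y, w)) \<le> (\<Sum>y\<in>Z. e' * B)"
      proof (rule sum_norm_le)
        fix y assume y: "y \<in> Z"
        have "norm (L y - of_real (\<tau> y z)) \<le> e'" using mp[OF y z] by (simp add: L_def norm_minus_commute)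
        moreover have "norm (K (y, w)) \<le> B" using B(2) y Z(2) w by blast
        ultimately show "norm ((L y - of_real (\<tau> y z)) *s K (y, w)) \<le> e' * B"
          unfolding norm_vec_scale using e' by (intro mult_mono) auto
      qed
      also have "\<dots> = e / 2 * (real (card Z) / (real (card Z) + 1))"
      proof -
        have "e' * B = e / 2 / (real (card Z) + 1)" using B(1) by (simp add: e'_def)
        then show ?thesis by simp
      qed
      also have "\<dots> \<le> e / 2" using e by (intro mult_left_le) (auto simp: divide_le_eq)
      finally show ?thesis .
    qed
    moreover have "norm (\<Sum>y\<in>Z. of_real (\<tau> y z) *s (K (y, w) - K (z, w))) \<le> e / 2"
    proof -
      have "norm (\<Sum>y\<in>Z. of_real (\<tau> y z) *s (K (y, w) - K (z, w))) \<le> (\<Sum>y\<in>Z. \<tau> y z * (e / 2))"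
      proof (rule sum_norm_le)
        fix y assume y: "y \<in> Z"
        show "norm (of_real (\<tau> y z) *s (K (y, w) - K (z, w))) \<le> \<tau> y z * (e / 2)"
        proof (cases "d \<le> dist z y")
          case True
          then show ?thesis using \<tau>0[OF True] by (simp add: norm_vec_scale)
        next
          case False
          then have "dist (K (y, w)) (K (z, w)) < e / 2"
            using d(2)[of "(z, w)" "(y, w)"] y Z(2) z w by (auto simp: dist_Pair_Pair dist_commute)
          then have "norm (K (y, w) - K (z, w)) \<le> e / 2" by (simp add: dist_norm)
          then have "\<tau> y z * norm (K (y, w) - K (z, w)) \<le> \<tau> y z * (e / 2)"
            using \<tau>p[OF y z] by (rule mult_left_mono)
          then show ?thesis unfolding norm_vec_scale using \<tau>p[OF y z] by simp
        qed
      qed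
      also have "\<dots> = (\<Sum>y\<in>Z. \<tau> y z) * (e / 2)" by (rule sum_distrib_right[symmetric])
      also have "\<dots> = e / 2" using \<tau>1[OF z] by simp
      finally show ?thesis .
    qed
    ultimately have "norm ((\<Sum>y\<in>Z. L y *s K (y, w)) - K (z, w)) \<le> e / 2 + e / 2"
      by (simp only: norm_triangle_mono)
    then show "norm ((\<Sum>y\<in>Z. laurent (m y) (p y) z *s K (y, w)) - K (z, w)) \<le> e"
      by (simp add: L_def)
  qed
qed

text \<open>After Laurent approximation in \<open>z\<close>, the substitution \<open>w = z ^ k\<close> cancels the poles at \<open>z = 0\<close>.
  The resulting disc is close to \<open>g\<close> away from the circle, where \<open>z ^ k\<close> is negligible.\<close>

lemma analytic_disc_patching:
  fixes g :: "complex \<Rightarrow> complex ^ 'm" and F :: "complex \<times> complex \<Rightarrow> complex ^ 'm"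
  assumes X: "open X" and W: "open W" and g: "g \<in> analytic_discs X"
    and F: "continuous_on (sphere 0 1 \<times> cball 0 1) F"
    and FX: "\<And>z. z \<in> sphere 0 1 \<Longrightarrow> (\<lambda>w. F (z, w)) \<in> analytic_discs_bdry X W"
    and F0: "\<And>z. z \<in> sphere 0 1 \<Longrightarrow> F (z, 0) = g z"
  obtains f where "f \<in> analytic_discs_bdry X W" "f 0 = g 0"
proof -
  let ?S = "sphere (0::complex) 1" and ?D = "cball (0::complex) 1"
  have gd: "\<And>i. (\<lambda>z. g z $ i) \<in> disc_algebra" and gX: "g ` ?D \<subseteq> X"
    using g by (auto simp: analytic_discs_iff)
  have gc: "continuous_on ?D g" using g by (simp add: analytic_discs_def)
  \<comment> \<open>Without \<open>g\<close> the slices vanish at \<open>w = 0\<close>; hence the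
    approximation keeps the centres \<open>g z\<close> exactly and each summand carries a factor
    \<open>w\<close>.\<close>
  define K where "K q = F q - g (fst q)" for q
  have Kc: "continuous_on (?S \<times> ?D) K"
    unfolding K_def by (intro continuous_intros F continuous_on_compose2[OF gc]) auto
  have Kd: "(\<lambda>w. K (z, w) $ i) \<in> disc_algebra" if "z \<in> ?S" for z i
    using FX[OF that] by (auto simp: K_def analytic_discs_bdry_def analytic_discs_iff intro!: disc_algebra_diff)
  have K0: "K (z, 0) = 0" if "z \<in> ?S" for z using F0[OF that] by (simp add: K_def)
  have FinX: "F (z, w) \<in> X" if "z \<in> ?S" "w \<in> ?D" for z w
    using FX[OF that(1)] that(2) by (auto simp: analytic_discs_bdry_def analytic_discs_def)
  have FinW: "F (z, w) \<in> W" if "z \<in> ?S" "w \<in> ?S" for z w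
    using FX[OF that(1)] that(2) by (auto simp: analytic_discs_bdry_def)
  obtain e1 where e1: "e1 > 0" "\<And>x y. x \<in> F ` (?S \<times> ?D) \<Longrightarrow> norm y \<le> e1 \<Longrightarrow> x + y \<in> X"
  proof (rule compact_in_open_translate[OF _ X, of "F ` (?S \<times> ?D)"])
    show "compact (F ` (?S \<times> ?D))" by (intro compact_continuous_image F compact_Times) auto
  qed (use FinX in auto)
  obtain e2 where e2: "e2 > 0" "\<And>x y. x \<in> F ` (?S \<times> ?S) \<Longrightarrow> norm y \<le> e2 \<Longrightarrow> x + y \<in> W"
  proof (rule compact_in_open_translate[OF _ W, of "F ` (?S \<times> ?S)"])
    show "compact (F ` (?S \<times> ?S))"
      by (intro compact_continuous_image continuous_on_subset[OF F] compact_Times) auto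
  qed (use FinW in auto)
  obtain e3 where e3: "e3 > 0" "\<And>x y. x \<in> g ` ?D \<Longrightarrow> norm y \<le> e3 \<Longrightarrow> x + y \<in> X"
    by (rule compact_in_open_translate[OF compact_continuous_image[OF gc] X gX]) auto
  define e where "e = min e1 e2"
  have e: "e > 0" using e1 e2 by (simp add: e_def)
  obtain Z m p where Z: "finite Z" "Z \<subseteq> ?S"
    and apx: "\<And>z w. z \<in> ?S \<Longrightarrow> w \<in> ?D \<Longrightarrow> norm ((\<Sum>y\<in>Z. laurent (m y) (p y) z *s K (y, w)) - K (z, w)) \<le> e"
    by (rule laurent_approximation[OF Kc e]) blast
  define \<Psi> where "\<Psi> q = g (fst q) + (\<Sum>y\<in>Z. laurent (m y) (p y) (fst q) *s K (y, snd q))" for q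
  have \<Psi>_near: "\<exists>v. norm v \<le> e \<and> \<Psi> (z, w) = F (z, w) + v" if "z \<in> ?S" "w \<in> ?D" for z w
    using apx[OF that] by (intro exI[of _ "(\<Sum>y\<in>Z. laurent (m y) (p y) z *s K (y, w)) - K (z, w)"]) (simp add: \<Psi>_def K_def)
  have \<Psi>X: "\<Psi> (z, w) \<in> X" if "z \<in> ?S" "w \<in> ?D" for z w
    using \<Psi>_near[OF that] e1(2)[of "F (z, w)"] that by (auto simp: e_def)
  have \<Psi>W: "\<Psi> (z, w) \<in> W" if "z \<in> ?S" "w \<in> ?S" for z w
    using \<Psi>_near[of z w] e2(2)[of "F (z, w)"] that by (auto simp: e_def)
  \<comment> \<open>The origin is cut out because the Laurent coefficients may have poles
    there.\<close>
  define Ann where "Ann = {z::complex. 1/2 \<le> norm z \<and> norm z \<le> 1}"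
  have Ann: "compact Ann"
  proof -
    have "Ann = cball 0 1 - ball 0 (1/2)" by (auto simp: Ann_def)
    then show ?thesis by (simp add: compact_diff)
  qed
  have \<Psi>c: "continuous_on (Ann \<times> ?D) \<Psi>"
  proof -
    have "continuous_on (Ann \<times> ?D) (\<lambda>q. K (y, snd q))" if "y \<in> Z" for y
      by (intro continuous_on_compose2[OF Kc] continuous_intros) (use that Z in auto)
    moreover have "continuous_on (Ann \<times> ?D) (\<lambda>q. laurent (m y) (p y) (fst q))" for y
      unfolding laurent_def by (intro continuous_intros) (auto simp: Ann_def)
    ultimately show ?thesis
      unfolding \<Psi>_def by (intro continuous_intros continuous_on_compose2[OF gc]) (auto simp: Ann_def)
  qed
  \<comment> \<open>Over |z| = 1 all values of \<open>\<Psi>\<close> lie in \<open>X\<close>, so on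
    the compact set of bad points |z| has a maximum strictly below 1; this maximum serves as
    \<open>t\<close>.\<close>
  obtain t where t: "0 < t" "t < 1" "\<And>z w. t < norm z \<Longrightarrow> norm z \<le> 1 \<Longrightarrow> norm w \<le> 1 \<Longrightarrow> \<Psi> (z, w) \<in> X"
  proof -
    define Bad where "Bad = (Ann \<times> ?D) \<inter> \<Psi> -` (- X)"
    have "compact Bad"
    proof -
      have "closedin (top_of_set (Ann \<times> ?D)) Bad"
        unfolding Bad_def by (rule continuous_closedin_preimage[OF \<Psi>c]) (use X in auto)
      moreover have "compact (Ann \<times> ?D)" by (intro compact_Times Ann) simp
      ultimately show ?thesis by (blast intro: closedin_compact)
    qed
    have notBad: "\<Psi> (z, w) \<in> X" if "(z, w) \<notin> Bad" "1/2 \<le> norm z" "norm z \<le> 1" "norm w \<le> 1" for z w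
      using that by (auto simp: Bad_def Ann_def)
    show ?thesis
    proof (cases "Bad = {}")
      case True
      show ?thesis by (rule that[of "1/2"]) (use True notBad in auto)
    next
      case False
      have "continuous_on Bad (\<lambda>q. norm (fst q))" by (intro continuous_intros)
      then obtain b where b: "b \<in> Bad" "\<And>q. q \<in> Bad \<Longrightarrow> norm (fst q) \<le> norm (fst b)"
        using continuous_attains_sup[OF \<open>compact Bad\<close> False] by blast
      have "fst b \<in> Ann" "snd b \<in> ?D" "\<Psi> (fst b, snd b) \<notin> X" using b(1) by (auto simp: Bad_def)
      then have "norm (fst b) \<noteq> 1" using \<Psi>X[of "fst b" "snd b"] by auto
      then have "1/2 \<le> norm (fst b)" "norm (fst b) < 1" using \<open>fst b \<in> Ann\<close> by (auto simp: Ann_def)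
      show ?thesis
      proof (rule that[of "norm (fst b)"])
        fix z w :: complex assume zw: "norm (fst b) < norm z" "norm z \<le> 1" "norm w \<le> 1"
        then have "(z, w) \<notin> Bad" using b(2)[of "(z, w)"] by auto
        then show "\<Psi> (z, w) \<in> X" using zw \<open>1/2 \<le> norm (fst b)\<close> by (intro notBad) auto
      qed (use \<open>1/2 \<le> norm (fst b)\<close> \<open>norm (fst b) < 1\<close> in auto)
    qed
  qed
  have "\<exists>R. R \<in> disc_algebra \<and> (\<forall>w. K (y, w) $ i = w * R w)" if "y \<in> Z" for y i
    using disc_algebra_factor[OF Kd, of y i] K0[of y] that Z(2) by (metis subsetD zero_index)
  then obtain R where R: "\<And>y i. y \<in> Z \<Longrightarrow> R y i \<in> disc_algebra" "\<And>y i w. y \<in> Z \<Longrightarrow> K (y, w) $ i = w * R y i w"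
    by metis
  define V where "V y w = (\<chi> i. R y i w)" for y w
  have KV: "K (y, w) = w *s V y w" if "y \<in> Z" for y w
    using R(2)[OF that] by (simp add: V_def vec_eq_iff)
  have "\<exists>B\<ge>0. \<forall>z. norm z \<le> 1 \<longrightarrow> norm (R y i z) \<le> B" if "y \<in> Z" for y i
    using disc_algebra_bounded[OF R(1)[OF that]] by metis
  then obtain BR where BR: "\<And>y i. y \<in> Z \<Longrightarrow> BR y i \<ge> 0" "\<And>y i z. y \<in> Z \<Longrightarrow> norm z \<le> 1 \<Longrightarrow> norm (R y i z) \<le> BR y i"
    by metis
  have "\<exists>B\<ge>0. \<forall>z. norm z \<le> 1 \<longrightarrow> norm (poly (p y) z) \<le> B" for y
    using disc_algebra_bounded[OF disc_algebra_poly] by metis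
  then obtain BP where BP: "\<And>y. BP y \<ge> 0" "\<And>y z. norm z \<le> 1 \<Longrightarrow> norm (poly (p y) z) \<le> BP y"
    by metis
  have VB: "norm (V y w) \<le> (\<Sum>i\<in>UNIV. BR y i)" if "y \<in> Z" "norm w \<le> 1" for y w
    using norm_vec_le_sum[of "V y w"] sum_mono[of UNIV "\<lambda>i. norm (R y i w)" "BR y"] BR(2)[OF that]
    by (simp add: V_def)
  define Q where "Q = (\<Sum>y\<in>Z. BP y * (\<Sum>i\<in>UNIV. BR y i))"
  have Q: "Q \<ge> 0" unfolding Q_def by (intro sum_nonneg mult_nonneg_nonneg BP BR) auto
  define mm where "mm = (\<Sum>y\<in>Z. m y)"
  have mm: "m y \<le> mm" if "y \<in> Z" for y unfolding mm_def using that Z(1) by (intro member_le_sum) auto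
  \<comment> \<open>For |z| at most \<open>t\<close> the correction added to \<open>g\<close> will
    be bounded by \<open>Q * t ^ n\<close>, uniformly in the exponent \<open>k\<close> still to be
    chosen.\<close>
  obtain n where n: "Q * t ^ n \<le> e3"
  proof -
    obtain n where "t ^ n < e3 / (Q + 1)" using real_arch_pow_inv[of "e3 / (Q + 1)" t] e3(1) Q t by auto
    then have "(Q + 1) * t ^ n \<le> e3" using Q by (simp add: field_simps)
    moreover have "Q * t ^ n \<le> (Q + 1) * t ^ n" using t by (intro mult_right_mono) auto
    ultimately show ?thesis by (intro that[of n]) linarith
  qed
  \<comment> \<open>\<open>mm\<close> outweighs every pole order, \<open>n\<close> provides the
    decay, and the successor makes \<open>k - m y\<close> positive, so that the correction vanishes
    at 0 and the centre is kept.\<close>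
  define k where "k = Suc (mm + n)"
  define T where "T y z = (poly (p y) z * z ^ (k - m y)) *s V y (z ^ k)" for y z
  define f where "f z = g z + (\<Sum>y\<in>Z. T y z)" for z
  have f\<Psi>: "f z = \<Psi> (z, z ^ k)" if "z \<noteq> 0" for z
  proof -
    have "T y z = laurent (m y) (p y) z *s K (y, z ^ k)" if "y \<in> Z" for y
    proof -
      have "m y \<le> k" using mm[OF that] by (simp add: k_def)
      then have "poly (p y) z * z ^ (k - m y) = laurent (m y) (p y) z * z ^ k"
        using \<open>z \<noteq> 0\<close> by (simp add: laurent_def power_diff)
      then show ?thesis by (simp add: T_def KV[OF that])
    qed
    then show ?thesis by (simp add: f_def \<Psi>_def)
  qed
  show ?thesis
  proof (rule that[of f])
    have "T y 0 = 0" if "y \<in> Z" for y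
      using mm[OF that] by (simp add: T_def k_def)
    then show "f 0 = g 0" by (simp add: f_def)
    have "(\<lambda>z. T y z $ i) \<in> disc_algebra" if "y \<in> Z" for y i
      unfolding T_def V_def vector_smult_component vec_lambda_beta
      by (intro disc_algebra_mult disc_algebra_poly disc_algebra_power disc_algebra_power_compose R(1) that) (simp add: k_def)
    then have 1: "(\<lambda>z. f z $ i) \<in> disc_algebra" for i
      unfolding f_def vector_add_component sum_component
      by (intro disc_algebra_add disc_algebra_sum gd)
    have 2: "f z \<in> X" if z: "norm z \<le> 1" for z
    \<comment> \<open>In the outer annulus \<open>f z\<close> is a value of \<open>\<Psi>\<close>;
      further inside it is within \<open>e3\<close> of \<open>g z\<close>.\<close>
    proof (cases "t < norm z")
      case True
      then have "z \<noteq> 0" using t by auto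
      then show ?thesis unfolding f\<Psi>[OF \<open>z \<noteq> 0\<close>]
        by (intro t(3) True z) (use z in \<open>simp add: norm_power power_le_one\<close>)
    next
      case False
      have "norm (\<Sum>y\<in>Z. T y z) \<le> (\<Sum>y\<in>Z. BP y * (\<Sum>i\<in>UNIV. BR y i) * t ^ n)"
      proof (rule sum_norm_le)
        fix y assume y: "y \<in> Z"
        have "norm z ^ (k - m y) \<le> norm z ^ n" using mm[OF y] z by (intro power_decreasing) (auto simp: k_def)
        also have "\<dots> \<le> t ^ n" using False by (intro power_mono) auto
        finally have a: "norm z ^ (k - m y) \<le> t ^ n" .
        have "norm (T y z) = norm (poly (p y) z) * norm z ^ (k - m y) * norm (V y (z ^ k))"
          by (simp add: T_def norm_vec_scale norm_mult norm_power)
        also have "\<dots> \<le> BP y * t ^ n * (\<Sum>i\<in>UNIV. BR y i)"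
          by (intro mult_mono a BP VB y z mult_nonneg_nonneg) (use z t in \<open>auto simp: norm_power power_le_one\<close>)
        finally show "norm (T y z) \<le> BP y * (\<Sum>i\<in>UNIV. BR y i) * t ^ n" by (simp add: mult_ac)
      qed
      also have "\<dots> = Q * t ^ n" by (simp add: Q_def sum_distrib_right)
      finally show ?thesis unfolding f_def using n z by (intro e3(2)) auto
    qed
    have 3: "f z \<in> W" if z: "norm z = 1" for z
    proof -
      have "z \<noteq> 0" using z by auto
      then show ?thesis unfolding f\<Psi>[OF \<open>z \<noteq> 0\<close>]
        using \<Psi>W[of z "z ^ k"] z by (simp add: norm_power)
    qed
    show "f \<in> analytic_discs_bdry X W"
      using 1 2 3 by (auto simp: analytic_discs_bdry_def analytic_discs_iff)
  qed
qed

text \<open>Compactness of the image of \<open>C\<close> gives one distance to the complement for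
  all \<open>c\<close>, hence a single \<open>d\<close>. This carries a disc or a homotopy from the
  base point \<open>p\<close> to all nearby ones.\<close>

lemma translates_stay_in_open:
  fixes G :: "'a::metric_space \<Rightarrow> 'b::{real_normed_vector, heine_borel}"
  assumes O: "open O'" and A: "compact (A ` C)" and G: "continuous_on S G" and p: "p \<in> S"
    and in_O: "\<And>c. c \<in> C \<Longrightarrow> G p + A c \<in> O'"
  obtains d where "d > 0" "\<And>z c. z \<in> S \<Longrightarrow> dist z p < d \<Longrightarrow> c \<in> C \<Longrightarrow> G z + A c \<in> O'"
proof -
  have "compact ((\<lambda>a. G p + a) ` A ` C)"
    by (intro compact_continuous_image A continuous_intros)
  moreover have "(\<lambda>a. G p + a) ` A ` C \<subseteq> O'" using in_O by auto
  ultimately obtain r where r: "r > 0" "\<And>x y. x \<in> (\<lambda>a. G p + a) ` A ` C \<Longrightarrow> norm y \<le> r \<Longrightarrow> x + y \<in> O'"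
    using compact_in_open_translate[OF _ O] by blast
  obtain d where d: "d > 0" "\<And>z. z \<in> S \<Longrightarrow> dist z p < d \<Longrightarrow> dist (G z) (G p) < r"
    using G p r(1) unfolding continuous_on_iff by blast
  show ?thesis
  proof (rule that[OF d(1)])
    fix z c assume "z \<in> S" "dist z p < d" and c: "c \<in> C"
    then have "norm (G z - G p) \<le> r" using d(2) by (auto simp: dist_norm less_imp_le)
    then have "G p + A c + (G z - G p) \<in> O'" using c by (intro r(2)) auto
    then show "G z + A c \<in> O'" by (simp add: algebra_simps)
  qed
qed

text \<open>The index type \<open>'n option\<close> provides the coordinates of X times the plane,
  with \<open>None\<close> for the majorant, so that \<open>analytic_disc_patching\<close> applies
  to the lifted data. The boundary domain is the open strict hypergraph of \<phi>; the extra
  coordinate of the patched disc is then a majorant with value \<open>h 0\<close> at the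
  centre.\<close>

lemma analytic_disc_patching_majorant:
  fixes g :: "complex \<Rightarrow> complex ^ 'n" and F :: "complex \<times> complex \<Rightarrow> complex ^ 'n"
    and Q :: "complex \<times> complex \<Rightarrow> complex"
  assumes X: "open X" and W: "open W" and \<phi>: "usc_on W \<phi>"
    and g: "g \<in> analytic_discs X" and h: "h \<in> disc_algebra"
    and F: "continuous_on (sphere 0 1 \<times> cball 0 1) F" and Q: "continuous_on (sphere 0 1 \<times> cball 0 1) Q"
    and FX: "\<And>z. z \<in> sphere 0 1 \<Longrightarrow> (\<lambda>w. F (z, w)) \<in> analytic_discs X"
    and QD: "\<And>z. z \<in> sphere 0 1 \<Longrightarrow> (\<lambda>w. Q (z, w)) \<in> disc_algebra"
    and centre: "\<And>z. z \<in> sphere 0 1 \<Longrightarrow> F (z, 0) = g z \<and> Q (z, 0) = h z"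
    and bdry: "\<And>z w. z \<in> sphere 0 1 \<Longrightarrow> w \<in> sphere 0 1 \<Longrightarrow> F (z, w) \<in> W \<and> \<phi> (F (z, w)) < ereal (Re (Q (z, w)))"
  obtains f where "f \<in> analytic_discs_bdry X W" "f 0 = g 0" "poisson_functional \<phi> f \<le> ereal (Re (h 0))"
proof -
  define pr :: "complex ^ ('n option) \<Rightarrow> complex ^ 'n" where "pr v = (\<chi> i. v $ Some i)" for v
  define lift :: "complex ^ 'n \<Rightarrow> complex \<Rightarrow> complex ^ ('n option)" where
    "lift x s = (\<chi> j. case j of None \<Rightarrow> s | Some i \<Rightarrow> x $ i)" for x s
  have pr_lift [simp]: "pr (lift x s) = x" "lift x s $ None = s" for x s
    by (auto simp: pr_def lift_def vec_eq_iff)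
  have lift_nth: "lift x s $ j = (case j of None \<Rightarrow> s | Some i \<Rightarrow> x $ i)" for x s j
    by (simp add: lift_def)
  have pr_cont: "continuous_on UNIV pr"
    unfolding pr_def by (intro continuous_on_vec_lambda continuous_intros)
  have lift_cont: "continuous_on S (\<lambda>q. lift (a q) (b q))"
    if "continuous_on S a" "continuous_on S b" for S :: "(complex \<times> complex) set" and a b
    unfolding lift_def
  proof (intro continuous_on_vec_lambda)
    fix j :: "'n option"
    show "continuous_on S (\<lambda>q. case j of None \<Rightarrow> b q | Some i \<Rightarrow> a q $ i)"
      using that by (cases j) (auto intro: continuous_on_component)
  qed
  define X' where "X' = pr -` X"
  define W' where "W' = (\<lambda>v. (pr v, v $ None)) -` {(x, s). x \<in> W \<and> \<phi> x < ereal (Re s)}"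
  have X': "open X'" unfolding X'_def by (rule open_vimage[OF X pr_cont])
  have W': "open W'"
    unfolding W'_def by (rule open_vimage[OF open_strict_hypergraph[OF W \<phi>]]) (intro continuous_intros pr_cont)
  have disc: "(\<lambda>z. lift (a z) (b z)) \<in> analytic_discs X'"
    if "a \<in> analytic_discs X" "b \<in> disc_algebra" for a b
    unfolding analytic_discs_iff
  proof (intro conjI allI)
    show "(\<lambda>z. lift (a z) (b z) $ j) \<in> disc_algebra" for j
      using that by (cases j) (auto simp: lift_nth analytic_discs_iff)
    show "(\<lambda>z. lift (a z) (b z)) ` cball 0 1 \<subseteq> X'"
      using that(1) by (auto simp: X'_def analytic_discs_iff)
  qed
  obtain f' where f': "f' \<in> analytic_discs_bdry X' W'" "f' 0 = lift (g 0) (h 0)"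
  proof (rule analytic_disc_patching[OF X' W' disc[OF g h], of "\<lambda>q. lift (F q) (Q q)"])
    show "continuous_on (sphere 0 1 \<times> cball 0 1) (\<lambda>q. lift (F q) (Q q))" by (intro lift_cont F Q)
    show "(\<lambda>w. lift (F (z, w)) (Q (z, w))) \<in> analytic_discs_bdry X' W'" if "z \<in> sphere 0 1" for z
      using disc[OF FX[OF that] QD[OF that]] bdry[OF that] by (auto simp: analytic_discs_bdry_def W'_def)
    show "lift (F (z, 0)) (Q (z, 0)) = lift (g z) (h z)" if "z \<in> sphere 0 1" for z
      using centre[OF that] by simp
  qed
  have d: "(\<lambda>z. f' z $ j) \<in> disc_algebra" for j
    using f'(1) by (auto simp: analytic_discs_bdry_def analytic_discs_iff)
  have "f' ` cball 0 1 \<subseteq> X'" using f'(1) by (simp add: analytic_discs_bdry_def analytic_discs_iff)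
  then have f'X: "\<And>z. z \<in> cball 0 1 \<Longrightarrow> pr (f' z) \<in> X" unfolding X'_def by blast
  have f'W: "pr (f' z) \<in> W \<and> \<phi> (pr (f' z)) < ereal (Re (f' z $ None))" if "z \<in> sphere 0 1" for z
  proof -
    have "f' z \<in> W'" using f'(1) that by (auto simp: analytic_discs_bdry_def)
    then show ?thesis by (simp add: W'_def)
  qed
  show ?thesis
  proof (rule that[of "\<lambda>z. pr (f' z)"])
    have "(\<lambda>z. pr (f' z) $ i) \<in> disc_algebra" for i using d[of "Some i"] by (simp add: pr_def)
    then show "(\<lambda>z. pr (f' z)) \<in> analytic_discs_bdry X W"
      using f'X f'W by (auto simp: analytic_discs_bdry_def analytic_discs_iff)
    show "pr (f' 0) = g 0" by (simp add: f'(2))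
    have "poisson_functional \<phi> (\<lambda>z. pr (f' z)) \<le> ereal (Re (f' 0 $ None))"
      unfolding poisson_functional_def
      by (rule ereal_integral_le_disc_algebra[OF d]) (use f'W in \<open>auto intro: less_imp_le\<close>)
    then show "poisson_functional \<phi> (\<lambda>z. pr (f' z)) \<le> ereal (Re (h 0))" by (simp add: f'(2))
  qed
qed

section \<open>Peak functions from the Poisson kernel\<close>

lemma Re_cayley:
  fixes u :: complex
  assumes "norm u < 1"
  shows "Re ((1 + u) / (1 - u)) \<ge> 0"
proof -
  have "Re ((1 + u) / (1 - u)) = Re ((1 + u) * cnj (1 - u)) / (norm (1 - u))\<^sup>2"
    by (subst complex_div_cnj) simp
  also have "Re ((1 + u) * cnj (1 - u)) = 1 - (norm u)\<^sup>2"
    unfolding cmod_power2 by (simp add: algebra_simps power2_eq_square)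
  also have "(1 - (norm u)\<^sup>2) / (norm (1 - u))\<^sup>2 \<ge> 0"
    using assms by (intro divide_nonneg_nonneg) (auto simp: power_le_one)
  finally show ?thesis .
qed

text \<open>The real part of \<open>h\<close> is \<eta> times the Poisson kernel of a point on the
  ray through \<open>p\<close>: its mean stays \<eta>, while its value at \<open>p\<close> is
  unbounded as that point approaches the circle.\<close>

lemma poisson_kernel_peak:
  assumes p: "p \<in> sphere 0 1" and \<eta>: "\<eta> > 0"
  obtains h where "h \<in> disc_algebra" "\<And>z. z \<in> sphere 0 1 \<Longrightarrow> Re (h z) \<ge> 0" "Re (h p) > M" "Re (h 0) = \<eta>"
proof -
  define B where "B = \<bar>M\<bar>"
  \<comment> \<open>Solves \<open>\<eta> * ((1 + r) / (1 - r)) = 2 * B + \<eta>\<close>, the value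
    of the peak at \<open>p\<close>.\<close>
  define r where "r = B / (B + \<eta>)"
  have r: "0 \<le> r" "r < 1" using \<eta> by (auto simp: r_def B_def intro!: divide_nonneg_nonneg)
  define h where "h z = of_real \<eta> * ((1 + of_real r * z * cnj p) / (1 - of_real r * z * cnj p))" for z
  have u: "norm (of_real r * z * cnj p) < 1" if "z \<in> cball 0 1" for z
  proof -
    have "norm (of_real r * z * cnj p) = r * norm z" using p r by (simp add: norm_mult)
    also have "\<dots> \<le> r" using that r by (simp add: mult_left_le)
    finally show ?thesis using r by simp
  qed
  then have nz: "1 - of_real r * z * cnj p \<noteq> 0" if "z \<in> cball 0 1" for z
    using that by (metis eq_iff_diff_eq_0 less_irrefl norm_one)
  show ?thesis
  proof (rule that[of h])
    show "h \<in> disc_algebra"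
      unfolding disc_algebra_def h_def using nz
      by (auto intro!: continuous_on_mult continuous_on_divide continuous_on_add continuous_on_diff
          continuous_on_const continuous_on_id holomorphic_on_mult holomorphic_on_divide holomorphic_on_add
          holomorphic_on_diff holomorphic_on_const holomorphic_on_id)
    show "Re (h z) \<ge> 0" if "z \<in> sphere 0 1" for z
    proof -
      have "Re (of_real \<eta> * x) = \<eta> * Re x" for x by simp
      then have "Re (h z) = \<eta> * Re ((1 + of_real r * z * cnj p) / (1 - of_real r * z * cnj p))"
        unfolding h_def by blast
      moreover have "Re ((1 + of_real r * z * cnj p) / (1 - of_real r * z * cnj p)) \<ge> 0"
        using that by (intro Re_cayley u) auto
      ultimately show ?thesis using \<eta> by simp
    qed
    have "p * cnj p = 1" using p by (simp add: complex_norm_square[symmetric])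
    then have "h p = of_real \<eta> * ((1 + of_real r) / (1 - of_real r))" by (simp add: h_def mult.assoc)
    also have "\<dots> = of_real (\<eta> * ((1 + r) / (1 - r)))" by simp
    finally have "Re (h p) = \<eta> * ((1 + r) / (1 - r))" by (simp only: Re_complex_of_real)
    also have "\<dots> = 2 * B + \<eta>"
    proof -
      have "B + \<eta> > 0" using \<eta> by (simp add: B_def)
      then have "1 + r = (2 * B + \<eta>) / (B + \<eta>)" "1 - r = \<eta> / (B + \<eta>)" by (auto simp: r_def field_simps)
      then show ?thesis using \<eta> \<open>B + \<eta> > 0\<close> by simp
    qed
    finally show "Re (h p) > M" using \<eta> by (simp add: B_def)
    show "Re (h 0) = \<eta>" by (simp add: h_def)
  qed
qed

text \<open>Added to a majorant, such an \<open>h\<close> allows an arbitrarily large constant near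
  finitely many points, spoils no inequality elsewhere on the circle, and raises the mean by less
  than \<eta>.\<close>

lemma poisson_kernel_peaks:
  assumes P: "finite P" "P \<subseteq> sphere 0 1" and \<eta>: "\<eta> > 0"
  obtains h where "h \<in> disc_algebra" "\<And>z. z \<in> sphere 0 1 \<Longrightarrow> Re (h z) \<ge> 0"
    "\<And>p. p \<in> P \<Longrightarrow> Re (h p) > M" "Re (h 0) < \<eta>"
proof -
  define \<eta>' where "\<eta>' = \<eta> / (real (card P) + 1)"
  have "\<eta>' > 0" using \<eta> by (simp add: \<eta>'_def)
  then have "\<exists>h. h \<in> disc_algebra \<and> (\<forall>z\<in>sphere 0 1. Re (h z) \<ge> 0) \<and> Re (h p) > M \<and> Re (h 0) = \<eta>'" if "p \<in> P" for p
    using poisson_kernel_peak[of p \<eta>' M] P(2) that by (metis subsetD)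
  then obtain k where k: "\<And>p. p \<in> P \<Longrightarrow> k p \<in> disc_algebra"
    "\<And>p z. p \<in> P \<Longrightarrow> z \<in> sphere 0 1 \<Longrightarrow> Re (k p z) \<ge> 0"
    "\<And>p. p \<in> P \<Longrightarrow> Re (k p p) > M" "\<And>p. p \<in> P \<Longrightarrow> Re (k p 0) = \<eta>'"
    by metis
  show ?thesis
  proof (rule that[of "\<lambda>z. \<Sum>p\<in>P. k p z"])
    show "(\<lambda>z. \<Sum>p\<in>P. k p z) \<in> disc_algebra" by (intro disc_algebra_sum k)
    show "Re (\<Sum>p\<in>P. k p z) \<ge> 0" if "z \<in> sphere 0 1" for z
      using k(2)[OF _ that] by (auto intro: sum_nonneg)
    show "Re (\<Sum>p\<in>P. k p q) > M" if q: "q \<in> P" for q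
    proof -
      have "Re (k q q) \<le> (\<Sum>p\<in>P. Re (k p q))"
        by (rule member_le_sum[OF q]) (use k(2) q P in auto)
      then show ?thesis using k(3)[OF q] by simp
    qed
    have "Re (\<Sum>p\<in>P. k p 0) = real (card P) * \<eta>'" using k(4) by simp
    also have "\<dots> < (real (card P) + 1) * \<eta>'" using \<open>\<eta>' > 0\<close> by simp
    also have "\<dots> = \<eta>" by (simp add: \<eta>'_def)
    finally show "Re (\<Sum>p\<in>P. k p 0) < \<eta>" .
  qed
qed

section \<open>Subdivision of the circle into arcs\<close>

lemma dist_cis_le: "dist (cis a) (cis b) \<le> \<bar>a - b\<bar>"
proof -
  have "cis a - cis b = cis b * (cis (a - b) - 1)" by (simp add: algebra_simps cis_mult)
  then have "dist (cis a) (cis b) = norm (cis (a - b) - 1)" by (simp add: dist_norm norm_mult)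
  also have "\<dots> = 2 * \<bar>sin ((a - b) / 2)\<bar>" unfolding cis_conv_exp dist_exp_i_1 ..
  also have "\<dots> \<le> 2 * \<bar>(a - b) / 2\<bar>" by (intro mult_left_mono abs_sin_x_le_abs_x) auto
  finally show ?thesis by simp
qed

lemma cis_eq_cases:
  assumes "cis s = cis t" "s \<in> {0..2 * pi}" "t \<in> {0..2 * pi}"
  shows "s = t \<or> (s = 0 \<and> t = 2 * pi) \<or> (s = 2 * pi \<and> t = 0)"
proof -
  have "sin s = sin t \<and> cos s = cos t" using assms(1) by (simp add: complex_eq_iff)
  then obtain n :: int where n: "s = t + 2 * pi * n" using sin_cos_eq_iff[of s t] by auto
  have "\<bar>2 * pi * n\<bar> \<le> 2 * pi" using n assms(2,3) by auto
  then have "\<bar>real_of_int n\<bar> \<le> 1" by (simp add: abs_mult)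
  then have "n = 0 \<or> n = 1 \<or> n = - 1" by linarith
  then show ?thesis using n assms(2,3) by auto
qed

text \<open>The arc \<open>A j\<close> leads from \<open>p j\<close> to \<open>p ((j + 1) mod N)\<close>.\<close>

lemma circle_subdivision:
  assumes e: "e > 0"
  obtains N :: nat and A :: "nat \<Rightarrow> complex set" and p :: "nat \<Rightarrow> complex" where "N > 0"
    "\<And>j. j < N \<Longrightarrow> closed (A j)" "\<And>j. j < N \<Longrightarrow> A j \<subseteq> ball (p j) e" "(\<Union>j<N. A j) = sphere 0 1"
    "\<And>j. j < N \<Longrightarrow> p j \<in> A j" "\<And>j. j < N \<Longrightarrow> p ((j + 1) mod N) \<in> A j"
    "\<And>j. j < N \<Longrightarrow> p ((j + 1) mod N) \<noteq> p j"
    "\<And>i j z. i < N \<Longrightarrow> j < N \<Longrightarrow> i \<noteq> j \<Longrightarrow> z \<in> A i \<Longrightarrow> z \<in> A j \<Longrightarrow>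
       (z = p j \<and> j = (i + 1) mod N) \<or> (z = p i \<and> i = (j + 1) mod N)"
proof -
  obtain N0 :: nat where N0: "2 * pi / e < real N0" using reals_Archimedean2 by blast
  \<comment> \<open>\<open>N0\<close> makes the arcs shorter than \<open>e\<close>; at least two
    arcs are taken so that the end points of an arc differ.\<close>
  define N where "N = N0 + 2"
  have N: "N \<ge> 2" "2 * pi / e < real N" using N0 by (auto simp: N_def)
  then have Ne: "2 * pi / real N < e" using e by (simp add: field_simps)
  define a where "a j = 2 * pi * real j / real N" for j
  have a_step: "a (Suc j) = a j + 2 * pi / real N" for j by (simp add: a_def distrib_left add_divide_distrib)
  have a_mono: "a i \<le> a j" if "i \<le> j" for i j
    using that N by (auto simp: a_def intro!: divide_right_mono)
  have a0: "a 0 = 0" and aN: "a N = 2 * pi" using N by (auto simp: a_def)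
  have a_inj: "i = j" if "a i = a j" for i j using that N by (simp add: a_def)
  have a_range: "{a j..a (Suc j)} \<subseteq> {0..2 * pi}" if "j < N" for j
    using a_mono[of 0 j] a_mono[of "Suc j" N] that a0 aN by auto
  define p where "p j = cis (a j)" for j
  define A where "A j = cis ` {a j..a (Suc j)}" for j
  have pN: "p ((j + 1) mod N) = cis (a (Suc j))" if "j < N" for j
  proof (cases "Suc j = N")
    case True
    then show ?thesis using aN a0 by (simp add: p_def)
  next
    case False
    then show ?thesis using that by (simp add: p_def)
  qed
  \<comment> \<open>The case \<open>j < i\<close> follows by symmetry. Both alternatives can occur
    for one pair of arcs: with two arcs, both end points are shared.\<close>
  have overlap: "(z = p j \<and> j = (i + 1) mod N) \<or> (z = p i \<and> i = (j + 1) mod N)"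
    if ij: "i < j" "j < N" and z: "z \<in> A i" "z \<in> A j" for i j z
  proof -
    obtain s where s: "z = cis s" "s \<in> {a i..a (Suc i)}" using z(1) by (auto simp: A_def)
    obtain t where t: "z = cis t" "t \<in> {a j..a (Suc j)}" using z(2) by (auto simp: A_def)
    have "a (Suc i) \<le> a j" using ij by (intro a_mono) simp
    have "s \<in> {0..2 * pi}" "t \<in> {0..2 * pi}" using s t a_range[of i] a_range[of j] ij by (metis less_trans subsetD)+
    then consider "s = t" | "s = 0" "t = 2 * pi" | "s = 2 * pi" "t = 0"
      using cis_eq_cases[of s t] s(1) t(1) by auto
    then show ?thesis
    proof cases
      case 1
      then have eq: "a (Suc i) = a j" "s = a j" using s t \<open>a (Suc i) \<le> a j\<close> by auto
      then have "Suc i = j" by (intro a_inj)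
      then show ?thesis using eq s ij by (simp add: p_def)
    next
      \<comment> \<open>The closing point: the last arc ends at the angle 2 pi, where arc 0
        starts.\<close>
      case 2
      then have "a i = a 0" using s(2) a0 a_mono[of 0 i] by auto
      then have "i = 0" by (rule a_inj)
      have "a (Suc j) = a N" using 2 t(2) aN a_mono[of "Suc j" N] ij by auto
      then have "Suc j = N" by (rule a_inj)
      then show ?thesis using \<open>i = 0\<close> 2 s(1) a0 by (simp add: p_def)
    next
      \<comment> \<open>Impossible, since \<open>i < j\<close> makes arc \<open>i\<close> end before
        the angle 2 pi.\<close>
      case 3
      have "a (Suc i) < a N"
        using \<open>a (Suc i) \<le> a j\<close> a_mono[of j N] a_inj[of j N] ij by (auto simp: order_less_le)
      then show ?thesis using 3 s(2) aN by auto
    qed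
  qed
  show ?thesis
  proof (rule that[of N A p])
    show "N > 0" using N by simp
    show "closed (A j)" for j
      unfolding A_def by (intro compact_imp_closed compact_continuous_image continuous_intros) auto
    show "A j \<subseteq> ball (p j) e" for j
    proof
      fix z assume "z \<in> A j"
      then obtain s where s: "z = cis s" "s \<in> {a j..a (Suc j)}" by (auto simp: A_def)
      have "dist (p j) z \<le> \<bar>a j - s\<bar>" unfolding p_def s(1) by (rule dist_cis_le)
      also have "\<dots> \<le> 2 * pi / real N" using s(2) a_step[of j] by auto
      finally show "z \<in> ball (p j) e" using Ne by simp
    qed
    show "(\<Union>j<N. A j) = sphere 0 1"
    proof
      show "sphere 0 1 \<subseteq> (\<Union>j<N. A j)"
      proof
        fix z :: complex assume z: "z \<in> sphere 0 1"
        define t where "t = Arg2pi z"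
        have t: "0 \<le> t" "t < 2 * pi" "z = cis t"
          using Arg2pi[of z] z by (auto simp: t_def is_Arg_def cis_conv_exp)
        define j where "j = nat \<lfloor>t * real N / (2 * pi)\<rfloor>"
        have "0 \<le> t * real N / (2 * pi)" using t by simp
        then have j: "real j \<le> t * real N / (2 * pi)" "t * real N / (2 * pi) < real j + 1"
          by (auto simp: j_def)
        have "t * real N / (2 * pi) < real N" using t N by (simp add: field_simps)
        then have "j < N" using j(1) by linarith
        have "a j \<le> t" using j(1) N by (simp add: a_def field_simps)
        moreover have "t \<le> a (Suc j)" using j(2) N by (simp add: a_def field_simps)
        ultimately have "z \<in> A j" using t(3) by (auto simp: A_def)
        then show "z \<in> (\<Union>j<N. A j)" using \<open>j < N\<close> by auto
      qed
    qed (auto simp: A_def)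
    show "p j \<in> A j" for j using a_mono[of j "Suc j"] by (auto simp: p_def A_def)
    show "p ((j + 1) mod N) \<in> A j" if "j < N" for j
      unfolding pN[OF that] A_def using a_mono[of j "Suc j"] by (intro imageI) simp
    show "p ((j + 1) mod N) \<noteq> p j" if "j < N" for j
    proof
      assume "p ((j + 1) mod N) = p j"
      then have "cis (a j) = cis (a (Suc j))" unfolding pN[OF that] by (simp add: p_def)
      moreover have "a j \<in> {0..2 * pi}" "a (Suc j) \<in> {0..2 * pi}"
        using a_range[OF that] a_mono[of j "Suc j"] by auto
      ultimately have "a j = a (Suc j) \<or> (a j = 0 \<and> a (Suc j) = 2 * pi) \<or> (a j = 2 * pi \<and> a (Suc j) = 0)"
        by (rule cis_eq_cases)
      then show False
        using a_inj[of j "Suc j"] a_inj[of j 0] a_inj[of "Suc j" N] a_inj[of "Suc j" 0] a0 aN N by auto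
    qed
    show "(z = p j \<and> j = (i + 1) mod N) \<or> (z = p i \<and> i = (j + 1) mod N)"
      if "i < N" "j < N" "i \<noteq> j" "z \<in> A i" "z \<in> A j" for i j z
      using overlap[of i j z] overlap[of j i z] that by (metis nat_neq_iff)
  qed
qed

section \<open>Patching homotopic discs\<close>

text \<open>The admissible size of the translation may depend on the disc. Together with homotopy of
  equicentred members this is all that patching asks of a class of discs.\<close>

definition translation_stable :: "(complex \<Rightarrow> complex ^ 'n) set \<Rightarrow> bool" where
  "translation_stable D \<longleftrightarrow> (\<forall>f\<in>D. \<exists>d>0. \<forall>y. norm y < d \<longrightarrow> (\<lambda>z. f z + y) \<in> D)"

lemma disc_envelope_less_iff:
  "disc_envelope D H x < a \<longleftrightarrow> (\<exists>f\<in>D. f 0 = x \<and> H f < a)"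
  by (auto simp: disc_envelope_def INF_less_iff)

text \<open>The deviations \<open>k\<close> and \<open>q\<close> from the centre do not depend on
  \<open>z\<close>; only the centres \<open>g z\<close> and \<open>h z\<close> move. So the family
  is continuous in \<open>z\<close>, and the strict majorization, valid at \<open>z0\<close> over a
  compact circle, extends to a neighbourhood.\<close>

lemma local_disc_family:
  fixes g :: "complex \<Rightarrow> complex ^ 'n"
  assumes W: "open W" and \<phi>: "usc_on W \<phi>"
    and D: "D \<subseteq> analytic_discs_bdry X W" "translation_stable D"
    and g: "continuous_on (sphere 0 1) g" and h: "continuous_on (sphere 0 1) h" and z0: "z0 \<in> sphere 0 1"
    and f: "f \<in> D" "f 0 = g z0" "poisson_functional \<phi> f < ereal (Re (h z0))"
  obtains k q and d :: real where "d > 0" "k 0 = 0" "q \<in> disc_algebra" "q 0 = 0"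
    "\<And>z. z \<in> sphere 0 1 \<Longrightarrow> dist z z0 < d \<Longrightarrow> (\<lambda>w. g z + k w) \<in> D"
    "\<And>z w. z \<in> sphere 0 1 \<Longrightarrow> dist z z0 < d \<Longrightarrow> w \<in> sphere 0 1 \<Longrightarrow> \<phi> (g z + k w) < ereal (Re (h z + q w))"
proof -
  have fX: "f \<in> analytic_discs_bdry X W" using D f by blast
  obtain r where r: "r \<in> disc_algebra" "\<And>w. w \<in> sphere 0 1 \<Longrightarrow> \<phi> (f w) < ereal (Re (r w))"
    "ereal (Re (r 0)) < ereal (Re (h z0))"
    using poisson_functional_majorant[OF fX \<phi> f(3)] by blast
  define k where "k w = f w - g z0" for w
  define q where "q w = r w - r 0" for w
  have fc: "continuous_on (sphere 0 1) f"
    using fX by (auto simp: analytic_discs_bdry_def analytic_discs_def intro: continuous_on_subset)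
  have rc: "continuous_on (sphere 0 1) r"
    using r(1) by (auto simp: disc_algebra_def intro: continuous_on_subset)
  obtain d1 where d1: "d1 > 0" "\<And>z w. z \<in> sphere 0 1 \<Longrightarrow> dist z z0 < d1 \<Longrightarrow> w \<in> sphere 0 1 \<Longrightarrow>
      (g z, h z) + (k w, q w) \<in> {(x, s). x \<in> W \<and> \<phi> x < ereal (Re s)}"
  proof (rule translates_stay_in_open[of "{(x, s). x \<in> W \<and> \<phi> x < ereal (Re s)}"
        "\<lambda>w. (k w, q w)" "sphere 0 1" "sphere 0 1" "\<lambda>z. (g z, h z)" z0])
    show "open {(x, s::complex). x \<in> W \<and> \<phi> x < ereal (Re s)}" by (rule open_strict_hypergraph[OF W \<phi>])
    show "compact ((\<lambda>w. (k w, q w)) ` sphere 0 1)"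
      unfolding k_def q_def by (intro compact_continuous_image continuous_intros fc rc) auto
    show "continuous_on (sphere 0 1) (\<lambda>z. (g z, h z))" by (intro continuous_intros g h)
    fix w :: complex assume w: "w \<in> sphere 0 1"
    have "\<phi> (f w) < ereal (Re (r w))" by (rule r(2)[OF w])
    \<comment> \<open>Exchanging the centre value \<open>r 0\<close> for \<open>h z0\<close> raises
      the real part.\<close>
    also have "\<dots> \<le> ereal (Re (h z0 + q w))" using r(3) by (simp add: q_def)
    finally show "(g z0, h z0) + (k w, q w) \<in> {(x, s). x \<in> W \<and> \<phi> x < ereal (Re s)}"
      using fX w by (auto simp: k_def analytic_discs_bdry_def)
  qed (use z0 in blast)+
  obtain d2 where d2: "d2 > 0" "\<And>y. norm y < d2 \<Longrightarrow> (\<lambda>z. f z + y) \<in> D"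
    using D(2) f(1) unfolding translation_stable_def by blast
  obtain d3 where d3: "d3 > 0" "\<And>z. z \<in> sphere 0 1 \<Longrightarrow> dist z z0 < d3 \<Longrightarrow> dist (g z) (g z0) < d2"
    using g z0 d2(1) unfolding continuous_on_iff by blast
  show ?thesis
  proof (rule that[of "min d1 d3" k q])
    show "min d1 d3 > 0" using d1 d3 by simp
    show "k 0 = 0" "q 0 = 0" by (auto simp: k_def q_def f)
    show "q \<in> disc_algebra" unfolding q_def by (intro disc_algebra_diff r disc_algebra_const)
    fix z :: complex assume z: "z \<in> sphere 0 1" "dist z z0 < min d1 d3"
    then have "(\<lambda>w. f w + (g z - g z0)) \<in> D" using d3(2)[of z] by (intro d2) (auto simp: dist_norm)
    then show "(\<lambda>w. g z + k w) \<in> D" by (simp add: k_def algebra_simps)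
    show "\<phi> (g z + k w) < ereal (Re (h z + q w))" if "w \<in> sphere 0 1" for w
      using d1(2)[of z w] z that by auto
  qed
qed

text \<open>Adding a large constant to the majorant over a short arc makes a whole homotopy of discs admissible there.\<close>

lemma homotopy_majorant:
  assumes \<phi>: "usc_on W \<phi>" and E: "continuous_on (cball 0 1 \<times> {0..1}) E"
    and EW: "\<And>t w. t \<in> {0..1} \<Longrightarrow> w \<in> sphere 0 1 \<Longrightarrow> E (w, t) \<in> W"
    and q: "continuous_on (cball (0::complex) 1 \<times> {0..1::real}) q"
  obtains M :: real where "\<And>t w. t \<in> {0..1} \<Longrightarrow> w \<in> sphere 0 1 \<Longrightarrow> \<phi> (E (w, t)) < ereal (Re (q (w, t)) + M)"
proof -
  let ?P = "sphere (0::complex) 1 \<times> {0..1::real}"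
  have sub: "?P \<subseteq> cball 0 1 \<times> {0..1}" by auto
  have "usc_on ?P (\<lambda>u. \<phi> (E u) + ereal (- Re (q u)))"
    by (intro usc_on_add_continuous usc_on_compose[OF \<phi>] continuous_on_subset[OF E sub]
        continuous_intros continuous_on_subset[OF q sub]) (use EW in auto)
  moreover have "compact ?P" by (intro compact_Times) auto
  ultimately obtain M where M: "\<And>u. u \<in> ?P \<Longrightarrow> \<phi> (E u) + ereal (- Re (q u)) < ereal M"
    using usc_on_compact_bounded by blast
  show ?thesis
  proof (rule that[of M])
    fix t w assume "t \<in> {0..1::real}" "w \<in> sphere (0::complex) 1"
    then have "\<phi> (E (w, t)) + ereal (- Re (q (w, t))) < ereal M" by (intro M) auto
    then show "\<phi> (E (w, t)) < ereal (Re (q (w, t)) + M)"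
      by (cases "\<phi> (E (w, t))") auto
  qed
qed

text \<open>The homotopy is given over the single centre \<open>g p\<close>. Its parameters form a
  compact set and all conditions are open, so translating every disc of it by
  \<open>g z - g p\<close> is harmless for \<open>z\<close> close to \<open>p\<close>.\<close>

lemma translated_homotopy:
  fixes g :: "complex \<Rightarrow> complex ^ 'n"
  assumes X: "open X" and W: "open W" and \<phi>: "usc_on W \<phi>"
    and g: "continuous_on (sphere 0 1) g" and h: "continuous_on (sphere 0 1) h" and p: "p \<in> sphere 0 1"
    and E: "continuous_on (cball 0 1 \<times> {0..1}) E"
    and EX: "\<And>t. t \<in> {0..1} \<Longrightarrow> (\<lambda>w. E (w, t)) \<in> analytic_discs_bdry X W"
    and q: "continuous_on (cball (0::complex) 1 \<times> {0..1::real}) q"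
    and lt: "\<And>t w. t \<in> {0..1} \<Longrightarrow> w \<in> sphere 0 1 \<Longrightarrow> \<phi> (E (w, t)) < ereal (Re (h p + q (w, t)))"
  obtains d where "d > 0"
    "\<And>z t w. z \<in> sphere 0 1 \<Longrightarrow> dist z p < d \<Longrightarrow> t \<in> {0..1} \<Longrightarrow> w \<in> cball 0 1 \<Longrightarrow> g z + (E (w, t) - g p) \<in> X"
    "\<And>z t w. z \<in> sphere 0 1 \<Longrightarrow> dist z p < d \<Longrightarrow> t \<in> {0..1} \<Longrightarrow> w \<in> sphere 0 1 \<Longrightarrow> g z + (E (w, t) - g p) \<in> W"
    "\<And>z t w. z \<in> sphere 0 1 \<Longrightarrow> dist z p < d \<Longrightarrow> t \<in> {0..1} \<Longrightarrow> w \<in> sphere 0 1 \<Longrightarrow>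
        \<phi> (g z + (E (w, t) - g p)) < ereal (Re (h z + q (w, t)))"
proof -
  let ?P = "sphere (0::complex) 1 \<times> {0..1::real}" and ?C = "cball (0::complex) 1 \<times> {0..1::real}"
  have sub: "?P \<subseteq> ?C" by auto
  have cpt: "compact ?P" "compact ?C" by (auto intro!: compact_Times)
  have Ex: "E (w, t) \<in> X" if "t \<in> {0..1}" "w \<in> cball 0 1" for w t
    using EX[OF that(1)] that(2) by (auto simp: analytic_discs_bdry_def analytic_discs_def)
  have Ew: "E (w, t) \<in> W" if "t \<in> {0..1}" "w \<in> sphere 0 1" for w t
    using EX[OF that(1)] that(2) by (auto simp: analytic_discs_bdry_def)
  obtain d1 where d1: "d1 > 0" "\<And>z c. z \<in> sphere 0 1 \<Longrightarrow> dist z p < d1 \<Longrightarrow> c \<in> ?C \<Longrightarrow> g z + (E c - g p) \<in> X"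
  proof (rule translates_stay_in_open[OF X _ g p, of "\<lambda>c. E c - g p" ?C])
    show "compact ((\<lambda>c. E c - g p) ` ?C)" by (intro compact_continuous_image continuous_intros E cpt)
    show "g p + (E c - g p) \<in> X" if "c \<in> ?C" for c using Ex that by auto
  qed blast
  obtain d2 where d2: "d2 > 0" "\<And>z c. z \<in> sphere 0 1 \<Longrightarrow> dist z p < d2 \<Longrightarrow> c \<in> ?P \<Longrightarrow>
      (g z, h z) + (E c - g p, q c) \<in> {(x, s). x \<in> W \<and> \<phi> x < ereal (Re s)}"
  proof (rule translates_stay_in_open[OF open_strict_hypergraph[OF W \<phi>] _ _ p, of "\<lambda>c. (E c - g p, q c)" ?P "\<lambda>z. (g z, h z)"])
    show "compact ((\<lambda>c. (E c - g p, q c)) ` ?P)"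
      by (intro compact_continuous_image continuous_intros continuous_on_subset[OF E sub] continuous_on_subset[OF q sub] cpt)
    show "continuous_on (sphere 0 1) (\<lambda>z. (g z, h z))" by (intro continuous_intros g h)
    show "(g p, h p) + (E c - g p, q c) \<in> {(x, s). x \<in> W \<and> \<phi> x < ereal (Re s)}" if "c \<in> ?P" for c
      using Ew lt that by auto
  qed blast
  show ?thesis
  proof (rule that[of "min d1 d2"])
    show "min d1 d2 > 0" using d1 d2 by simp
    show "g z + (E (w, t) - g p) \<in> X" if "z \<in> sphere 0 1" "dist z p < min d1 d2" "t \<in> {0..1}" "w \<in> cball 0 1" for z t w
      using d1(2)[of z "(w, t)"] that by auto
    show "g z + (E (w, t) - g p) \<in> W" "\<phi> (g z + (E (w, t) - g p)) < ereal (Re (h z + q (w, t)))"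
      if "z \<in> sphere 0 1" "dist z p < min d1 d2" "t \<in> {0..1}" "w \<in> sphere 0 1" for z t w
      using d2(2)[of z "(w, t)"] that by auto
  qed
qed

lemma continuous_on_pasting_closed:
  fixes f :: "nat \<Rightarrow> 'a::topological_space \<Rightarrow> 'b::topological_space"
  assumes "\<And>i. i < N \<Longrightarrow> closed (T i)" "S = (\<Union>i<N. T i)" "\<And>i. i < N \<Longrightarrow> continuous_on (T i) (f i)"
    and "\<And>i j x. i < N \<Longrightarrow> j < N \<Longrightarrow> x \<in> T i \<Longrightarrow> x \<in> T j \<Longrightarrow> f i x = f j x"
  obtains g where "continuous_on S g" "\<And>i x. i < N \<Longrightarrow> x \<in> T i \<Longrightarrow> g x = f i x"
proof -
  obtain g where g: "continuous_map (top_of_set S) euclidean g"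
    "\<And>x i. i \<in> {..<N} \<Longrightarrow> x \<in> topspace (top_of_set S) \<inter> T i \<Longrightarrow> g x = f i x"
  proof (rule pasting_lemma_exists_closed[of "{..<N}" "top_of_set S" T euclidean f])
    show "closedin (top_of_set S) (T i)" if "i \<in> {..<N}" for i
      using assms(1,2) that by (intro closed_subset) auto
    show "continuous_map (subtopology (top_of_set S) (T i)) euclidean (f i)" if "i \<in> {..<N}" for i
    proof -
      have "S \<inter> T i = T i" using assms(2) that by auto
      then show ?thesis using assms(3) that by (simp add: subtopology_subtopology)
    qed
    show "topspace (top_of_set S) \<subseteq> \<Union> (T ` {..<N})" using assms(2) by simp
    show "f i x = f j x" if "i \<in> {..<N}" "j \<in> {..<N}" "x \<in> topspace (top_of_set S) \<inter> T i \<inter> T j" for i j x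
      using that by (intro assms(4)) auto
    show "finite {..<N}" by simp
  qed blast
  show ?thesis
  proof (rule that[of g])
    show "continuous_on S g" using g(1) by simp
    show "g x = f i x" if "i < N" "x \<in> T i" for i x
      using that assms(2) by (intro g(2)) auto
  qed
qed

text \<open>On arc \<open>j\<close> the disc over \<open>z\<close> is the translate of
  \<open>k j\<close>, except close to the end point \<open>p (\<sigma> j)\<close>, where the
  homotopy \<open>E j\<close> turns it into the translate of \<open>k (\<sigma> j)\<close> that the
  next arc starts with. There \<open>h\<close> alone may fail to majorise, and \<open>hk\<close> is
  added to it; this is the origin of \<eta>.\<close>

lemma homotopic_discs_patching:
  fixes g :: "complex \<Rightarrow> complex ^ 'n"
  assumes X: "open X" and W: "open W" and \<phi>: "usc_on W \<phi>"
    and D: "D \<subseteq> analytic_discs_bdry X W" "translation_stable D"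
    and hom: "\<And>f1 f2. f1 \<in> D \<Longrightarrow> f2 \<in> D \<Longrightarrow> f1 0 = f2 0 \<Longrightarrow> centre_homotopic X W f1 f2"
    and g: "g \<in> analytic_discs X" and h: "h \<in> disc_algebra" and \<eta>: "\<eta> > 0"
    and lt: "\<And>z. z \<in> sphere 0 1 \<Longrightarrow> disc_envelope D (poisson_functional \<phi>) (g z) < ereal (Re (h z))"
  obtains f where "f \<in> analytic_discs_bdry X W" "f 0 = g 0" "poisson_functional \<phi> f < ereal (Re (h 0) + \<eta>)"
proof -
  let ?S = "sphere (0::complex) 1" and ?D = "cball (0::complex) 1" and ?I = "{0..1::real}"
  have gc: "continuous_on ?S g" using g by (auto simp: analytic_discs_def intro: continuous_on_subset)
  have hc: "continuous_on ?S h" using h by (auto simp: disc_algebra_def intro: continuous_on_subset)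
  define good where "good z k q \<longleftrightarrow> (\<lambda>w. g z + k w) \<in> D \<and> (\<forall>w\<in>?S. \<phi> (g z + k w) < ereal (Re (h z + q w)))" for z k q
  define shape where "shape z0 k q d \<longleftrightarrow> d > (0::real) \<and> k 0 = 0 \<and> q \<in> disc_algebra \<and> q 0 = 0 \<and>
      (\<forall>z\<in>?S. dist z z0 < d \<longrightarrow> good z k q)" for z0 k q d
  have "\<exists>k q d. shape z0 k q d" if z0: "z0 \<in> ?S" for z0
  proof -
    obtain f where f: "f \<in> D" "f 0 = g z0" "poisson_functional \<phi> f < ereal (Re (h z0))"
      using lt[OF z0] unfolding disc_envelope_less_iff by blast
    show ?thesis
      by (rule local_disc_family[OF W \<phi> D gc hc z0 f]) (unfold good_def shape_def, blast)
  qed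
  then obtain k0 q0 d0 where "\<And>z0. z0 \<in> ?S \<Longrightarrow> shape z0 (k0 z0) (q0 z0) (d0 z0)"
    by metis
  then have sh: "\<And>z0. z0 \<in> ?S \<Longrightarrow> d0 z0 > (0::real)" "\<And>z0. z0 \<in> ?S \<Longrightarrow> k0 z0 0 = 0"
    "\<And>z0. z0 \<in> ?S \<Longrightarrow> q0 z0 \<in> disc_algebra" "\<And>z0. z0 \<in> ?S \<Longrightarrow> q0 z0 0 = 0"
    "\<And>z z0. z0 \<in> ?S \<Longrightarrow> z \<in> ?S \<Longrightarrow> dist z z0 < d0 z0 \<Longrightarrow> good z (k0 z0) (q0 z0)"
    unfolding shape_def by blast+
  \<comment> \<open>A Lebesgue number of the covering by the local neighbourhoods: each arc inside
    an \<open>e\<close>-ball can use one single pair \<open>k j\<close>, \<open>q j\<close>.\<close>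
  obtain e where e: "e > 0" "\<And>x. x \<in> ?S \<Longrightarrow> \<exists>G\<in>(\<lambda>z0. ball z0 (d0 z0)) ` ?S. ball x e \<subseteq> G"
  proof (rule Heine_Borel_lemma[of ?S "(\<lambda>z0. ball z0 (d0 z0)) ` ?S"])
    show "?S \<subseteq> \<Union>((\<lambda>z0. ball z0 (d0 z0)) ` ?S)" using sh(1) by auto
  qed auto
  obtain N :: nat and A :: "nat \<Rightarrow> complex set" and p :: "nat \<Rightarrow> complex" where N: "N > 0"
    and Acl: "\<And>j. j < N \<Longrightarrow> closed (A j)" and Ab: "\<And>j. j < N \<Longrightarrow> A j \<subseteq> ball (p j) e"
    and AU: "(\<Union>j<N. A j) = ?S" and pA: "\<And>j. j < N \<Longrightarrow> p j \<in> A j"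
    and spA: "\<And>j. j < N \<Longrightarrow> p ((j + 1) mod N) \<in> A j" and sp_ne: "\<And>j. j < N \<Longrightarrow> p ((j + 1) mod N) \<noteq> p j"
    and overlap: "\<And>i j z. i < N \<Longrightarrow> j < N \<Longrightarrow> i \<noteq> j \<Longrightarrow> z \<in> A i \<Longrightarrow> z \<in> A j \<Longrightarrow>
       (z = p j \<and> j = (i + 1) mod N) \<or> (z = p i \<and> i = (j + 1) mod N)"
    by (rule circle_subdivision[OF e(1)]) blast
  define \<sigma> where "\<sigma> j = (j + 1) mod N" for j
  have \<sigma>: "\<sigma> j < N" for j using N by (simp add: \<sigma>_def)
  have AS: "A j \<subseteq> ?S" if "j < N" for j using AU that by blast
  have pS: "p j \<in> ?S" if "j < N" for j using AS pA that by blast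
  have "\<exists>c\<in>?S. ball (p j) e \<subseteq> ball c (d0 c)" if "j < N" for j using e(2)[OF pS[OF that]] by blast
  then obtain c where c: "\<And>j. j < N \<Longrightarrow> c j \<in> ?S" "\<And>j. j < N \<Longrightarrow> ball (p j) e \<subseteq> ball (c j) (d0 (c j))" by metis
  define k where "k j = k0 (c j)" for j
  define q where "q j = q0 (c j)" for j
  have k0: "k j 0 = 0" and qD: "q j \<in> disc_algebra" and q0: "q j 0 = 0" if "j < N" for j
    using sh(2-4)[OF c(1)[OF that]] by (auto simp: k_def q_def)
  have good: "good z (k j) (q j)" if "j < N" "z \<in> A j" for j z
    unfolding k_def q_def
  proof (rule sh(5)[OF c(1)[OF that(1)]])
    show "z \<in> ?S" using AS that by blast
    show "dist z (c j) < d0 (c j)" using Ab[OF that(1)] c(2)[OF that(1)] that(2) by (auto simp: dist_commute)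
  qed
  have qc: "continuous_on ?D (q j)" if "j < N" for j using qD[OF that] by (simp add: disc_algebra_def)
  \<comment> \<open>The homotopy sits over the end point of arc \<open>j\<close>, the point common
    with the next arc, where the translates of \<open>k j\<close> and \<open>k (\<sigma> j)\<close>
    both belong to \<open>D\<close>.\<close>
  define HP where "HP j E \<longleftrightarrow> continuous_on (?D \<times> ?I) E \<and> (\<forall>t\<in>?I. (\<lambda>w. E (w, t)) \<in> analytic_discs_bdry X W) \<and>
      (\<forall>w\<in>?D. E (w, 0) = g (p (\<sigma> j)) + k j w \<and> E (w, 1) = g (p (\<sigma> j)) + k (\<sigma> j) w) \<and>
      (\<forall>t\<in>?I. E (0, t) = g (p (\<sigma> j)))" for j E
  have "\<exists>E. HP j E" if j: "j < N" for j
  proof -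
    have "(\<lambda>w. g (p (\<sigma> j)) + k j w) \<in> D" "(\<lambda>w. g (p (\<sigma> j)) + k (\<sigma> j) w) \<in> D"
      using good[OF j spA[OF j]] good[OF \<sigma> pA[OF \<sigma>]] by (auto simp: good_def \<sigma>_def)
    moreover have "g (p (\<sigma> j)) + k j 0 = g (p (\<sigma> j)) + k (\<sigma> j) 0" using k0 j \<sigma> by simp
    ultimately have "centre_homotopic X W (\<lambda>w. g (p (\<sigma> j)) + k j w) (\<lambda>w. g (p (\<sigma> j)) + k (\<sigma> j) w)"
      by (rule hom)
    then show ?thesis unfolding centre_homotopic_def HP_def using k0[OF j] by auto
  qed
  then obtain E where E: "\<And>j. j < N \<Longrightarrow> HP j (E j)" by metis
  have Ec: "continuous_on (?D \<times> ?I) (E j)" and EX: "\<And>t. t \<in> ?I \<Longrightarrow> (\<lambda>w. E j (w, t)) \<in> analytic_discs_bdry X W"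
    and E0: "\<And>w. w \<in> ?D \<Longrightarrow> E j (w, 0) = g (p (\<sigma> j)) + k j w"
    and E1: "\<And>w. w \<in> ?D \<Longrightarrow> E j (w, 1) = g (p (\<sigma> j)) + k (\<sigma> j) w"
    and Ecen: "\<And>t. t \<in> ?I \<Longrightarrow> E j (0, t) = g (p (\<sigma> j))" if "j < N" for j
    using E[OF that] by (auto simp: HP_def)
  \<comment> \<open>Linear interpolation of the two majorant deviations; it stays in the disc
    algebra and vanishes at \<open>w = 0\<close>, so the centre value of the majorant is
    untouched.\<close>
  define qh where "qh j u = of_real (1 - snd u) * q j (fst u) + of_real (snd u) * q (\<sigma> j) (fst u)" for j and u :: "complex \<times> real"
  have qhc: "continuous_on (?D \<times> ?I) (qh j)" if "j < N" for j
    unfolding qh_def by (intro continuous_intros continuous_on_compose2[OF qc] \<sigma> that) auto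
  have qhD: "(\<lambda>w. qh j (w, t)) \<in> disc_algebra" if "j < N" for j t
    unfolding qh_def fst_conv snd_conv by (intro disc_algebra_add disc_algebra_mult disc_algebra_const qD \<sigma> that)
  have qh0: "qh j (0, t) = 0" if "j < N" for j t using q0 \<sigma> that by (simp add: qh_def)
  have "\<exists>M. \<forall>t\<in>?I. \<forall>w\<in>?S. \<phi> (E j (w, t)) < ereal (Re (qh j (w, t)) + M)" if j: "j < N" for j
  proof (rule homotopy_majorant[OF \<phi> Ec[OF j] _ qhc[OF j]])
    show "E j (w, t) \<in> W" if "t \<in> ?I" "w \<in> ?S" for t w
      using EX[OF j that(1)] that(2) by (auto simp: analytic_discs_bdry_def)
  qed blast
  then obtain M where M: "\<And>j t w. j < N \<Longrightarrow> t \<in> ?I \<Longrightarrow> w \<in> ?S \<Longrightarrow> \<phi> (E j (w, t)) < ereal (Re (qh j (w, t)) + M j)"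
    by metis
  \<comment> \<open>At each junction \<open>hk\<close> must exceed what the homotopy costs there
    minus the contribution of \<open>h\<close>; \<open>MM\<close> bounds all these amounts at
    once.\<close>
  define MM where "MM = (\<Sum>j<N. \<bar>M j\<bar> + \<bar>Re (h (p (\<sigma> j)))\<bar>)"
  have MM: "M j - Re (h (p (\<sigma> j))) \<le> MM" if "j < N" for j
  proof -
    have "\<bar>M j\<bar> + \<bar>Re (h (p (\<sigma> j)))\<bar> \<le> MM" unfolding MM_def using that by (intro member_le_sum) auto
    then show ?thesis by linarith
  qed
  obtain hk where hk: "hk \<in> disc_algebra" "\<And>z. z \<in> ?S \<Longrightarrow> Re (hk z) \<ge> 0"
    "\<And>x. x \<in> p ` {..<N} \<Longrightarrow> Re (hk x) > MM" "Re (hk 0) < \<eta>"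
  proof (rule poisson_kernel_peaks[of "p ` {..<N}" \<eta> MM])
    show "p ` {..<N} \<subseteq> ?S" using pS by blast
  qed (use \<eta> in auto)
  define h' where "h' z = h z + hk z" for z
  have h': "h' \<in> disc_algebra" unfolding h'_def by (intro disc_algebra_add h hk)
  have h'c: "continuous_on ?S h'" using h' by (auto simp: disc_algebra_def intro: continuous_on_subset)
  define near where "near j d \<longleftrightarrow> (\<forall>z\<in>?S. dist z (p (\<sigma> j)) < d \<longrightarrow> (\<forall>t\<in>?I.
      (\<forall>w\<in>?D. g z + (E j (w, t) - g (p (\<sigma> j))) \<in> X) \<and>
      (\<forall>w\<in>?S. g z + (E j (w, t) - g (p (\<sigma> j))) \<in> W \<and>
         \<phi> (g z + (E j (w, t) - g (p (\<sigma> j)))) < ereal (Re (h' z + qh j (w, t))))))" for j d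
  have "\<exists>d>0. near j d" if j: "j < N" for j
  proof -
    have lt': "\<phi> (E j (w, t)) < ereal (Re (h' (p (\<sigma> j)) + qh j (w, t)))" if tw: "t \<in> ?I" "w \<in> ?S" for t w
    proof -
      have "\<phi> (E j (w, t)) < ereal (Re (qh j (w, t)) + M j)" by (rule M[OF j tw])
      also have "\<dots> \<le> ereal (Re (h' (p (\<sigma> j)) + qh j (w, t)))"
      proof -
        have "Re (hk (p (\<sigma> j))) > MM" using \<sigma> by (intro hk(3)) auto
        then show ?thesis using MM[OF j] by (simp add: h'_def)
      qed
      finally show ?thesis .
    qed
    obtain d where d: "d > 0"
      "\<And>z t w. z \<in> ?S \<Longrightarrow> dist z (p (\<sigma> j)) < d \<Longrightarrow> t \<in> ?I \<Longrightarrow> w \<in> ?D \<Longrightarrow> g z + (E j (w, t) - g (p (\<sigma> j))) \<in> X"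
      "\<And>z t w. z \<in> ?S \<Longrightarrow> dist z (p (\<sigma> j)) < d \<Longrightarrow> t \<in> ?I \<Longrightarrow> w \<in> ?S \<Longrightarrow> g z + (E j (w, t) - g (p (\<sigma> j))) \<in> W"
      "\<And>z t w. z \<in> ?S \<Longrightarrow> dist z (p (\<sigma> j)) < d \<Longrightarrow> t \<in> ?I \<Longrightarrow> w \<in> ?S \<Longrightarrow>
        \<phi> (g z + (E j (w, t) - g (p (\<sigma> j)))) < ereal (Re (h' z + qh j (w, t)))"
      by (rule translated_homotopy[OF X W \<phi> gc h'c pS[OF \<sigma>] Ec[OF j] EX[OF j] qhc[OF j] lt']) (assumption | blast)+
    have "near j d"
      unfolding near_def by (intro ballI impI conjI d(2) d(3) d(4))
    then show ?thesis using d(1) by blast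
  qed
  then obtain d1 where d1: "\<And>j. j < N \<Longrightarrow> d1 j > 0" "\<And>j. j < N \<Longrightarrow> near j (d1 j)" by metis
  \<comment> \<open>The second bound makes the transition zone of arc \<open>j\<close> avoid its
    starting point \<open>p j\<close>.\<close>
  define d where "d j = min (d1 j) (dist (p j) (p (\<sigma> j)))" for j
  have d: "d j > 0" "d j \<le> d1 j" "d j \<le> dist (p j) (p (\<sigma> j))" if "j < N" for j
    using d1(1)[OF that] sp_ne[OF that] by (auto simp: d_def \<sigma>_def)
  \<comment> \<open>The time of the homotopy over \<open>z\<close>: 1 at the end point, 0 from
    distance \<open>d j\<close> on, where the plain translate of \<open>k j\<close> is used.\<close>
  define l where "l j z = max 0 (1 - dist z (p (\<sigma> j)) / d j)" for j z
  have l_I: "l j z \<in> ?I" if "j < N" for j z using d(1)[OF that] by (auto simp: l_def)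
  have l1: "l j (p (\<sigma> j)) = 1" for j by (simp add: l_def)
  have l0: "l j (p j) = 0" if "j < N" for j using d[OF that] by (simp add: l_def)
  have l_near: "dist z (p (\<sigma> j)) < d1 j" if "j < N" "l j z \<noteq> 0" for j z
  proof -
    have "1 - dist z (p (\<sigma> j)) / d j > 0" using that(2) unfolding l_def by linarith
    then have "dist z (p (\<sigma> j)) < d j" using d(1)[OF that(1)] by (simp add: field_simps)
    then show ?thesis using d(2)[OF that(1)] by linarith
  qed
  have lc: "continuous_on S (l j)" if "j < N" for j S
    unfolding l_def using d(1)[OF that] by (intro continuous_intros) auto
  define F where "F j u = (g (fst u) + (E j (snd u, l j (fst u)) - g (p (\<sigma> j))), h' (fst u) + qh j (snd u, l j (fst u)))" for j u
  have F_eq: "F j (z, w) = (g z + k j w, h' z + q j w)" if "j < N" "l j z = 0" "w \<in> ?D" for j z w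
    using E0[OF that(1,3)] that(2) by (simp add: F_def qh_def)
  have Fc: "continuous_on (A j \<times> ?D) (F j)" if j: "j < N" for j
  proof -
    have a: "continuous_on (A j \<times> ?D) (\<lambda>u. (snd u, l j (fst u)))"
      by (intro continuous_intros continuous_on_compose2[OF lc[OF j, of UNIV]]) auto
    have b: "(\<lambda>u. (snd u, l j (fst u))) ` (A j \<times> ?D) \<subseteq> ?D \<times> ?I" using l_I[OF j] by auto
    show ?thesis unfolding F_def
      by (intro continuous_intros continuous_on_compose2[OF Ec[OF j] a b] continuous_on_compose2[OF qhc[OF j] a b]
          continuous_on_compose2[OF gc] continuous_on_compose2[OF h'c]) (use AS[OF j] in auto)
  qed
  \<comment> \<open>At the junction arc \<open>i\<close> has completed its homotopy (time 1) while
    arc \<open>\<sigma> i\<close> has not begun its own (time 0). Distinct arcs meet only at such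
    points, so the pieces paste.\<close>
  have F_step: "F i (p (\<sigma> i), w) = F (\<sigma> i) (p (\<sigma> i), w)" if i: "i < N" and w: "w \<in> ?D" for i w
    unfolding F_eq[OF \<sigma> l0[OF \<sigma>] w] using E1[OF i w] by (simp add: F_def l1 qh_def)
  obtain G where G: "continuous_on (?S \<times> ?D) G" "\<And>j u. j < N \<Longrightarrow> u \<in> A j \<times> ?D \<Longrightarrow> G u = F j u"
  proof (rule continuous_on_pasting_closed[of N "\<lambda>j. A j \<times> ?D" "?S \<times> ?D" F])
    show "closed (A j \<times> ?D)" if "j < N" for j by (intro closed_Times Acl that) auto
    show "?S \<times> ?D = (\<Union>j<N. A j \<times> ?D)" unfolding AU[symmetric] by auto
    show "continuous_on (A j \<times> ?D) (F j)" if "j < N" for j by (rule Fc[OF that])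
    show "F i u = F j u" if ij: "i < N" "j < N" "u \<in> A i \<times> ?D" "u \<in> A j \<times> ?D" for i j u
    proof (cases "i = j")
      case False
      obtain z w where u: "u = (z, w)" "z \<in> A i" "z \<in> A j" "w \<in> ?D" using ij by auto
      then show ?thesis
        using overlap[OF ij(1,2) False, of z] F_step[OF ij(1), of w] F_step[OF ij(2), of w] by (auto simp: \<sigma>_def)
    qed simp
  qed blast
  have F_disc: "(\<lambda>w. fst (F j (z, w))) \<in> analytic_discs X \<and> (\<lambda>w. snd (F j (z, w))) \<in> disc_algebra \<and>
      F j (z, 0) = (g z, h' z) \<and> (\<forall>w\<in>?S. fst (F j (z, w)) \<in> W \<and> \<phi> (fst (F j (z, w))) < ereal (Re (snd (F j (z, w)))))"
    if j: "j < N" and z: "z \<in> A j" for j z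
  proof -
    have zS: "z \<in> ?S" using AS[OF j] z by blast
    have inX: "fst (F j (z, w)) \<in> X" if w: "w \<in> ?D" for w
    proof (cases "l j z = 0")
      case True
      have "(\<lambda>w. g z + k j w) \<in> analytic_discs_bdry X W" using good[OF j z] D(1) by (auto simp: good_def)
      then show ?thesis unfolding F_eq[OF j True w] using w by (auto simp: analytic_discs_bdry_def analytic_discs_def)
    next
      case False
      then show ?thesis using d1(2)[OF j] zS l_near[OF j False] l_I[OF j] w by (auto simp: near_def F_def)
    qed
    have inW: "fst (F j (z, w)) \<in> W \<and> \<phi> (fst (F j (z, w))) < ereal (Re (snd (F j (z, w))))" if w: "w \<in> ?S" for w
    proof (cases "l j z = 0")
      case True
      have wD: "w \<in> ?D" using w by auto
      have "(\<lambda>w. g z + k j w) \<in> analytic_discs_bdry X W" using good[OF j z] D(1) by (auto simp: good_def)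
      then have 1: "g z + k j w \<in> W" using w by (auto simp: analytic_discs_bdry_def)
      have "\<phi> (g z + k j w) < ereal (Re (h z + q j w))" using good[OF j z] w by (auto simp: good_def)
      also have "\<dots> \<le> ereal (Re (h' z + q j w))" using hk(2)[OF zS] by (simp add: h'_def)
      finally show ?thesis unfolding F_eq[OF j True wD] using 1 by simp
    next
      case False
      then show ?thesis using d1(2)[OF j] zS l_near[OF j False] l_I[OF j] w by (auto simp: near_def F_def)
    qed
    have "(\<lambda>w. E j (w, l j z) $ i) \<in> disc_algebra" for i
      using EX[OF j l_I[OF j]] by (auto simp: analytic_discs_bdry_def analytic_discs_iff)
    then have "(\<lambda>w. fst (F j (z, w)) $ i) \<in> disc_algebra" for i
      unfolding F_def fst_conv snd_conv vector_add_component vector_minus_component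
      by (intro disc_algebra_add disc_algebra_diff disc_algebra_const)
    then have "(\<lambda>w. fst (F j (z, w))) \<in> analytic_discs X" using inX by (auto simp: analytic_discs_iff)
    moreover have "(\<lambda>w. snd (F j (z, w))) \<in> disc_algebra"
      unfolding F_def fst_conv snd_conv by (intro disc_algebra_add disc_algebra_const qhD j)
    moreover have "F j (z, 0) = (g z, h' z)" using Ecen[OF j l_I[OF j]] qh0[OF j] by (simp add: F_def)
    ultimately show ?thesis using inW by blast
  qed
  have G_disc: "(\<lambda>w. fst (G (z, w))) \<in> analytic_discs X \<and> (\<lambda>w. snd (G (z, w))) \<in> disc_algebra \<and>
      G (z, 0) = (g z, h' z) \<and> (\<forall>w\<in>?S. fst (G (z, w)) \<in> W \<and> \<phi> (fst (G (z, w))) < ereal (Re (snd (G (z, w)))))"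
    if z: "z \<in> ?S" for z
  proof -
    obtain j where j: "j < N" "z \<in> A j" using z AU by blast
    have G_F: "G (z, w) = F j (z, w)" if "w \<in> ?D" for w using G(2)[OF j(1)] j(2) that by auto
    note Fd = F_disc[OF j]
    have "(\<lambda>w. fst (G (z, w))) \<in> analytic_discs X"
    proof -
      have "continuous_on ?D (\<lambda>w. fst (G (z, w)))"
        by (intro continuous_intros continuous_on_compose2[OF G(1)]) (use z in auto)
      moreover have "(\<lambda>w. fst (G (z, w)) $ i) holomorphic_on ball 0 1" for i
        by (rule holomorphic_transform[of "\<lambda>w. fst (F j (z, w)) $ i"])
          (use Fd G_F in \<open>auto simp: analytic_discs_def\<close>)
      moreover have "fst (G (z, w)) \<in> X" if "w \<in> ?D" for w
        using Fd that unfolding G_F[OF that] by (auto simp: analytic_discs_def)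
      ultimately show ?thesis by (auto simp: analytic_discs_def)
    qed
    moreover have "(\<lambda>w. snd (G (z, w))) \<in> disc_algebra"
    proof -
      have "continuous_on ?D (\<lambda>w. snd (G (z, w)))"
        by (intro continuous_intros continuous_on_compose2[OF G(1)]) (use z in auto)
      moreover have "(\<lambda>w. snd (G (z, w))) holomorphic_on ball 0 1"
        by (rule holomorphic_transform[of "\<lambda>w. snd (F j (z, w))"])
          (use Fd G_F in \<open>auto simp: disc_algebra_def\<close>)
      ultimately show ?thesis by (auto simp: disc_algebra_def)
    qed
    ultimately show ?thesis using Fd G_F by auto
  qed
  obtain f where f: "f \<in> analytic_discs_bdry X W" "f 0 = g 0" "poisson_functional \<phi> f \<le> ereal (Re (h' 0))"
    by (rule analytic_disc_patching_majorant[OF X W \<phi> g h', of "\<lambda>u. fst (G u)" "\<lambda>u. snd (G u)"])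
      (use G_disc G(1) in \<open>auto intro: continuous_intros\<close>)
  moreover have "ereal (Re (h' 0)) < ereal (Re (h 0) + \<eta>)" using hk(4) by (simp add: h'_def)
  ultimately show ?thesis by (intro that[of f]) (auto intro: order_le_less_trans)
qed

section \<open>The plurisubharmonic envelope\<close>

text \<open>A near-optimal disc at \<open>x\<close> is translated to nearby centres; the same disc
  algebra majorant \<open>h\<close> remains valid for small translations because the strict
  hypergraph is open.\<close>

lemma usc_on_disc_envelope:
  fixes X W :: "(complex ^ 'n) set"
  assumes W: "open W" and \<phi>: "usc_on W \<phi>"
    and D: "D \<subseteq> analytic_discs_bdry X W" "translation_stable D"
    and cover: "\<And>x. x \<in> X \<Longrightarrow> \<exists>f\<in>D. f 0 = x"
  shows "usc_on X (disc_envelope D (poisson_functional \<phi>))"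
  unfolding usc_on_def
proof (intro conjI ballI allI)
  fix x assume "x \<in> X"
  then obtain f where f: "f \<in> D" "f 0 = x" using cover by blast
  have "usc_on (sphere 0 1) (\<lambda>z. \<phi> (f z))"
    using usc_on_boundary_values[OF _ \<phi>] f(1) D(1) by blast
  then obtain M where M: "\<And>z. z \<in> sphere 0 1 \<Longrightarrow> \<phi> (f z) < ereal M"
    using usc_on_compact_bounded[OF _ compact_sphere] by blast
  have "poisson_functional \<phi> f \<le> ereal (Re (of_real M))"
    unfolding poisson_functional_def
    by (rule ereal_integral_le_disc_algebra[where h = "\<lambda>_. of_real M"]) (use M in \<open>auto intro: less_imp_le\<close>)
  then have "poisson_functional \<phi> f < \<infinity>" by (auto intro: order_le_less_trans)
  then have "disc_envelope D (poisson_functional \<phi>) x < \<infinity>"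
    using f unfolding disc_envelope_less_iff by blast
  then show "disc_envelope D (poisson_functional \<phi>) x \<noteq> \<infinity>" by simp
next
  fix c
  show "openin (top_of_set X) {x \<in> X. disc_envelope D (poisson_functional \<phi>) x < c}"
    unfolding openin_euclidean_subtopology_iff
  proof (intro conjI ballI)
    fix x assume "x \<in> {x \<in> X. disc_envelope D (poisson_functional \<phi>) x < c}"
    then obtain f where f: "f \<in> D" "f 0 = x" "poisson_functional \<phi> f < c"
      by (auto simp: disc_envelope_less_iff)
    then have fX: "f \<in> analytic_discs_bdry X W" using D by blast
    obtain h where h: "h \<in> disc_algebra" "\<And>z. z \<in> sphere 0 1 \<Longrightarrow> \<phi> (f z) < ereal (Re (h z))" "ereal (Re (h 0)) < c"
      using poisson_functional_majorant[OF fX \<phi> f(3)] by blast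
    have fc: "continuous_on (sphere 0 1) f"
      using fX by (auto simp: analytic_discs_bdry_def analytic_discs_def intro: continuous_on_subset)
    have hc: "continuous_on (sphere 0 1) h"
      using h(1) by (auto simp: disc_algebra_def intro: continuous_on_subset)
    obtain d1 where d1: "d1 > 0" "\<And>y z. y \<in> UNIV \<Longrightarrow> dist y 0 < d1 \<Longrightarrow> z \<in> sphere 0 1 \<Longrightarrow>
        (y, 0) + (f z, h z) \<in> {(x, s). x \<in> W \<and> \<phi> x < ereal (Re s)}"
    proof (rule translates_stay_in_open[OF open_strict_hypergraph[OF W \<phi>],
          of "\<lambda>z. (f z, h z)" "sphere 0 1" UNIV "\<lambda>y. (y, 0)" 0])
      show "compact ((\<lambda>z. (f z, h z)) ` sphere 0 1)"
        by (intro compact_continuous_image continuous_intros fc hc) auto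
      show "(0, 0) + (f z, h z) \<in> {(x, s). x \<in> W \<and> \<phi> x < ereal (Re s)}" if "z \<in> sphere 0 1" for z
        using h(2)[OF that] fX that by (auto simp: analytic_discs_bdry_def)
    qed (auto intro: continuous_intros)
    obtain d2 where d2: "d2 > 0" "\<And>y. norm y < d2 \<Longrightarrow> (\<lambda>z. f z + y) \<in> D"
      using D(2) f(1) unfolding translation_stable_def by blast
    show "\<exists>e>0. \<forall>x'\<in>X. dist x' x < e \<longrightarrow> x' \<in> {x \<in> X. disc_envelope D (poisson_functional \<phi>) x < c}"
    proof (intro exI[of _ "min d1 d2"] conjI ballI impI)
      fix x' assume x': "x' \<in> X" "dist x' x < min d1 d2"
      define y where "y = x' - x"
      have y: "norm y < d1" "norm y < d2" using x' by (auto simp: y_def dist_norm)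
      have "poisson_functional \<phi> (\<lambda>z. f z + y) \<le> ereal (Re (h 0))"
        unfolding poisson_functional_def
        by (rule ereal_integral_le_disc_algebra[OF h(1)])
          (use d1(2)[of y] y in \<open>auto simp: add.commute intro: less_imp_le\<close>)
      then have "poisson_functional \<phi> (\<lambda>z. f z + y) < c" using h(3) by (rule order_le_less_trans)
      moreover have "(\<lambda>z. f z + y) \<in> D" using d2(2)[OF y(2)] .
      moreover have "f 0 + y = x'" by (simp add: f(2) y_def)
      ultimately show "x' \<in> {x \<in> X. disc_envelope D (poisson_functional \<phi>) x < c}"
        using x'(1) by (auto simp: disc_envelope_less_iff)
    qed (use d1 d2 in auto)
  qed auto
qed

text \<open>The left side is the envelope over all discs with boundary in \<open>W\<close>, since
  patching does not control the class of the disc it produces. Only if \<open>D\<close> consists of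
  all these discs is this a submean inequality for one and the same function.\<close>

lemma disc_envelope_le_poisson_functional:
  fixes X W :: "(complex ^ 'n) set"
  assumes X: "open X" and W: "open W" and \<phi>: "usc_on W \<phi>"
    and D: "D \<subseteq> analytic_discs_bdry X W" "translation_stable D"
    and hom: "\<And>f1 f2. f1 \<in> D \<Longrightarrow> f2 \<in> D \<Longrightarrow> f1 0 = f2 0 \<Longrightarrow> centre_homotopic X W f1 f2"
    and cover: "\<And>x. x \<in> X \<Longrightarrow> \<exists>f\<in>D. f 0 = x"
    and g: "g \<in> analytic_discs_bdry X X"
  shows "disc_envelope (analytic_discs_bdry X W) (poisson_functional \<phi>) (g 0)
    \<le> poisson_functional (disc_envelope D (poisson_functional \<phi>)) g"
proof (rule ccontr)
  assume "\<not> ?thesis"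
  then have lt: "poisson_functional (disc_envelope D (poisson_functional \<phi>)) g
      < disc_envelope (analytic_discs_bdry X W) (poisson_functional \<phi>) (g 0)" (is "_ < ?E") by simp
  obtain h where h: "h \<in> disc_algebra"
    "\<And>z. z \<in> sphere 0 1 \<Longrightarrow> disc_envelope D (poisson_functional \<phi>) (g z) < ereal (Re (h z))" "ereal (Re (h 0)) < ?E"
    using poisson_functional_majorant[OF g usc_on_disc_envelope[OF W \<phi> D cover] lt] by blast
  obtain a where a: "ereal (Re (h 0)) < ereal a" "ereal a < ?E" using ereal_dense2[OF h(3)] by blast
  have ga: "g \<in> analytic_discs X" using g by (simp add: analytic_discs_bdry_def)
  have pos: "a - Re (h 0) > 0" using a(1) by simp
  obtain f where f: "f \<in> analytic_discs_bdry X W" "f 0 = g 0" "poisson_functional \<phi> f < ereal (Re (h 0) + (a - Re (h 0)))"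
    by (rule homotopic_discs_patching[OF X W \<phi> D hom ga h(1) pos h(2)]) (assumption | blast)+
  then have "?E < ereal a" unfolding disc_envelope_less_iff by auto
  then show False using a(2) by simp
qed

section \<open>Centre-homotopies\<close>

lemma centre_homotopic_sym:
  assumes "centre_homotopic X W f0 f1"
  shows "centre_homotopic X W f1 f0"
proof -
  obtain F where F: "f0 \<in> analytic_discs_bdry X W" "f1 \<in> analytic_discs_bdry X W" "f0 0 = f1 0"
    "continuous_on (cball 0 1 \<times> {0..1}) F" "\<And>t. t \<in> {0..1} \<Longrightarrow> (\<lambda>z. F (z, t)) \<in> analytic_discs_bdry X W"
    "\<And>z. z \<in> cball 0 1 \<Longrightarrow> F (z, 0) = f0 z \<and> F (z, 1) = f1 z" "\<And>t. t \<in> {0..1::real} \<Longrightarrow> F (0, t) = f0 0"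
    using assms unfolding centre_homotopic_def by blast
  show ?thesis
    unfolding centre_homotopic_def
  proof (intro conjI exI[of _ "\<lambda>u. F (fst u, 1 - snd u)"] ballI)
    show "continuous_on (cball 0 1 \<times> {0..1}) (\<lambda>u. F (fst u, 1 - snd u))"
      by (intro continuous_on_compose2[OF F(4)] continuous_intros) auto
  qed (use F in auto)
qed

lemma centre_homotopic_trans:
  assumes "centre_homotopic X W f0 f1" "centre_homotopic X W f1 f2"
  shows "centre_homotopic X W f0 f2"
proof -
  obtain F where F: "f0 \<in> analytic_discs_bdry X W" "f1 \<in> analytic_discs_bdry X W" "f0 0 = f1 0"
    "continuous_on (cball 0 1 \<times> {0..1}) F" "\<And>t. t \<in> {0..1} \<Longrightarrow> (\<lambda>z. F (z, t)) \<in> analytic_discs_bdry X W"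
    "\<And>z. z \<in> cball 0 1 \<Longrightarrow> F (z, 0) = f0 z \<and> F (z, 1) = f1 z" "\<And>t. t \<in> {0..1::real} \<Longrightarrow> F (0, t) = f0 0"
    using assms(1) unfolding centre_homotopic_def by blast
  obtain G where G: "f2 \<in> analytic_discs_bdry X W" "f1 0 = f2 0"
    "continuous_on (cball 0 1 \<times> {0..1}) G" "\<And>t. t \<in> {0..1} \<Longrightarrow> (\<lambda>z. G (z, t)) \<in> analytic_discs_bdry X W"
    "\<And>z. z \<in> cball 0 1 \<Longrightarrow> G (z, 0) = f1 z \<and> G (z, 1) = f2 z" "\<And>t. t \<in> {0..1::real} \<Longrightarrow> G (0, t) = f1 0"
    using assms(2) unfolding centre_homotopic_def by blast
  define H where "H u = (if snd u \<le> 1/2 then F (fst u, 2 * snd u) else G (fst u, 2 * snd u - 1))" for u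
  have H1: "H (z, t) = F (z, 2 * t)" if "t \<le> 1/2" for z t using that by (simp add: H_def)
  have H2: "H (z, t) = G (z, 2 * t - 1)" if "\<not> t \<le> 1/2" for z t using that by (simp add: H_def)
  show ?thesis
    unfolding centre_homotopic_def
  proof (intro conjI exI[of _ H] ballI)
    show "continuous_on (cball 0 1 \<times> {0..1}) H"
      unfolding H_def
    proof (rule continuous_on_cases_le)
      show "continuous_on {u \<in> cball 0 1 \<times> {0..1}. snd u \<le> 1/2} (\<lambda>u. F (fst u, 2 * snd u))"
        by (intro continuous_on_compose2[OF F(4)] continuous_intros) auto
      show "continuous_on {u \<in> cball 0 1 \<times> {0..1}. 1/2 \<le> snd u} (\<lambda>u. G (fst u, 2 * snd u - 1))"
        by (intro continuous_on_compose2[OF G(3)] continuous_intros) auto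
      show "F (fst u, 2 * snd u) = G (fst u, 2 * snd u - 1)" if "u \<in> cball 0 1 \<times> {0..1}" "snd u = 1/2" for u
      proof -
        have "fst u \<in> cball 0 1" using that(1) by auto
        moreover have "2 * snd u = 1" using that(2) by simp
        ultimately show ?thesis using F(6) G(5) by (simp only: diff_self)
      qed
    qed (intro continuous_intros)
    fix t :: real assume t: "t \<in> {0..1}"
    show "(\<lambda>z. H (z, t)) \<in> analytic_discs_bdry X W"
      by (cases "t \<le> 1/2") (use t in \<open>auto simp: H1 H2 intro!: F(5) G(4)\<close>)
    show "H (0, t) = f0 0"
      by (cases "t \<le> 1/2") (use t F(3,7) G(6) in \<open>auto simp: H1 H2\<close>)
  next
    fix z :: complex assume z: "z \<in> cball 0 1"
    show "H (z, 0) = f0 z" "H (z, 1) = f2 z"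
      using H1[of 0 z] H2[of 1 z] F(6)[OF z] G(5)[OF z] by auto
  qed (use F G in auto)
qed

text \<open>The image of the whole homotopy is compact in \<open>X\<close>, that of its boundary
  part compact in \<open>W\<close>, so one translation by a small vector moves all its discs
  simultaneously.\<close>

lemma centre_homotopic_translate:
  fixes f0 :: "complex \<Rightarrow> complex ^ 'n"
  assumes X: "open X" and W: "open W" and "centre_homotopic X W f0 f1"
  obtains d where "d > 0" "\<And>y. norm y < d \<Longrightarrow> centre_homotopic X W (\<lambda>z. f0 z + y) (\<lambda>z. f1 z + y)"
proof -
  obtain F where F: "f0 0 = f1 0"
    "continuous_on (cball 0 1 \<times> {0..1}) F" "\<And>t. t \<in> {0..1} \<Longrightarrow> (\<lambda>z. F (z, t)) \<in> analytic_discs_bdry X W"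
    "\<And>z. z \<in> cball 0 1 \<Longrightarrow> F (z, 0) = f0 z \<and> F (z, 1) = f1 z" "\<And>t. t \<in> {0..1::real} \<Longrightarrow> F (0, t) = f0 0"
    and f: "f0 \<in> analytic_discs_bdry X W" "f1 \<in> analytic_discs_bdry X W"
    using assms(3) unfolding centre_homotopic_def by blast
  have FX: "F u \<in> X" if "u \<in> cball 0 1 \<times> {0..1}" for u
    using F(3)[of "snd u"] that by (auto simp: analytic_discs_bdry_def analytic_discs_def image_subset_iff)
  have FW: "F u \<in> W" if "u \<in> sphere 0 1 \<times> {0..1}" for u
    using F(3)[of "snd u"] that by (auto simp: analytic_discs_bdry_def image_subset_iff)
  obtain d1 where d1: "d1 > 0" "\<And>x y. x \<in> F ` (cball 0 1 \<times> {0..1}) \<Longrightarrow> norm y \<le> d1 \<Longrightarrow> x + y \<in> X"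
  proof (rule compact_in_open_translate[OF _ X, of "F ` (cball 0 1 \<times> {0..1})"])
    show "compact (F ` (cball 0 1 \<times> {0..1}))" by (intro compact_continuous_image F compact_Times) auto
    show "F ` (cball 0 1 \<times> {0..1}) \<subseteq> X" using FX by blast
  qed blast
  obtain d2 where d2: "d2 > 0" "\<And>x y. x \<in> F ` (sphere 0 1 \<times> {0..1}) \<Longrightarrow> norm y \<le> d2 \<Longrightarrow> x + y \<in> W"
  proof (rule compact_in_open_translate[OF _ W, of "F ` (sphere 0 1 \<times> {0..1})"])
    show "compact (F ` (sphere 0 1 \<times> {0..1}))"
      by (intro compact_continuous_image continuous_on_subset[OF F(2)] compact_Times) auto
    show "F ` (sphere 0 1 \<times> {0..1}) \<subseteq> W" using FW by blast
  qed blast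
  show ?thesis
  proof (rule that[of "min d1 d2"])
    show "min d1 d2 > 0" using d1 d2 by simp
    fix y :: "complex ^ 'n" assume y: "norm y < min d1 d2"
    have disc: "(\<lambda>z. F (z, t) + y) \<in> analytic_discs_bdry X W" if t: "t \<in> {0..1}" for t
    proof -
      have "(\<lambda>z. (F (z, t) + y) $ i) \<in> disc_algebra" for i
        using F(3)[OF t] unfolding vector_add_component
        by (intro disc_algebra_add disc_algebra_const) (auto simp: analytic_discs_bdry_def analytic_discs_iff)
      then show ?thesis
        using y t d1(2) d2(2) by (auto simp: analytic_discs_bdry_def analytic_discs_iff)
    qed
    \<comment> \<open>The end discs agree with the homotopy only on the closed unit disc, hence
      membership is transferred by equality there.\<close>
    have cong: "f \<in> analytic_discs_bdry X W" if "f' \<in> analytic_discs_bdry X W" "\<And>z. z \<in> cball 0 1 \<Longrightarrow> f z = f' z" for f f'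
    proof -
      have "continuous_on (cball 0 1) f"
        by (rule continuous_on_eq[of _ f']) (use that in \<open>auto simp: analytic_discs_bdry_def analytic_discs_def\<close>)
      moreover have "(\<lambda>z. f z $ i) holomorphic_on ball 0 1" for i
        by (rule holomorphic_transform[of "\<lambda>z. f' z $ i"]) (use that in \<open>auto simp: analytic_discs_bdry_def analytic_discs_def\<close>)
      ultimately show ?thesis using that by (auto simp: analytic_discs_bdry_def analytic_discs_def)
    qed
    show "centre_homotopic X W (\<lambda>z. f0 z + y) (\<lambda>z. f1 z + y)"
      unfolding centre_homotopic_def
    proof (intro conjI exI[of _ "\<lambda>u. F u + y"] ballI)
      show "(\<lambda>z. f0 z + y) \<in> analytic_discs_bdry X W" by (rule cong[OF disc[of 0]]) (use F(4) in auto)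
      show "(\<lambda>z. f1 z + y) \<in> analytic_discs_bdry X W" by (rule cong[OF disc[of 1]]) (use F(4) in auto)
      show "continuous_on (cball 0 1 \<times> {0..1}) (\<lambda>u. F u + y)" by (intro continuous_intros F)
    qed (use F disc in auto)
  qed
qed

text \<open>Linear interpolation: at every point it stays in the ball about \<open>f z\<close> that
  contains both discs, hence in \<open>X\<close>, and in \<open>W\<close> on the circle. It fixes
  the common centre.\<close>

lemma close_discs_centre_homotopic:
  fixes f :: "complex \<Rightarrow> complex ^ 'n"
  assumes X: "open X" and W: "open W" and f: "f \<in> analytic_discs_bdry X W"
  obtains e where "e > 0"
    "\<And>f0 f1. f0 \<in> analytic_discs_bdry X W \<Longrightarrow> f1 \<in> analytic_discs_bdry X W \<Longrightarrow> f0 0 = f1 0 \<Longrightarrow>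
       (\<And>z. z \<in> cball 0 1 \<Longrightarrow> dist (f0 z) (f z) < e) \<Longrightarrow> (\<And>z. z \<in> cball 0 1 \<Longrightarrow> dist (f1 z) (f z) < e) \<Longrightarrow>
       centre_homotopic X W f0 f1"
proof -
  have fc: "continuous_on (cball 0 1) f" and fX: "f ` cball 0 1 \<subseteq> X" and fW: "f ` sphere 0 1 \<subseteq> W"
    using f by (auto simp: analytic_discs_bdry_def analytic_discs_def)
  obtain d1 where d1: "d1 > 0" "\<And>x y. x \<in> f ` cball 0 1 \<Longrightarrow> norm y \<le> d1 \<Longrightarrow> x + y \<in> X"
    by (rule compact_in_open_translate[OF compact_continuous_image[OF fc] X fX]) auto
  have "compact (f ` sphere 0 1)" by (intro compact_continuous_image continuous_on_subset[OF fc]) auto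
  then obtain d2 where d2: "d2 > 0" "\<And>x y. x \<in> f ` sphere 0 1 \<Longrightarrow> norm y \<le> d2 \<Longrightarrow> x + y \<in> W"
    using compact_in_open_translate[OF _ W fW] by blast
  show ?thesis
  proof (rule that[of "min d1 d2"])
    show "min d1 d2 > 0" using d1 d2 by simp
    fix f0 f1 assume f0: "f0 \<in> analytic_discs_bdry X W" and f1: "f1 \<in> analytic_discs_bdry X W" and cen: "f0 0 = f1 0"
      and n0: "\<And>z. z \<in> cball 0 1 \<Longrightarrow> dist (f0 z) (f z) < min d1 d2" and n1: "\<And>z. z \<in> cball 0 1 \<Longrightarrow> dist (f1 z) (f z) < min d1 d2"
    define F where "F u = f0 (fst u) + of_real (snd u) *s (f1 (fst u) - f0 (fst u))" for u :: "complex \<times> real"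
    have c: "continuous_on (cball 0 1) f0" "continuous_on (cball 0 1) f1"
      using f0 f1 by (auto simp: analytic_discs_bdry_def analytic_discs_def)
    have near: "norm (F (z, t) - f z) \<le> min d1 d2" if t: "t \<in> {0..1}" and z: "z \<in> cball 0 1" for t z
    proof -
      have "F (z, t) - f z = of_real (1 - t) *s (f0 z - f z) + of_real t *s (f1 z - f z)"
        by (simp add: F_def vec_eq_iff algebra_simps)
      then have "norm (F (z, t) - f z) \<le> norm (complex_of_real (1 - t) *s (f0 z - f z)) + norm (complex_of_real t *s (f1 z - f z))"
        by (simp only: norm_triangle_ineq)
      also have "\<dots> = (1 - t) * norm (f0 z - f z) + t * norm (f1 z - f z)"
        using t unfolding norm_vec_scale norm_of_real by simp
      also have "\<dots> \<le> (1 - t) * min d1 d2 + t * min d1 d2"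
        using t n0[OF z] n1[OF z] by (intro add_mono mult_left_mono) (auto simp: dist_norm less_imp_le)
      finally show ?thesis by (simp add: algebra_simps)
    qed
    have disc: "(\<lambda>z. F (z, t)) \<in> analytic_discs_bdry X W" if t: "t \<in> {0..1}" for t
    proof -
      have "(\<lambda>z. F (z, t) $ i) \<in> disc_algebra" for i
        unfolding F_def fst_conv snd_conv vector_add_component vector_smult_component vector_minus_component
        by (intro disc_algebra_add disc_algebra_mult disc_algebra_const disc_algebra_diff)
          (use f0 f1 in \<open>auto simp: analytic_discs_bdry_def analytic_discs_iff\<close>)
      moreover have "F (z, t) \<in> X" if "z \<in> cball 0 1" for z
        using d1(2)[of "f z" "F (z, t) - f z"] near[OF t that] that by auto
      moreover have "F (z, t) \<in> W" if "z \<in> sphere 0 1" for z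
        using d2(2)[of "f z" "F (z, t) - f z"] near[OF t, of z] that by auto
      ultimately show ?thesis by (auto simp: analytic_discs_bdry_def analytic_discs_iff)
    qed
    show "centre_homotopic X W f0 f1"
      unfolding centre_homotopic_def
    proof (intro conjI exI[of _ F] ballI)
      show "continuous_on (cball 0 1 \<times> {0..1}) F"
        unfolding F_def by (intro continuous_intros continuous_on_compose2[OF c(1)] continuous_on_compose2[OF c(2)]) auto
    qed (use f0 f1 cen disc in \<open>auto simp: F_def\<close>)
  qed
qed

lemma analytic_discs_full_bdry [simp]: "analytic_discs_bdry X X = analytic_discs X"
  by (auto simp: analytic_discs_bdry_def analytic_discs_def)

lemma disc_algebra_scale:
  assumes h: "h \<in> disc_algebra" and r: "0 \<le> r" "r \<le> 1"
  shows "(\<lambda>w. h (of_real r * w)) \<in> disc_algebra"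
proof (cases "r = 0")
  case False
  then show ?thesis using disc_algebra_affine[OF h, of r 0] r by simp
qed simp

text \<open>With no separate boundary condition every disc contracts to its centre through
  \<open>f ((1 - t) * z)\<close>; two discs with the same centre are joined through the constant
  one.\<close>

lemma centre_homotopic_full:
  fixes f0 f1 :: "complex \<Rightarrow> complex ^ 'n"
  assumes "f0 \<in> analytic_discs X" "f1 \<in> analytic_discs X" "f0 0 = f1 0"
  shows "centre_homotopic X X f0 f1"
proof -
  have const: "centre_homotopic X X f (\<lambda>_. f 0)" if f: "f \<in> analytic_discs X" for f :: "complex \<Rightarrow> complex ^ 'n"
    unfolding centre_homotopic_def analytic_discs_full_bdry
  proof (intro conjI exI[of _ "\<lambda>u. f (of_real (1 - snd u) * fst u)"] ballI)
    have le: "norm (of_real (1 - t) * z) \<le> 1" if "t \<in> {0..1}" "norm z \<le> 1" for t and z :: complex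
      using that mult_le_one[of "1 - t" "norm z"] by (simp add: norm_mult del: of_real_diff)
    have fc: "continuous_on (cball 0 1) f" using f by (simp add: analytic_discs_def)
    show "continuous_on (cball 0 1 \<times> {0..1}) (\<lambda>u. f (of_real (1 - snd u) * fst u))"
      by (intro continuous_on_compose2[OF fc] continuous_intros) (use le in auto)
    have disc: "(\<lambda>z. f (of_real (1 - t) * z)) \<in> analytic_discs X" if "t \<in> {0..1}" for t
      unfolding analytic_discs_iff
    proof (intro conjI allI)
      show "(\<lambda>z. f (of_real (1 - t) * z) $ i) \<in> disc_algebra" for i
        by (rule disc_algebra_scale[where h = "\<lambda>z. f z $ i"]) (use f that in \<open>auto simp: analytic_discs_iff\<close>)
      have "of_real (1 - t) * z \<in> cball 0 1" if "z \<in> cball 0 1" for z :: complex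
        using le[OF \<open>t \<in> {0..1}\<close>, of z] that by simp
      moreover have "f ` cball 0 1 \<subseteq> X" using f by (simp add: analytic_discs_iff)
      ultimately show "(\<lambda>z. f (of_real (1 - t) * z)) ` cball 0 1 \<subseteq> X" by blast
    qed
    then show "(\<lambda>z. f (of_real (1 - snd (z, t)) * fst (z, t))) \<in> analytic_discs X" if "t \<in> {0..1}" for t
      using that by simp
    show "(\<lambda>_. f 0) \<in> analytic_discs X" using disc[of 1] by simp
  qed (use f in auto)
  show ?thesis
    using centre_homotopic_trans[OF const[OF assms(1)]] centre_homotopic_sym[OF const[OF assms(2)]] assms(3) by simp
qed

lemma translation_stable_full:
  assumes "open X"
  shows "translation_stable (analytic_discs X)"
  unfolding translation_stable_def
proof
  fix f assume f: "f \<in> analytic_discs X"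
  have "centre_homotopic X X f f" using centre_homotopic_full[OF f f] by simp
  then obtain d where "d > 0" "\<And>y. norm y < d \<Longrightarrow> centre_homotopic X X (\<lambda>z. f z + y) (\<lambda>z. f z + y)"
    using centre_homotopic_translate[OF assms assms] by blast
  then show "\<exists>d>0. \<forall>y. norm y < d \<longrightarrow> (\<lambda>z. f z + y) \<in> analytic_discs X"
    unfolding centre_homotopic_def analytic_discs_full_bdry by blast
qed

lemma const_analytic_disc: "x \<in> X \<Longrightarrow> (\<lambda>_. x) \<in> analytic_discs X"
  by (auto simp: analytic_discs_iff)

text \<open>For W = X and the class of all discs, \<open>disc_envelope_le_poisson_functional\<close>
  has the same envelope on both sides and becomes the submean inequality along every analytic disc,
  in particular along affine ones.\<close>

lemma poisson_envelope_PSH: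
  fixes X :: "(complex ^ 'n) set"
  assumes X: "open X" and \<psi>: "usc_on X \<psi>"
  shows "disc_envelope (analytic_discs X) (poisson_functional \<psi>) \<in> PSH X" (is "?v \<in> _")
proof -
  have usc: "usc_on X ?v"
    by (rule usc_on_disc_envelope[OF X \<psi> _ translation_stable_full[OF X]]) (auto intro: const_analytic_disc)
  have sub: "?v (g 0) \<le> poisson_functional ?v g" if g: "g \<in> analytic_discs X" for g
  proof -
    have "disc_envelope (analytic_discs_bdry X X) (poisson_functional \<psi>) (g 0) \<le> poisson_functional ?v g"
    proof (rule disc_envelope_le_poisson_functional[OF X X \<psi> _ translation_stable_full[OF X]])
      show "centre_homotopic X X f1 f2" if "f1 \<in> analytic_discs X" "f2 \<in> analytic_discs X" "f1 0 = f2 0" for f1 f2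
        using that by (rule centre_homotopic_full)
      show "\<exists>f\<in>analytic_discs X. f 0 = x" if "x \<in> X" for x
        using const_analytic_disc[OF that] by (intro bexI[of _ "\<lambda>_. x"]) auto
    qed (use g in auto)
    then show ?thesis by simp
  qed
  have "subharmonic_on {z. a + z *s b \<in> X} (\<lambda>z. ?v (a + z *s b))" for a b
    unfolding subharmonic_on_def
  proof (intro conjI allI impI)
    show "usc_on {z. a + z *s b \<in> X} (\<lambda>z. ?v (a + z *s b))"
      by (rule usc_on_compose[OF usc]) (auto intro!: continuous_intros)
    fix c :: complex and r :: real assume r: "r > 0 \<and> cball c r \<subseteq> {z. a + z *s b \<in> X}"
    have "(\<lambda>z. a + (c + of_real r * z) *s b) \<in> analytic_discs X"
      unfolding analytic_discs_iff
    proof (intro conjI allI)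
      show "(\<lambda>z. (a + (c + of_real r * z) *s b) $ i) \<in> disc_algebra" for i
        unfolding vector_add_component vector_smult_component
        by (intro disc_algebra_add disc_algebra_mult disc_algebra_const disc_algebra_id)
      show "(\<lambda>z. a + (c + of_real r * z) *s b) ` cball 0 1 \<subseteq> X"
      proof
        fix x assume "x \<in> (\<lambda>z. a + (c + of_real r * z) *s b) ` cball 0 1"
        then obtain z where z: "norm z \<le> 1" "x = a + (c + of_real r * z) *s b" by auto
        have "c + of_real r * z \<in> cball c r" using z(1) r by (simp add: dist_norm norm_mult mult_left_le)
        then show "x \<in> X" using r z(2) by auto
      qed
    qed
    from sub[OF this] show "?v (a + c *s b) \<le> ereal_integral circle_measure (\<lambda>z. ?v (a + (c + of_real r * z) *s b))"
      by (simp add: poisson_functional_def)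
  qed
  then show ?thesis using usc by (simp add: PSH_def)
qed

text \<open>Comparison with all real upper bounds \<open>a\<close> of \<open>\<psi> x\<close> avoids
  a case distinction for infinite values.\<close>

lemma poisson_functional_const: "poisson_functional \<psi> (\<lambda>_. x) \<le> \<psi> x"
proof (rule ereal_le_real)
  fix a assume "\<psi> x \<le> ereal a"
  then have "ereal_integral circle_measure (\<lambda>_. \<psi> x) \<le> ereal (Re (of_real a))"
    by (intro ereal_integral_le_disc_algebra[where h = "\<lambda>_. of_real a"]) auto
  then show "poisson_functional \<psi> (\<lambda>_. x) \<le> ereal a" by (simp add: poisson_functional_def)
qed

text \<open>Closing the family under homotopy makes it stable under small translations, which the
  discs of the structure alone need not be, without losing that members with a common centre are
  homotopic.\<close>

definition disc_structure_class ::
  "(complex ^ 'n) set \<Rightarrow> (complex ^ 'n) set \<Rightarrow> 'i set \<Rightarrow> ('i \<Rightarrow> (complex ^ 'n) set) \<Rightarrow>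
     ('i \<Rightarrow> complex ^ 'n \<Rightarrow> complex \<Rightarrow> complex ^ 'n) \<Rightarrow> (complex \<Rightarrow> complex ^ 'n) set" where
  "disc_structure_class X W I U \<beta> = {f. \<exists>\<nu>\<in>I. f 0 \<in> U \<nu> \<and> centre_homotopic X W f (\<beta> \<nu> (f 0))}"

lemma disc_structure_class_homotopic:
  assumes "disc_structure X W I U \<beta>" "f1 \<in> disc_structure_class X W I U \<beta>" "f2 \<in> disc_structure_class X W I U \<beta>" "f1 0 = f2 0"
  shows "centre_homotopic X W f1 f2"
proof -
  obtain \<nu> \<mu> where 1: "\<nu> \<in> I" "f1 0 \<in> U \<nu>" "centre_homotopic X W f1 (\<beta> \<nu> (f1 0))"
    and 2: "\<mu> \<in> I" "f1 0 \<in> U \<mu>" "centre_homotopic X W f2 (\<beta> \<mu> (f1 0))"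
    using assms(2-4) unfolding disc_structure_class_def by auto
  have "centre_homotopic X W (\<beta> \<nu> (f1 0)) (\<beta> \<mu> (f1 0))"
    using assms(1) 1 2 unfolding disc_structure_def by blast
  then show ?thesis
    using 1(3) centre_homotopic_sym[OF 2(3)] centre_homotopic_trans by blast
qed

lemma disc_family_subset_class:
  assumes "disc_structure X W I U \<beta>"
  shows "disc_family I U \<beta> \<subseteq> disc_structure_class X W I U \<beta>"
proof
  fix f assume "f \<in> disc_family I U \<beta>"
  then obtain \<nu> x where nx: "\<nu> \<in> I" "x \<in> U \<nu>" "f = \<beta> \<nu> x" by (auto simp: disc_family_def)
  moreover have "f 0 = x" "centre_homotopic X W (\<beta> \<nu> x) (\<beta> \<nu> x)"
    using assms nx unfolding disc_structure_def by blast+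
  ultimately show "f \<in> disc_structure_class X W I U \<beta>" by (auto simp: disc_structure_class_def)
qed

text \<open>With x the centre of f, f + y is homotopic to \<beta> \<nu> x + y by translating the
  given homotopy, and that disc to \<beta> \<nu> (x + y) because both are uniformly close to \<beta>
  \<nu> x. The continuity of \<beta> \<nu> is what the second step rests on.\<close>

lemma disc_structure_class_translation_stable:
  fixes X W :: "(complex ^ 'n) set"
  assumes X: "open X" and W: "open W" and \<beta>: "disc_structure X W I U \<beta>"
  shows "translation_stable (disc_structure_class X W I U \<beta>)"
  unfolding translation_stable_def
proof
  fix f assume "f \<in> disc_structure_class X W I U \<beta>"
  then obtain \<nu> where \<nu>: "\<nu> \<in> I" "f 0 \<in> U \<nu>" "centre_homotopic X W f (\<beta> \<nu> (f 0))"
    by (auto simp: disc_structure_class_def)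
  define x where "x = f 0"
  have U: "open (U \<nu>)"
    using \<beta> \<nu>(1) X unfolding disc_structure_def by (meson openin_open_trans)
  have lim: "uniform_limit (cball 0 1) (\<beta> \<nu>) (\<beta> \<nu> x) (at x within U \<nu>)"
    and \<beta>d: "\<And>y. y \<in> U \<nu> \<Longrightarrow> \<beta> \<nu> y \<in> analytic_discs_bdry X W" and \<beta>0: "\<And>y. y \<in> U \<nu> \<Longrightarrow> \<beta> \<nu> y 0 = y"
    using \<beta> \<nu>(1,2) unfolding disc_structure_def x_def by blast+
  have x: "x \<in> U \<nu>" using \<nu>(2) by (simp add: x_def)
  obtain d1 where d1: "d1 > 0" "\<And>y. norm y < d1 \<Longrightarrow> centre_homotopic X W (\<lambda>z. f z + y) (\<lambda>z. \<beta> \<nu> x z + y)"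
    using centre_homotopic_translate[OF X W \<nu>(3)] unfolding x_def by blast
  obtain e where e: "e > 0"
    "\<And>f0 f1. f0 \<in> analytic_discs_bdry X W \<Longrightarrow> f1 \<in> analytic_discs_bdry X W \<Longrightarrow> f0 0 = f1 0 \<Longrightarrow>
       (\<And>z. z \<in> cball 0 1 \<Longrightarrow> dist (f0 z) (\<beta> \<nu> x z) < e) \<Longrightarrow> (\<And>z. z \<in> cball 0 1 \<Longrightarrow> dist (f1 z) (\<beta> \<nu> x z) < e) \<Longrightarrow>
       centre_homotopic X W f0 f1"
    by (rule close_discs_centre_homotopic[OF X W \<beta>d[OF x]]) blast
  have "\<forall>\<^sub>F y in at x within U \<nu>. \<forall>z\<in>cball 0 1. dist (\<beta> \<nu> y z) (\<beta> \<nu> x z) < e"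
    using lim e(1) by (rule uniform_limitD)
  then obtain d2 where d2: "d2 > 0"
    "\<And>y. y \<in> U \<nu> \<Longrightarrow> y \<noteq> x \<Longrightarrow> dist y x < d2 \<Longrightarrow> \<forall>z\<in>cball 0 1. dist (\<beta> \<nu> y z) (\<beta> \<nu> x z) < e"
    unfolding eventually_at by blast
  obtain d3 where d3: "d3 > 0" "ball x d3 \<subseteq> U \<nu>" using U x openE by blast
  show "\<exists>d>0. \<forall>y. norm y < d \<longrightarrow> (\<lambda>z. f z + y) \<in> disc_structure_class X W I U \<beta>"
  proof (intro exI[of _ "Min {d1, d2, d3, e}"] conjI allI impI)
    fix y :: "complex ^ 'n" assume "norm y < Min {d1, d2, d3, e}"
    then have y: "norm y < d1" "norm y < d2" "norm y < d3" "norm y < e" by auto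
    have xy: "x + y \<in> U \<nu>" using d3(2) y(3) by (auto simp: dist_norm)
    have h1: "centre_homotopic X W (\<lambda>z. f z + y) (\<lambda>z. \<beta> \<nu> x z + y)" by (rule d1(2)[OF y(1)])
    have "centre_homotopic X W (\<lambda>z. \<beta> \<nu> x z + y) (\<beta> \<nu> (x + y))"
    proof (rule e(2))
      show "(\<lambda>z. \<beta> \<nu> x z + y) \<in> analytic_discs_bdry X W" using h1 by (simp add: centre_homotopic_def)
      show "\<beta> \<nu> (x + y) \<in> analytic_discs_bdry X W" by (rule \<beta>d[OF xy])
      show "\<beta> \<nu> x 0 + y = \<beta> \<nu> (x + y) 0" by (simp add: \<beta>0[OF xy] \<beta>0[OF x])
      show "dist (\<beta> \<nu> x z + y) (\<beta> \<nu> x z) < e" for z using y(4) by (simp add: dist_norm)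
      show "dist (\<beta> \<nu> (x + y) z) (\<beta> \<nu> x z) < e" if "z \<in> cball 0 1" for z
        \<comment> \<open>The limit along \<open>at x within U \<nu>\<close> says nothing at
          \<open>x\<close> itself, hence the separate case \<open>y = 0\<close>.\<close>
        using d2(2)[OF xy] y(2) that e(1) by (cases "y = 0") (auto simp: dist_norm)
    qed
    with h1 have "centre_homotopic X W (\<lambda>z. f z + y) (\<beta> \<nu> (x + y))" by (rule centre_homotopic_trans)
    then show "(\<lambda>z. f z + y) \<in> disc_structure_class X W I U \<beta>"
      using \<nu>(1) xy by (auto simp: disc_structure_class_def x_def)
  qed (use d1 d2 d3 e in auto)
qed

theorem corollary2p5:
  fixes W X :: "(complex ^ 'n) set"
    and \<phi> :: "complex ^ 'n \<Rightarrow> ereal"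
    and I :: "'i set"
    and U :: "'i \<Rightarrow> (complex ^ 'n) set"
    and \<beta> :: "'i \<Rightarrow> complex ^ 'n \<Rightarrow> complex \<Rightarrow> complex ^ 'n"
  assumes "open W" "connected W" "W \<noteq> {}"
    and "open X" "connected X" "X \<noteq> {}"
    and "W \<subseteq> X"
    and "usc_on W \<phi>"
    and "disc_structure X W I U \<beta>"
    and "\<forall>x\<in>W. disc_envelope (disc_family I U \<beta>) (poisson_functional \<phi>) x \<le> \<phi> x"
  shows "\<forall>x\<in>X. (SUP u\<in>{u \<in> PSH X. \<forall>y\<in>W. u y \<le> \<phi> y}. u x)
           = disc_envelope (analytic_discs_bdry X W) (poisson_functional \<phi>) x"
proof
  fix x assume x: "x \<in> X"
  note W = \<open>open W\<close> and X = \<open>open X\<close> and \<phi> = \<open>usc_on W \<phi>\<close> and \<beta> = \<open>disc_structure X W I U \<beta>\<close>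
  define D where "D = disc_structure_class X W I U \<beta>"
  have D: "D \<subseteq> analytic_discs_bdry X W" "translation_stable D"
    using disc_structure_class_translation_stable[OF X W \<beta>]
    by (auto simp: D_def disc_structure_class_def centre_homotopic_def)
  have hom: "\<And>f1 f2. f1 \<in> D \<Longrightarrow> f2 \<in> D \<Longrightarrow> f1 0 = f2 0 \<Longrightarrow> centre_homotopic X W f1 f2"
    unfolding D_def by (rule disc_structure_class_homotopic[OF \<beta>])
  have BD: "disc_family I U \<beta> \<subseteq> D" unfolding D_def by (rule disc_family_subset_class[OF \<beta>])
  have cover: "\<exists>f\<in>D. f 0 = y" if "y \<in> X" for y
  proof -
    have "y \<in> (\<Union>\<nu>\<in>I. U \<nu>)" using \<beta> that unfolding disc_structure_def by blast
    then obtain \<nu> where \<nu>: "\<nu> \<in> I" "y \<in> U \<nu>" by blast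
    then have "\<beta> \<nu> y \<in> D" using BD by (auto simp: disc_family_def)
    moreover have "\<beta> \<nu> y 0 = y" using \<beta> \<nu> unfolding disc_structure_def by blast
    ultimately show ?thesis by blast
  qed
  define v0 where "v0 = disc_envelope D (poisson_functional \<phi>)"
  define v where "v = disc_envelope (analytic_discs X) (poisson_functional v0)"
  have v0: "usc_on X v0" unfolding v0_def by (rule usc_on_disc_envelope[OF W \<phi> D cover])
  have v_PSH: "v \<in> PSH X" unfolding v_def by (rule poisson_envelope_PSH[OF X v0])
  have v_le: "v y \<le> \<phi> y" if y: "y \<in> W" for y
  proof -
    have "y \<in> X" using y \<open>W \<subseteq> X\<close> by blast
    then have "v y \<le> poisson_functional v0 (\<lambda>_. y)"
      unfolding v_def disc_envelope_def by (intro INF_lower) (simp add: const_analytic_disc)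
    also have "\<dots> \<le> v0 y" by (rule poisson_functional_const)
    \<comment> \<open>\<open>D\<close> contains the discs of the structure, so its infimum is no
      larger and the hypothesis on their envelope carries over.\<close>
    also have "\<dots> \<le> disc_envelope (disc_family I U \<beta>) (poisson_functional \<phi>) y"
      unfolding v0_def disc_envelope_def using BD by (intro INF_superset_mono) auto
    also have "\<dots> \<le> \<phi> y" using assms(10) y by blast
    finally show ?thesis .
  qed
  let ?E = "disc_envelope (analytic_discs_bdry X W) (poisson_functional \<phi>) x"
  \<comment> \<open>Each disc in \<open>X\<close> centred at \<open>x\<close> competes in
    \<open>v\<close>, and patching along it gives discs with boundary in \<open>W\<close> and the
    same centre.\<close>
  have "?E \<le> v x"
    unfolding v_def disc_envelope_def[of "analytic_discs X"]
  proof (rule INF_greatest)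
    fix f assume f: "f \<in> {f \<in> analytic_discs X. f 0 = x}"
    then have fX: "f \<in> analytic_discs_bdry X X" "f 0 = x" by auto
    have "disc_envelope (analytic_discs_bdry X W) (poisson_functional \<phi>) (f 0) \<le> poisson_functional v0 f"
      unfolding v0_def
      by (rule disc_envelope_le_poisson_functional[OF X W \<phi> D hom cover fX(1)])
    then show "?E \<le> poisson_functional v0 f" by (simp only: fX(2))
  qed
  also have "v x \<le> (SUP u\<in>{u \<in> PSH X. \<forall>y\<in>W. u y \<le> \<phi> y}. u x)"
    by (rule SUP_upper) (use v_PSH v_le in auto)
  finally have ge: "?E \<le> (SUP u\<in>{u \<in> PSH X. \<forall>y\<in>W. u y \<le> \<phi> y}. u x)" .
  have "(SUP u\<in>{u \<in> PSH X. \<forall>y\<in>W. u y \<le> \<phi> y}. u x) \<le> ?E"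
    unfolding disc_envelope_def
  proof (intro SUP_least INF_greatest)
    fix u f assume "u \<in> {u \<in> PSH X. \<forall>y\<in>W. u y \<le> \<phi> y}" "f \<in> {f \<in> analytic_discs_bdry X W. f 0 = x}"
    then show "u x \<le> poisson_functional \<phi> f"
      using PSH_le_poisson_functional[OF X _ _ \<phi>, of u f] by auto
  qed
  then show "(SUP u\<in>{u \<in> PSH X. \<forall>y\<in>W. u y \<le> \<phi> y}. u x) = ?E" using ge by (rule antisym)
qed

end
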